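(* For a stable assignment instance $(G,<,\mathbf{q})$ with $G=(A\cup B,E)$ and $X\in\{A,B\}$, Algorithm $X$-rotate-remove (described below) can be implemented so as to run in time $O(|E|)$.
   Context: Setting: $G=(A\cup B,E)$ finite simple bipartite graph (students $A$, schools $B$); $<_v$ a strict total order on the neighbours of each vertex $v$ (write $y>_x y'$ and $y>_x\emptyset$ for each neighbour $y$); positive integer quotas $q_b$ for $b\in B$ and $q_a=1$ for $a\in A$. An assignment is $M\subseteq E$ with each vertex $v$ in at most $q_v$ edges; $M(x)=\{y:xy\in M\}$. Edge $ab$ blocks $M$ if $b>_a M(a)$ and either $|M(b)|<q_b$ or $a>_b a'$ for some $a'\in M(b)$; $M$ is stable if no edge blocks it. $M\succeq M'$ means $M(a)\ge_a M'(a)$ for all $a\in A$; the student-optimal (resp. school-optimal) stable assignment is the stable $M$ with $M\succeq M'$ (resp. $M'\succeq M$) for all stable $M'$. $Y$ denotes the side other than $X$. For stable $M$ in an instance and $x\in X$, $s_M(x)$ is the most preferred agent $y$ in $x$'s list with $y\notin M(x)$ and $x>_y x'$ for some $x'\in M(y)$ (may not exist); if it exists and $|M(y)|=q_y$, $next_M(x)$ is the $<_y$-least element of $M(y)$, and if $|M(y)|<q_y$, $next_M(x)=\emptyset$. The $X$-rotation digraph of $M$ has vertices $X\cup Y\cup\{\emptyset\}$ and arcs $(x,s_M(x)),(s_M(x),next_M(x))$ for each $x\in X$ with $s_M(x)$ defined; a directed cycle corresponds to an $X$-rotation $\rho=y_0,x_0,\dots,y_{r-1},x_{r-1}$ ($x_iy_i\in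 M$, $s_M(x_i)=y_{i+1}$, indices mod $r$), and $M/\rho$ replaces each $x_iy_i$ by $x_iy_{i+1}$. Algorithm $X$-rotate-remove: let $M^0$ be the $Y$-optimal stable assignment, $G^0=G$, $i=0$, $D^0$ the $X$-rotation digraph of $M^0$ in $(G^0,<,\mathbf{q})$. While $D^i$ has an arc: find (i) arcs $(x',y),(y,x)$ of $D^i$ with $x$ a sink of $D^i$, or (ii) a directed cycle of $D^i$; in case (i) remove edge $x'y$ from $G^i$ to get $G^{i+1}$ and set $M^{i+1}=M^i$; in case (ii) set $M^{i+1}=M^i/\rho^i$ for the corresponding rotation $\rho^i$ and $G^{i+1}=G^i$; increment $i$ and let $D^i$ be the $X$-rotation digraph of $M^i$ in $(G^i,<,\mathbf{q})$ (preferences restricted to $G^i$). Output $M^i$ when $D^i$ has no arc. *)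

theory Defs
  imports Complex_Main "HOL-Library.Landau_Symbols"
begin

section \<open>Stable assignment instances\<close>

text \<open>
  Edges are two-element sets, so \<^term>\<open>{x, y}\<close> is the edge \<open>xy\<close>.
  \<open>pref I v y y'\<close> means \<open>y >\<^sub>v y'\<close>; it is only meaningful when \<open>y\<close> and \<open>y'\<close> are neighbours
  of \<open>v\<close>, so removing an edge from \<open>edges I\<close> restricts the preferences implicitly.
\<close>

record 'v inst =
  students :: "'v set"
  schools :: "'v set"
  edges :: "'v set set"
  pref :: "'v \<Rightarrow> 'v \<Rightarrow> 'v \<Rightarrow> bool"
  quota :: "'v \<Rightarrow> nat"

definition partners :: "'v set set \<Rightarrow> 'v \<Rightarrow> 'v set" where
  "partners M x = {y. {x, y} \<in> M}"

definition stable_assignment_instance :: "'v inst \<Rightarrow> bool" where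
  "stable_assignment_instance I \<longleftrightarrow>
     finite (students I) \<and> finite (schools I) \<and> students I \<inter> schools I = {} \<and>
     edges I \<subseteq> {{a, b} | a b. a \<in> students I \<and> b \<in> schools I} \<and>
     (\<forall>v \<in> students I \<union> schools I.
        irreflp_on (partners (edges I) v) (pref I v) \<and>
        transp_on (partners (edges I) v) (pref I v) \<and>
        totalp_on (partners (edges I) v) (pref I v)) \<and>
     (\<forall>a \<in> students I. quota I a = 1) \<and>
     (\<forall>b \<in> schools I. quota I b \<ge> 1)"

definition assignment :: "'v inst \<Rightarrow> 'v set set \<Rightarrow> bool" where
  "assignment I M \<longleftrightarrow>
     M \<subseteq> edges I \<and> (\<forall>v \<in> students I \<union> schools I. card (partners M v) \<le> quota I v)"

definition blocks :: "'v inst \<Rightarrow> 'v set set \<Rightarrow> 'v \<Rightarrow> 'v \<Rightarrow> bool" where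
  "blocks I M a b \<longleftrightarrow>
     a \<in> students I \<and> b \<in> schools I \<and> {a, b} \<in> edges I \<and>
     (\<forall>b' \<in> partners M a. pref I a b b') \<and>
     (card (partners M b) < quota I b \<or> (\<exists>a' \<in> partners M b. pref I b a a'))"

definition stable :: "'v inst \<Rightarrow> 'v set set \<Rightarrow> bool" where
  "stable I M \<longleftrightarrow> assignment I M \<and> (\<forall>a b. \<not> blocks I M a b)"

text \<open>\<open>M \<succeq> M'\<close>; each student has at most one partner, and being matched beats being unmatched.\<close>

definition students_prefer :: "'v inst \<Rightarrow> 'v set set \<Rightarrow> 'v set set \<Rightarrow> bool" where
  "students_prefer I M M' \<longleftrightarrow>
     (\<forall>a \<in> students I. \<forall>b' \<in> partners M' a. \<exists>b \<in> partners M a. b = b' \<or> pref I a b b')"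

datatype side = Students | Schools

fun opposite :: "side \<Rightarrow> side" where
  "opposite Students = Schools"
| "opposite Schools = Students"

fun members :: "'v inst \<Rightarrow> side \<Rightarrow> 'v set" where
  "members I Students = students I"
| "members I Schools = schools I"

fun side_optimal :: "side \<Rightarrow> 'v inst \<Rightarrow> 'v set set \<Rightarrow> bool" where
  "side_optimal Students I M \<longleftrightarrow> stable I M \<and> (\<forall>M'. stable I M' \<longrightarrow> students_prefer I M M')"
| "side_optimal Schools I M \<longleftrightarrow> stable I M \<and> (\<forall>M'. stable I M' \<longrightarrow> students_prefer I M' M)"

section \<open>Rotation digraphs\<close>

definition most_preferred :: "'v inst \<Rightarrow> 'v \<Rightarrow> 'v set \<Rightarrow> 'v" where
  "most_preferred I v S = (THE y. y \<in> S \<and> (\<forall>z \<in> S. z \<noteq> y \<longrightarrow> pref I v y z))"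

definition least_preferred :: "'v inst \<Rightarrow> 'v \<Rightarrow> 'v set \<Rightarrow> 'v" where
  "least_preferred I v S = (THE y. y \<in> S \<and> (\<forall>z \<in> S. z \<noteq> y \<longrightarrow> pref I v z y))"

definition s_candidates :: "'v inst \<Rightarrow> 'v set set \<Rightarrow> 'v \<Rightarrow> 'v set" where
  "s_candidates I M x =
     {y \<in> partners (edges I) x. y \<notin> partners M x \<and> (\<exists>x' \<in> partners M y. pref I y x x')}"

definition s_agent :: "'v inst \<Rightarrow> 'v set set \<Rightarrow> 'v \<Rightarrow> 'v option" where
  "s_agent I M x =
     (if s_candidates I M x = {} then None else Some (most_preferred I x (s_candidates I M x)))"

text \<open>
  Below, \<^const>\<open>None\<close> is the digraph vertex \<open>\<emptyset>\<close>. The value of \<open>next_agent\<close> is irrelevant when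
  \<^const>\<open>s_agent\<close> is undefined.
\<close>

definition next_agent :: "'v inst \<Rightarrow> 'v set set \<Rightarrow> 'v \<Rightarrow> 'v option" where
  "next_agent I M x =
     (case s_agent I M x of
        None \<Rightarrow> None
      | Some y \<Rightarrow>
          if card (partners M y) < quota I y then None
          else Some (least_preferred I y (partners M y)))"

definition rotation_arcs ::
  "side \<Rightarrow> 'v inst \<Rightarrow> 'v set set \<Rightarrow> ('v option \<times> 'v option) set" where
  "rotation_arcs X I M =
     {(Some x, Some y) | x y. x \<in> members I X \<and> s_agent I M x = Some y} \<union>
     {(Some y, next_agent I M x) | x y. x \<in> members I X \<and> s_agent I M x = Some y}"

definition directed_cycle :: "('u \<times> 'u) set \<Rightarrow> 'u list \<Rightarrow> bool" where
  "directed_cycle D vs \<longleftrightarrow>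
     vs \<noteq> [] \<and> distinct vs \<and>
     (\<forall>i < length vs. (vs ! i, vs ! (Suc i mod length vs)) \<in> D)"

text \<open>A rotation \<open>y\<^sub>0, x\<^sub>0, \<dots>, y\<^bsub>r-1\<^esub>, x\<^bsub>r-1\<^esub>\<close> is the list of the pairs \<open>(y\<^sub>i, x\<^sub>i)\<close>.\<close>

type_synonym 'v rotation = "('v \<times> 'v) list"

definition is_rotation :: "side \<Rightarrow> 'v inst \<Rightarrow> 'v set set \<Rightarrow> 'v rotation \<Rightarrow> bool" where
  "is_rotation X I M \<rho> \<longleftrightarrow>
     (\<forall>(y, x) \<in> set \<rho>. y \<in> members I (opposite X) \<and> x \<in> members I X) \<and>
     directed_cycle (rotation_arcs X I M) (concat (map (\<lambda>(y, x). [Some y, Some x]) \<rho>))"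

definition eliminate :: "'v set set \<Rightarrow> 'v rotation \<Rightarrow> 'v set set" where
  "eliminate M \<rho> =
     (M - {{x, y} | x y. (y, x) \<in> set \<rho>}) \<union>
     {{snd (\<rho> ! i), fst (\<rho> ! (Suc i mod length \<rho>))} | i. i < length \<rho>}"

section \<open>The algorithm\<close>

datatype 'v operation = Remove 'v 'v | Eliminate "'v rotation"

text \<open>
  \<open>rr_loop X I M ops M'\<close>: started with current graph \<open>edges I\<close> and current assignment \<open>M\<close>, the
  while loop can perform the iterations \<open>ops\<close> and then stop with output \<open>M'\<close>.
\<close>

inductive rr_loop ::
  "side \<Rightarrow> 'v inst \<Rightarrow> 'v set set \<Rightarrow> 'v operation list \<Rightarrow> 'v set set \<Rightarrow> bool" for X where
  stop: "rotation_arcs X I M = {} \<Longrightarrow> rr_loop X I M [] M"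
| remove: "\<lbrakk>x' \<in> members I X; y \<in> members I (opposite X);
    (Some x', Some y) \<in> rotation_arcs X I M; (Some y, x) \<in> rotation_arcs X I M;
    \<forall>z. (x, z) \<notin> rotation_arcs X I M;
    rr_loop X (I\<lparr>edges := edges I - {{x', y}}\<rparr>) M ops M'\<rbrakk>
    \<Longrightarrow> rr_loop X I M (Remove x' y # ops) M'"
| eliminate: "\<lbrakk>is_rotation X I M \<rho>; rr_loop X I (eliminate M \<rho>) ops M'\<rbrakk>
    \<Longrightarrow> rr_loop X I M (Eliminate \<rho> # ops) M'"

definition rotate_remove_run ::
  "side \<Rightarrow> 'v inst \<Rightarrow> 'v set set \<Rightarrow> 'v operation list \<Rightarrow> 'v set set \<Rightarrow> bool" where
  "rotate_remove_run X I M0 ops M \<longleftrightarrow> side_optimal (opposite X) I M0 \<and> rr_loop X I M0 ops M"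

section \<open>Machine model\<close>

text \<open>
  A random access machine with finitely many named, zero-initialised arrays of natural numbers; a
  scalar variable is cell 0 of an array. Every command and every test costs one time unit: the
  expressions of a fixed program have constant size. The only arithmetic is \<open>\<plusminus> 1\<close>, so that after
  \<open>t\<close> steps no number exceeds the input numbers by more than \<open>O(t)\<close>, and unit cost cannot be
  exploited by packing data into large numbers.
\<close>

type_synonym memory = "string \<Rightarrow> nat \<Rightarrow> nat"

datatype aexp = Const nat | Cell string aexp | Inc aexp | Dec aexp

fun aval :: "aexp \<Rightarrow> memory \<Rightarrow> nat" where
  "aval (Const n) s = n"
| "aval (Cell a e) s = s a (aval e s)"
| "aval (Inc e) s = aval e s + 1"
| "aval (Dec e) s = aval e s - 1"

datatype bexp = Less aexp aexp | Equal aexp aexp | Neg bexp | Conj bexp bexp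

fun bval :: "bexp \<Rightarrow> memory \<Rightarrow> bool" where
  "bval (Less e f) s \<longleftrightarrow> aval e s < aval f s"
| "bval (Equal e f) s \<longleftrightarrow> aval e s = aval f s"
| "bval (Neg b) s \<longleftrightarrow> \<not> bval b s"
| "bval (Conj b c) s \<longleftrightarrow> bval b s \<and> bval c s"

datatype com =
  Skip
| Store string aexp aexp
| Seq com com
| Cond bexp com com
| While bexp com

text \<open>\<open>exec c s t s'\<close>: program \<open>c\<close>, started in \<open>s\<close>, halts in \<open>s'\<close> after \<open>t\<close> time units.\<close>

inductive exec :: "com \<Rightarrow> memory \<Rightarrow> nat \<Rightarrow> memory \<Rightarrow> bool" where
  Skip: "exec Skip s 1 s"
| Store: "exec (Store a e f) s 1 (s(a := (s a)(aval e s := aval f s)))"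
| Seq: "\<lbrakk>exec c s t s'; exec d s' u s''\<rbrakk> \<Longrightarrow> exec (Seq c d) s (t + u) s''"
| CondTrue: "\<lbrakk>bval b s; exec c s t s'\<rbrakk> \<Longrightarrow> exec (Cond b c d) s (1 + t) s'"
| CondFalse: "\<lbrakk>\<not> bval b s; exec d s t s'\<rbrakk> \<Longrightarrow> exec (Cond b c d) s (1 + t) s'"
| WhileFalse: "\<not> bval b s \<Longrightarrow> exec (While b c) s 1 s"
| WhileTrue: "\<lbrakk>bval b s; exec c s t s'; exec (While b c) s' u s''\<rbrakk>
    \<Longrightarrow> exec (While b c) s (1 + t + u) s''"

lemma exec_deterministic:
  "exec c s t s' \<Longrightarrow> exec c s u s'' \<Longrightarrow> u = t \<and> s'' = s'"
proof (induction arbitrary: u s'' rule: exec.induct)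
  case (Skip s)
  then show ?case by cases simp
next
  case (Store a e f s)
  then show ?case by cases simp
next
  case (Seq c s t s' d v r)
  from Seq.prems show ?case by cases (use Seq.IH in blast)
next
  case (CondTrue b s c t s' d)
  from CondTrue.prems show ?case by cases (use CondTrue in blast)+
next
  case (CondFalse b s d t s' c)
  from CondFalse.prems show ?case by cases (use CondFalse in blast)+
next
  case (WhileFalse b s c)
  from WhileFalse.prems show ?case by cases (use WhileFalse in simp_all)
next
  case (WhileTrue b s c t s' v r)
  from WhileTrue.prems show ?case by cases (use WhileTrue.hyps WhileTrue.IH in blast)+
qed

section \<open>Input and output\<close>

text \<open>A list occupies an array with its length in cell 0 and its elements in cells 1, 2, \<open>\<dots>\<close>\<close>

definition list_array :: "nat list \<Rightarrow> nat \<Rightarrow> nat" where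
  "list_array xs i = (if i \<le> length xs then (length xs # xs) ! i else 0)"

definition stores :: "memory \<Rightarrow> string \<Rightarrow> nat list \<Rightarrow> bool" where
  "stores s a xs \<longleftrightarrow> (\<forall>i \<le> length xs. s a i = list_array xs i)"

definition is_pref_list :: "'v inst \<Rightarrow> 'v \<Rightarrow> 'v list \<Rightarrow> bool" where
  "is_pref_list I v ys \<longleftrightarrow>
     distinct ys \<and> set ys = partners (edges I) v \<and> sorted_wrt (pref I v) ys"

text \<open>
  The preference lists, best partner first, of the agents of one side, concatenated in an arbitrary
  order of the agents; each list entry is tagged with its owner. Thus every edge occurs exactly
  once, and an isolated agent does not occur at all.
\<close>

definition pref_table :: "'v inst \<Rightarrow> side \<Rightarrow> ('v \<times> 'v) list \<Rightarrow> bool" where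
  "pref_table I Z ps \<longleftrightarrow>
     (\<exists>vs L. distinct vs \<and> set vs = members I Z \<and> (\<forall>v \<in> set vs. is_pref_list I v (L v)) \<and>
        ps = concat (map (\<lambda>v. map (Pair v) (L v)) vs))"

definition input_memory :: "nat inst \<Rightarrow> memory \<Rightarrow> bool" where
  "input_memory I s \<longleftrightarrow>
     (\<exists>ps qs. pref_table I Students ps \<and> pref_table I Schools qs \<and>
        s = (\<lambda>_ _. 0)
          (''student_owner'' := list_array (map fst ps),
           ''student_entry'' := list_array (map snd ps),
           ''school_owner'' := list_array (map fst qs),
           ''school_entry'' := list_array (map snd qs),
           ''quota'' := (\<lambda>v. if v \<in> students I \<union> schools I then quota I v else 0)))"

definition stores_edges :: "memory \<Rightarrow> string \<Rightarrow> string \<Rightarrow> nat set set \<Rightarrow> bool" where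
  "stores_edges s a b M \<longleftrightarrow>
     (\<exists>es. distinct (map (\<lambda>(u, v). {u, v}) es) \<and> M = (\<lambda>(u, v). {u, v}) ` set es \<and>
        stores s a (map fst es) \<and> stores s b (map snd es))"

fun operation_code :: "nat operation \<Rightarrow> nat list" where
  "operation_code (Remove x y) = [0, x, y]"
| "operation_code (Eliminate \<rho>) = 1 # length \<rho> # concat (map (\<lambda>(y, x). [y, x]) \<rho>)"

text \<open>
  To certify that the program implements the algorithm, rather than computing the same output in
  some other way, it has to deliver a complete log of the run: the initial assignment, the operation
  performed in each iteration, and the output.
\<close>

definition output_memory ::
  "memory \<Rightarrow> nat set set \<Rightarrow> nat operation list \<Rightarrow> nat set set \<Rightarrow> bool" where
  "output_memory s M0 ops M \<longleftrightarrow>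
     stores_edges s ''initial_fst'' ''initial_snd'' M0 \<and>
     stores s ''operations'' (concat (map operation_code ops)) \<and>
     stores_edges s ''output_fst'' ''output_snd'' M"

end

theory Submission
  imports Defs
begin

text \<open>
  The two sides are treated alike: with quotas on both sides, an edge outside \<open>M\<close> blocks iff each of
  its ends is below its quota or prefers the edge to one of its edges in \<open>M\<close>. For students, who have
  quota 1, this is the definition of blocking. Deferred acceptance with \<open>Y\<close> proposing yields the
  \<open>Y\<close>-optimal stable assignment, since no rejected edge belongs to any stable assignment.

  During the main loop the partners of every \<open>y \<in> Y\<close> only improve and their number is constant, so
  the candidates for \<open>s\<^sub>M x\<close> only shrink. Hence \<open>s\<^sub>M x\<close> is found by a pointer that moves down the list
  of \<open>x\<close>, and the worst partner of \<open>y\<close> by a pointer that moves up the list of \<open>y\<close>. All out-degrees in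
  the rotation digraph are at most 1; the program follows the path from some \<open>x\<close>, keeping it on a
  stack. If the path ends in a sink, the last edge before it is removed; if it returns to an agent on
  the stack, the part of the stack from that agent on is a rotation. Every iteration is paid for by
  pointer moves, up to the number of agents on the stack.
\<close>

section \<open>Timed execution\<close>

text \<open>A bound in |E| alone leaves no time for agents without edges, nor for a matrix indexed
  by pairs of agents. Hence every pass runs over table positions, the cells of an agent rely on zero
  initialisation with 0 meaning "no position", and the two positions of an edge are matched by
  bucketing the table of \<open>Y\<close> by entry (\<open>cross\<close>). The current graph is not
  stored at all: an edge is removed only when the pointer of its end in \<open>X\<close> stands on
  it, and the pointer then passes it, so the removed edges lie behind the pointers and the graph
  survives only as a parameter of the invariant. Deferred acceptance and linking are flat loops with
  loop-free bodies, inner loops being replaced by a test at the start of the body. In the main loop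
  only the treatment of a found rotation contains further loops. The potentials count the positions
  that the pointer of their owner has not passed yet, which avoids summing list lengths over
  agents.\<close>

fun loop_free :: "com \<Rightarrow> bool" where
  "loop_free (Seq c d) \<longleftrightarrow> loop_free c \<and> loop_free d"
| "loop_free (Cond b c d) \<longleftrightarrow> loop_free c \<and> loop_free d"
| "loop_free (While b c) \<longleftrightarrow> False"
| "loop_free _ \<longleftrightarrow> True"

text \<open>The clause for \<open>While\<close> is a placeholder: \<open>sem\<close> is related to
  \<open>exec\<close> for loop-free programs only, where it lets the simplifier compute the final
  state.\<close>

primrec sem :: "com \<Rightarrow> memory \<Rightarrow> memory" where
  "sem Skip s = s"
| "sem (Store a e f) s = s(a := (s a)(aval e s := aval f s))"
| "sem (Seq c d) s = sem d (sem c s)"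
| "sem (Cond b c d) s = (if bval b s then sem c s else sem d s)"
| "sem (While b c) s = s"

text \<open>A conditional is charged for both branches, so that the bound does not depend on the
  state.\<close>

fun weight :: "com \<Rightarrow> nat" where
  "weight (Seq c d) = weight c + weight d"
| "weight (Cond b c d) = 1 + weight c + weight d"
| "weight _ = 1"

fun writes :: "com \<Rightarrow> string set" where
  "writes Skip = {}"
| "writes (Store a e f) = {a}"
| "writes (Seq c d) = writes c \<union> writes d"
| "writes (Cond b c d) = writes c \<union> writes d"
| "writes (While b c) = writes c"

text \<open>The rules for \<open>runs\<close> pass such a frame on to the next proof obligation,
  which keeps arrays that a program never writes out of the invariants.\<close>

definition frame :: "string set \<Rightarrow> memory \<Rightarrow> memory \<Rightarrow> bool" where
  "frame W s s' \<longleftrightarrow> (\<forall>a. a \<notin> W \<longrightarrow> s' a = s a)"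

lemma frameD: "frame W s s' \<Longrightarrow> a \<notin> W \<Longrightarrow> s' a = s a"
  by (simp add: frame_def)

lemma frame_trans: "frame W s s' \<Longrightarrow> frame W s' s'' \<Longrightarrow> frame W s s''"
  by (simp add: frame_def)

lemma exec_frame: "exec c s t s' \<Longrightarrow> frame (writes c) s s'"
  by (induction rule: exec.induct) (auto simp: frame_def)

lemma exec_sem: "loop_free c \<Longrightarrow> \<exists>t. exec c s t (sem c s) \<and> t \<le> weight c"
proof (induction c arbitrary: s)
  case Skip
  show ?case using exec.Skip[of s] by auto
next
  case (Store a e f)
  have "exec (Store a e f) s 1 (sem (Store a e f) s)" by (simp only: sem.simps exec.Store)
  then show ?case by (metis weight.simps(4) order_refl)
next
  case (Seq c d)
  obtain t u where "exec c s t (sem c s)" "t \<le> weight c"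
    "exec d (sem c s) u (sem d (sem c s))" "u \<le> weight d"
    using Seq by fastforce
  then show ?case by (auto intro!: exI[of _ "t + u"] exec.Seq)
next
  case (Cond b c d)
  obtain t u where "exec c s t (sem c s)" "t \<le> weight c"
    "exec d s u (sem d s)" "u \<le> weight d"
    using Cond by fastforce
  then show ?case
    using exec.CondTrue[of b s c t "sem c s" d] exec.CondFalse[of b s d u "sem d s" c]
    by (cases "bval b s") fastforce+
qed simp

text \<open>Total correctness with a time bound; by \<open>exec_deterministic\<close> the witnesses
  are unique.\<close>

definition runs :: "com \<Rightarrow> memory \<Rightarrow> nat \<Rightarrow> (memory \<Rightarrow> bool) \<Rightarrow> bool" where
  "runs c s n Q \<longleftrightarrow> (\<exists>t s'. exec c s t s' \<and> t \<le> n \<and> Q s')"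

lemma runs_mono: "runs c s n Q \<Longrightarrow> n \<le> n' \<Longrightarrow> (\<And>s'. Q s' \<Longrightarrow> frame (writes c) s s' \<Longrightarrow> Q' s') \<Longrightarrow> runs c s n' Q'"
  unfolding runs_def using exec_frame by (meson order_trans)

lemma runs_loop_free: "loop_free c \<Longrightarrow> weight c \<le> n \<Longrightarrow> Q (sem c s) \<Longrightarrow> runs c s n Q"
  unfolding runs_def using exec_sem order_trans by blast

lemma runs_Seq:
  assumes "runs c s n P" and "\<And>s'. P s' \<Longrightarrow> frame (writes c) s s' \<Longrightarrow> runs d s' k Q"
  shows "runs (Seq c d) s (n + k) Q"
proof -
  obtain t s' where 1: "exec c s t s'" "t \<le> n" "P s'"
    using assms(1) by (auto simp: runs_def)
  then obtain u s'' where "exec d s' u s''" "u \<le> k" "Q s''"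
    using assms(2)[OF 1(3) exec_frame[OF 1(1)]] unfolding runs_def by blast
  with 1 show ?thesis unfolding runs_def by (meson exec.Seq add_mono)
qed

lemma runs_Cond:
  assumes "bval b s \<Longrightarrow> runs c s n Q" and "\<not> bval b s \<Longrightarrow> runs d s n Q"
  shows "runs (Cond b c d) s (Suc n) Q"
proof (cases "bval b s")
  case True
  then obtain t s' where "exec c s t s'" "t \<le> n" "Q s'"
    using assms(1) by (auto simp: runs_def)
  with True show ?thesis
    unfolding runs_def using exec.CondTrue[of b s c t s' d] by fastforce
next
  case False
  then obtain t s' where "exec d s t s'" "t \<le> n" "Q s'"
    using assms(2) by (auto simp: runs_def)
  with False show ?thesis
    unfolding runs_def using exec.CondFalse[of b s d t s' c] by fastforce
qed

text \<open>The potential method: an iteration may cost any \<open>n\<close>, provided that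
  \<open>\<Phi>\<close> drops by \<open>n\<close> and one more unit for the test. The failing last
  test accounts for \<open>Suc\<close>. The frame in the step reaches back to the state before the
  loop, not only to the previous iteration.\<close>

lemma runs_While:
  fixes \<Phi> :: "memory \<Rightarrow> nat"
  assumes "P s"
    and step: "\<And>s'. \<lbrakk>P s'; bval b s'; frame (writes c) s s'\<rbrakk>
      \<Longrightarrow> \<exists>n. runs c s' n (\<lambda>s''. P s'' \<and> \<Phi> s'' + n + 1 \<le> \<Phi> s')"
  shows "runs (While b c) s (Suc (\<Phi> s)) (\<lambda>s'. P s' \<and> \<not> bval b s')"
proof -
  have "P s' \<Longrightarrow> frame (writes c) s s' \<Longrightarrow>
      runs (While b c) s' (Suc (\<Phi> s')) (\<lambda>s'. P s' \<and> \<not> bval b s')" for s'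
  proof (induction "\<Phi> s'" arbitrary: s' rule: less_induct)
    case less
    show ?case
    proof (cases "bval b s'")
      case True
      then obtain n t s'' where 1: "exec c s' t s''" "t \<le> n" "P s''" "\<Phi> s'' + n + 1 \<le> \<Phi> s'"
        using step[OF less.prems(1) True less.prems(2)] by (auto simp: runs_def)
      have fr: "frame (writes c) s s''"
        using frame_trans[OF less.prems(2)] exec_frame[OF 1(1)] by blast
      have "\<Phi> s'' < \<Phi> s'" using 1(4) by linarith
      from less.hyps[OF this 1(3) fr]
      obtain u r where 2: "exec (While b c) s'' u r" "u \<le> Suc (\<Phi> s'')" "P r \<and> \<not> bval b r"
        unfolding runs_def by blast
      have "exec (While b c) s' (1 + t + u) r" using True 1(1) 2(1) by (rule exec.WhileTrue)
      moreover have "1 + t + u \<le> Suc (\<Phi> s')" using 1 2 by linarith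
      ultimately show ?thesis using 2(3) unfolding runs_def by blast
    next
      case False
      then show ?thesis
        using exec.WhileFalse[OF False, of c] less.prems(1) unfolding runs_def by fastforce
    qed
  qed
  then show ?thesis using assms(1) by (simp add: frame_def)
qed

text \<open>An iteration costs at most \<open>weight c\<close> plus the test, so any decreasing
  measure becomes a potential after scaling by \<open>Suc (weight c)\<close>.\<close>

lemma runs_While_loop_free:
  fixes \<Phi> :: "memory \<Rightarrow> nat"
  assumes "loop_free c" and "P s"
    and step: "\<And>s'. \<lbrakk>P s'; bval b s'; frame (writes c) s s'\<rbrakk> \<Longrightarrow> P (sem c s') \<and> \<Phi> (sem c s') < \<Phi> s'"
  shows "runs (While b c) s (Suc (Suc (weight c) * \<Phi> s)) (\<lambda>s'. P s' \<and> \<not> bval b s')"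
proof (rule runs_While[where \<Phi> = "\<lambda>s. Suc (weight c) * \<Phi> s"])
  fix s' assume "P s'" "bval b s'" "frame (writes c) s s'"
  note st = step[OF this]
  have "Suc (weight c) * Suc (\<Phi> (sem c s')) \<le> Suc (weight c) * \<Phi> s'"
    using st by (intro mult_le_mono2) simp
  then show "\<exists>n. runs c s' n (\<lambda>s''. P s'' \<and> Suc (weight c) * \<Phi> s'' + n + 1 \<le> Suc (weight c) * \<Phi> s')"
    using st by (intro exI[of _ "weight c"] runs_loop_free) (auto simp: assms(1))
qed fact

abbreviation Var :: "string \<Rightarrow> aexp" where
  "Var a \<equiv> Cell a (Const 0)"

abbreviation Assign :: "string \<Rightarrow> aexp \<Rightarrow> com" where
  "Assign a e \<equiv> Store a (Const 0) e"

abbreviation sequence :: "com \<Rightarrow> com \<Rightarrow> com" (infixr ";;" 60) where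
  "c ;; d \<equiv> Seq c d"

section \<open>Lists stored in arrays, and counted loops\<close>

definition snoc :: "(nat \<Rightarrow> nat) \<Rightarrow> nat \<Rightarrow> nat \<Rightarrow> nat" where
  "snoc f v = f(Suc (f 0) := v, 0 := Suc (f 0))"

definition Append :: "string \<Rightarrow> aexp \<Rightarrow> com" where
  "Append a e = (Store a (Inc (Var a)) e ;; Assign a (Inc (Var a)))"

lemma Append_simps [simp]:
  "sem (Append a e) s = s(a := snoc (s a) (aval e s))"
  "loop_free (Append a e)" "weight (Append a e) = 2" "writes (Append a e) = {a}"
  by (simp_all add: Append_def snoc_def)

definition holds_list :: "(nat \<Rightarrow> nat) \<Rightarrow> nat list \<Rightarrow> bool" where
  "holds_list f xs \<longleftrightarrow> (\<forall>i \<le> length xs. f i = list_array xs i)"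

lemma stores_iff_holds_list: "stores s a xs \<longleftrightarrow> holds_list (s a) xs"
  by (simp add: stores_def holds_list_def)

lemma holds_list_Nil: "f 0 = 0 \<Longrightarrow> holds_list f []"
  by (simp add: holds_list_def list_array_def)

lemma holds_list_snoc: "holds_list f xs \<Longrightarrow> holds_list (snoc f v) (xs @ [v])"
proof -
  assume a: "holds_list f xs"
  have len: "f 0 = length xs" using a by (auto simp: holds_list_def list_array_def)
  have "snoc f v i = list_array (xs @ [v]) i" if "i \<le> Suc (length xs)" for i
  proof (cases i)
    case 0
    then show ?thesis using len by (simp add: snoc_def list_array_def)
  next
    case (Suc k)
    then show ?thesis using a that len
      by (auto simp: snoc_def list_array_def nth_append holds_list_def)
  qed
  then show ?thesis by (simp add: holds_list_def)
qed

definition For :: "com \<Rightarrow> com" where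
  "For c = (Assign ''i'' (Const 1) ;;
     While (Neg (Less (Var ''m'') (Var ''i''))) (c ;; Assign ''i'' (Inc (Var ''i''))))"

lemma writes_For [simp]: "writes (For c) = insert ''i'' (writes c)"
  by (auto simp: For_def)

text \<open>\<open>P i\<close> describes the state before iteration \<open>i\<close>. Each iteration
  pays for the body, the increment and the test; the remaining 2 units are the initial assignment
  and the failing test.\<close>

lemma runs_For:
  assumes "loop_free c" and "''i'' \<notin> writes c" and "''m'' \<notin> writes c" and "s ''m'' 0 = m"
    and indep: "\<And>i s f. P i s \<Longrightarrow> P i (s(''i'' := f))" and "P 1 s"
    and step: "\<And>i s'. \<lbrakk>1 \<le> i; i \<le> m; s' ''i'' 0 = i; P i s'; frame (insert ''i'' (writes c)) s s'\<rbrakk>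
      \<Longrightarrow> P (Suc i) (sem c s')"
  shows "runs (For c) s (2 + (weight c + 2) * m) (P (Suc m))"
proof -
  define s1 where "s1 = s(''i'' := (s ''i'')(0 := 1))"
  define c' where "c' = (c ;; Assign ''i'' (Inc (Var ''i'')))"
  have keep: "sem c s' a = s' a" if "a \<notin> writes c" for s' a
    using exec_sem[OF assms(1), of s'] exec_frame frameD that by metis
  have w: "writes c' = insert ''i'' (writes c)" by (auto simp: c'_def)
  have fr1: "frame (insert ''i'' (writes c)) s s1" by (auto simp: frame_def s1_def)
  have lfc: "loop_free c'" using assms(1) by (simp add: c'_def)
  have "runs (While (Neg (Less (Var ''m'') (Var ''i''))) c') s1 (Suc (Suc (weight c') * (Suc m - s1 ''i'' 0)))
     (\<lambda>s'. (1 \<le> s' ''i'' 0 \<and> s' ''i'' 0 \<le> Suc m \<and> P (s' ''i'' 0) s')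
       \<and> \<not> bval (Neg (Less (Var ''m'') (Var ''i''))) s')"
  proof (rule runs_While_loop_free[where \<Phi> = "\<lambda>s. Suc m - s ''i'' 0", OF lfc])
    show "1 \<le> s1 ''i'' 0 \<and> s1 ''i'' 0 \<le> Suc m \<and> P (s1 ''i'' 0) s1"
      using indep[OF assms(6)] by (simp add: s1_def)
  next
    fix s'
    assume P: "1 \<le> s' ''i'' 0 \<and> s' ''i'' 0 \<le> Suc m \<and> P (s' ''i'' 0) s'"
      and b: "bval (Neg (Less (Var ''m'') (Var ''i''))) s'" and fr: "frame (writes c') s1 s'"
    have fr': "frame (insert ''i'' (writes c)) s s'" using frame_trans[OF fr1] fr w by simp
    have m: "s' ''m'' 0 = m" using frameD[OF fr'] assms(3,4) by simp
    have i: "sem c s' ''i'' 0 = s' ''i'' 0" using keep assms(2) by simp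
    have "P (Suc (s' ''i'' 0)) (sem c s')" using step P b m fr' by simp
    then show "(1 \<le> sem c' s' ''i'' 0 \<and> sem c' s' ''i'' 0 \<le> Suc m \<and> P (sem c' s' ''i'' 0) (sem c' s'))
        \<and> Suc m - sem c' s' ''i'' 0 < Suc m - s' ''i'' 0"
      using b m P i indep by (auto simp: c'_def)
  qed
  note loop = this
  have "runs (Assign ''i'' (Const 1)) s 1 (\<lambda>s'. s' = s1)"
    by (rule runs_loop_free) (auto simp: s1_def)
  then have "runs (For c) s (1 + Suc (Suc (weight c') * (Suc m - s1 ''i'' 0))) (P (Suc m))"
    unfolding For_def c'_def[symmetric]
  proof (rule runs_Seq)
    fix s' assume [simp]: "s' = s1"
    show "runs (While (Neg (Less (Var ''m'') (Var ''i''))) c') s' (Suc (Suc (weight c') * (Suc m - s1 ''i'' 0))) (P (Suc m))"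
    proof (simp only: \<open>s' = s1\<close>, rule runs_mono[OF loop])
      fix r assume r: "(1 \<le> r ''i'' 0 \<and> r ''i'' 0 \<le> Suc m \<and> P (r ''i'' 0) r)
          \<and> \<not> bval (Neg (Less (Var ''m'') (Var ''i''))) r"
        and fr: "frame (writes (While (Neg (Less (Var ''m'') (Var ''i''))) c')) s1 r"
      have "frame (insert ''i'' (writes c)) s r" using frame_trans[OF fr1] fr w by simp
      then have "r ''m'' 0 = m" using assms(3,4) frameD by fastforce
      then have "r ''i'' 0 = Suc m" using r by simp
      then show "P (Suc m) r" using r by simp
    qed simp
  qed
  then show ?thesis
    by (rule runs_mono) (auto simp: s1_def c'_def)
qed

section \<open>Preference tables\<close>

text \<open>The trace left by the concatenation in \<open>pref_table\<close>: a pointer that stays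
  between two positions of an owner cannot enter the list of another agent.\<close>

definition grouped :: "nat \<Rightarrow> (nat \<Rightarrow> 'v) \<Rightarrow> bool" where
  "grouped m ow \<longleftrightarrow>
     (\<forall>p p' p''. 1 \<le> p \<longrightarrow> p \<le> p' \<longrightarrow> p' \<le> p'' \<longrightarrow> p'' \<le> m \<longrightarrow> ow p = ow p'' \<longrightarrow> ow p' = ow p)"

lemma groupedD:
  "grouped m ow \<Longrightarrow> 1 \<le> p \<Longrightarrow> p \<le> p' \<Longrightarrow> p' \<le> p'' \<Longrightarrow> p'' \<le> m \<Longrightarrow> ow p = ow p'' \<Longrightarrow> ow p' = ow p"
  unfolding grouped_def by blast

text \<open>Positions start at 1 because cell 0 of an array holds the length; this frees position 0
  to mean "none".\<close>

definition table :: "'v inst \<Rightarrow> side \<Rightarrow> nat \<Rightarrow> (nat \<Rightarrow> 'v) \<Rightarrow> (nat \<Rightarrow> 'v) \<Rightarrow> bool" where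
  "table I Z m ow en \<longleftrightarrow>
     (\<forall>p \<in> {1..m}. ow p \<in> members I Z \<and> en p \<in> members I (opposite Z)) \<and>
     edges I = (\<lambda>p. {ow p, en p}) ` {1..m} \<and>
     inj_on (\<lambda>p. {ow p, en p}) {1..m} \<and>
     (\<forall>p p'. 1 \<le> p \<and> p < p' \<and> p' \<le> m \<and> ow p = ow p' \<longrightarrow> pref I (ow p) (en p) (en p')) \<and>
     grouped m ow"

text \<open>The program copies cells 1 to \<open>m\<close> only, so its arrays agree with the input
  tables on these cells and possibly nowhere else.\<close>

lemma table_cong:
  assumes "table I Z m ow en" and eq: "\<And>p. p \<in> {1..m} \<Longrightarrow> ow' p = ow p \<and> en' p = en p"
  shows "table I Z m ow' en'"
proof -
  have i: "(\<lambda>p. {ow' p, en' p}) ` {1..m} = (\<lambda>p. {ow p, en p}) ` {1..m}"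
    using eq by (intro image_cong) auto
  have j: "inj_on (\<lambda>p. {ow' p, en' p}) {1..m} = inj_on (\<lambda>p. {ow p, en p}) {1..m}"
    using eq by (intro inj_on_cong) auto
  have eq': "ow' p = ow p" "en' p = en p" if "1 \<le> p" "p \<le> m" for p using eq that by auto
  have k: "pref I (ow' p) (en' p) (en' p')" if "1 \<le> p" "p < p'" "p' \<le> m" "ow' p = ow' p'" for p p'
    using assms(1) that eq'[of p] eq'[of p'] unfolding table_def by simp
  have g: "grouped m ow" using assms(1) by (simp add: table_def)
  have "grouped m ow'"
    unfolding grouped_def
  proof (intro allI impI)
    fix p p' p'' assume p: "1 \<le> p" "p \<le> p'" "p' \<le> p''" "p'' \<le> m" "ow' p = ow' p''"
    have "ow p = ow p''" using p eq'[of p] eq'[of p''] by simp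
    from groupedD[OF g p(1-4) this] show "ow' p' = ow' p" using p eq'[of p] eq'[of p'] by simp
  qed
  moreover have "\<forall>p \<in> {1..m}. ow' p \<in> members I Z \<and> en' p \<in> members I (opposite Z)"
    using assms(1) eq unfolding table_def by simp
  moreover have "edges I = (\<lambda>p. {ow p, en p}) ` {1..m}" "inj_on (\<lambda>p. {ow p, en p}) {1..m}"
    using assms(1) by (simp_all only: table_def)
  ultimately show ?thesis using k unfolding table_def i j by blast
qed

lemma table_card: "table I Z m ow en \<Longrightarrow> card (edges I) = m"
  by (simp add: table_def card_image)

lemma edge_sides:
  assumes "stable_assignment_instance I" and "{u, v} \<in> edges I"
  shows "u \<in> members I Z \<longleftrightarrow> v \<in> members I (opposite Z)"
proof -
  obtain a b where "{u, v} = {a, b}" "a \<in> students I" "b \<in> schools I"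
    using assms unfolding stable_assignment_instance_def by blast
  moreover have "students I \<inter> schools I = {}"
    using assms by (simp add: stable_assignment_instance_def)
  ultimately show ?thesis by (cases Z) (auto simp: doubleton_eq_iff)
qed

lemma edge_cover:
  assumes "stable_assignment_instance I" and "e \<in> edges I"
  obtains u v where "e = {u, v}" "u \<in> members I Z" "v \<in> members I (opposite Z)"
proof -
  obtain a b where "e = {a, b}" "a \<in> students I" "b \<in> schools I"
    using assms unfolding stable_assignment_instance_def by blast
  then show ?thesis using that by (cases Z) (auto simp: insert_commute)
qed

lemma members_disjoint:
  "stable_assignment_instance I \<Longrightarrow> members I Z \<inter> members I (opposite Z) = {}"
  by (cases Z) (auto simp: stable_assignment_instance_def)

text \<open>By induction on the agents: if the first of the three indices lies in the block of the
  head, so does the last, since the head owns nothing in the tail; otherwise the block of the head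
  is dropped from all three.\<close>

lemma owners_grouped:
  assumes "distinct vs" and "i \<le> j" and "j \<le> k"
    and "k < length (concat (map (\<lambda>v. map (Pair v) (L v)) vs))"
    and "fst (concat (map (\<lambda>v. map (Pair v) (L v)) vs) ! i) = fst (concat (map (\<lambda>v. map (Pair v) (L v)) vs) ! k)"
  shows "fst (concat (map (\<lambda>v. map (Pair v) (L v)) vs) ! j) = fst (concat (map (\<lambda>v. map (Pair v) (L v)) vs) ! i)"
  using assms
proof (induction vs arbitrary: i j k)
  case Nil
  then show ?case by simp
next
  case (Cons v vs)
  let ?C = "concat (map (\<lambda>v. map (Pair v) (L v)) vs)"
  let ?n = "length (L v)"
  have C: "fst (?C ! l) \<noteq> v" if "l < length ?C" for l
    using nth_mem[OF that] Cons.prems(1) by auto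
  show ?case
  proof (cases "i < ?n")
    case True
    have "k < ?n"
    proof (rule ccontr)
      assume k: "\<not> k < ?n"
      then have "k - ?n < length ?C" using Cons.prems(4) by simp
      then show False using C[of "k - ?n"] Cons.prems(5) True k by (simp add: nth_append)
    qed
    then show ?thesis using Cons.prems True by (simp add: nth_append)
  next
    case False
    then show ?thesis
      using Cons.prems Cons.IH[of "i - ?n" "j - ?n" "k - ?n"] by (simp add: nth_append)
  qed
qed

lemma pref_table_table:
  fixes I :: "nat inst"
  assumes inst: "stable_assignment_instance I" and "pref_table I Z ps"
  shows "table I Z (length ps) (list_array (map fst ps)) (list_array (map snd ps))"
proof -
  obtain vs L where vs: "distinct vs" "set vs = members I Z"
    and L: "\<And>v. v \<in> set vs \<Longrightarrow> is_pref_list I v (L v)"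
    and ps: "ps = concat (map (\<lambda>v. map (Pair v) (L v)) vs)"
    using assms(2) unfolding pref_table_def by blast
  let ?m = "length ps" and ?o = "list_array (map fst ps)" and ?e = "list_array (map snd ps)"
  \<comment> \<open>The length in cell 0 shifts the elements by one.\<close>
  have oe: "?o p = fst (ps ! (p - 1))" "?e p = snd (ps ! (p - 1))" if "p \<in> {1..?m}" for p
    using that by (auto simp: list_array_def nth_Cons' nth_map)
  have set_ps: "set ps = {(v, y). v \<in> members I Z \<and> {v, y} \<in> edges I}"
    using L vs(2) by (auto simp: ps is_pref_list_def partners_def)
  have dist: "distinct ps"
    unfolding ps using vs(1) L
    by (induction vs) (auto simp: is_pref_list_def distinct_map inj_on_def)
  have srt: "sorted_wrt (\<lambda>u v. fst u = fst v \<longrightarrow> pref I (fst u) (snd u) (snd v)) ps"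
    unfolding ps using vs(1) L
    by (induction vs) (auto simp: is_pref_list_def sorted_wrt_append sorted_wrt_map)
  have nth: "ps ! (p - 1) \<in> set ps" if "p \<in> {1..?m}" for p
    using that by (intro nth_mem) auto
  have mem: "?o p \<in> members I Z \<and> ?e p \<in> members I (opposite Z) \<and> {?o p, ?e p} \<in> edges I"
    if "p \<in> {1..?m}" for p
  proof -
    have "(?o p, ?e p) \<in> set ps" using nth[OF that] oe[OF that] by simp
    then have "?o p \<in> members I Z" "{?o p, ?e p} \<in> edges I" using set_ps by auto
    then show ?thesis using edge_sides[OF inst] by blast
  qed
  have "edges I \<subseteq> (\<lambda>p. {?o p, ?e p}) ` {1..?m}"
  proof
    fix e assume e: "e \<in> edges I"
    then obtain u v where uv: "e = {u, v}" "u \<in> members I Z" using edge_cover[OF inst e] by metis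
    then have "(u, v) \<in> set ps" using e set_ps by auto
    then obtain i where i: "i < ?m" "ps ! i = (u, v)" by (auto simp: in_set_conv_nth)
    then have "Suc i \<in> {1..?m}" "{?o (Suc i), ?e (Suc i)} = e" using oe[of "Suc i"] uv by auto
    then show "e \<in> (\<lambda>p. {?o p, ?e p}) ` {1..?m}" by blast
  qed
  then have edges: "edges I = (\<lambda>p. {?o p, ?e p}) ` {1..?m}" using mem by blast
  have inj: "inj_on (\<lambda>p. {?o p, ?e p}) {1..?m}"
  proof (rule inj_onI)
    fix p p' assume p: "p \<in> {1..?m}" "p' \<in> {1..?m}" and eq: "{?o p, ?e p} = {?o p', ?e p'}"
    have "?o p = ?o p'" "?e p = ?e p'"
      using mem[OF p(1)] mem[OF p(2)] members_disjoint[OF inst, of Z] eq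
      by (auto simp: doubleton_eq_iff)
    then have "ps ! (p - 1) = ps ! (p' - 1)" using oe p by (metis prod_eqI)
    moreover have "p - 1 < ?m" "p' - 1 < ?m" using p by auto
    ultimately have "p - 1 = p' - 1" using nth_eq_iff_index_eq[OF dist] by blast
    then show "p = p'" using p by auto
  qed
  have pr: "pref I (?o p) (?e p) (?e p')" if "1 \<le> p" "p < p'" "p' \<le> ?m" "?o p = ?o p'" for p p'
  proof -
    have p: "p \<in> {1..?m}" "p' \<in> {1..?m}" "p - 1 < p' - 1" "p' - 1 < ?m" using that by auto
    show ?thesis
      using sorted_wrt_nth_less[OF srt p(3,4)] that(4) by (simp only: oe[OF p(1)] oe[OF p(2)])
  qed
  have gr: "?o p' = ?o p" if "1 \<le> p" "p \<le> p'" "p' \<le> p''" "p'' \<le> ?m" "?o p = ?o p''" for p p' p''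
  proof -
    have p: "p \<in> {1..?m}" "p' \<in> {1..?m}" "p'' \<in> {1..?m}" "p - 1 \<le> p' - 1" "p' - 1 \<le> p'' - 1" "p'' - 1 < ?m"
      using that by auto
    show ?thesis
      using owners_grouped[OF vs(1) p(4,5), of L, folded ps, OF p(6)] that(5)
      by (simp only: oe[OF p(1)] oe[OF p(2)] oe[OF p(3)])
  qed
  have "grouped ?m ?o" unfolding grouped_def using gr by blast
  then show ?thesis unfolding table_def using mem edges inj pr by blast
qed

text \<open>The recursion follows the scan performed by \<open>index_step\<close>; the value 0
  stands for an agent that owns no position.\<close>

fun last_pos :: "(nat \<Rightarrow> 'v) \<Rightarrow> nat \<Rightarrow> 'v \<Rightarrow> nat" where
  "last_pos ow 0 v = 0"
| "last_pos ow (Suc n) v = (if ow (Suc n) = v then Suc n else last_pos ow n v)"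

fun first_pos :: "(nat \<Rightarrow> 'v) \<Rightarrow> nat \<Rightarrow> 'v \<Rightarrow> nat" where
  "first_pos ow 0 v = 0"
| "first_pos ow (Suc n) v = (if first_pos ow n v = 0 \<and> ow (Suc n) = v then Suc n else first_pos ow n v)"

lemma last_pos_le: "last_pos ow n v \<le> n"
  by (induction n) (simp_all add: le_SucI)

lemma last_pos_owner: "last_pos ow n v \<noteq> 0 \<Longrightarrow> ow (last_pos ow n v) = v"
  by (induction n) (simp_all split: if_splits)

lemma last_pos_ge: "1 \<le> p \<Longrightarrow> p \<le> n \<Longrightarrow> p \<le> last_pos ow n (ow p)"
proof (induction n)
  case (Suc n)
  then show ?case by (cases "p = Suc n") simp_all
qed simp

lemma first_pos_bound: "first_pos ow n v \<le> n"
  by (induction n) (simp_all add: le_SucI)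

lemma first_pos_owner: "first_pos ow n v \<noteq> 0 \<Longrightarrow> ow (first_pos ow n v) = v"
  by (induction n) (simp_all split: if_splits)

lemma first_pos_le: "1 \<le> p \<Longrightarrow> p \<le> n \<Longrightarrow> 1 \<le> first_pos ow n (ow p) \<and> first_pos ow n (ow p) \<le> p"
proof (induction n)
  case (Suc n)
  show ?case
  proof (cases "p = Suc n")
    case True
    then show ?thesis using first_pos_bound[of ow n "ow p"] by simp
  next
    case False
    then show ?thesis using Suc by simp
  qed
qed simp

text \<open>The block of an owner is contiguous. This is why the program may test a pointer against
  one end of the list and then read the tables there.\<close>

lemma table_owner_between:
  assumes "table I Z m ow en" and "p \<in> {1..m}" and "first_pos ow m (ow p) \<le> r"
    and "r \<le> last_pos ow m (ow p)"
  shows "r \<in> {1..m} \<and> ow r = ow p"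
proof -
  have 1: "1 \<le> first_pos ow m (ow p)" using first_pos_le[of p m ow] assms(2) by auto
  have 2: "last_pos ow m (ow p) \<le> m" by (rule last_pos_le)
  have "ow (first_pos ow m (ow p)) = ow p" "ow (last_pos ow m (ow p)) = ow p"
    using first_pos_owner[of ow m "ow p"] last_pos_owner[of ow m "ow p"] 1 assms(3,4) by auto
  moreover have "grouped m ow" using assms(1) by (simp add: table_def)
  ultimately have "ow r = ow (first_pos ow m (ow p))"
    using groupedD[OF _ 1 assms(3,4) 2] by metis
  then show ?thesis using 1 2 assms(3,4) \<open>ow (first_pos ow m (ow p)) = ow p\<close> by auto
qed

section \<open>Edges as table positions\<close>

text \<open>
  \<open>Y\<close> is the side opposite to \<open>X\<close>. An edge is identified with its position \<open>q\<close> in the table of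
  side \<open>Y\<close>; its ends are \<open>yo q \<in> Y\<close> and \<open>ye q \<in> X\<close>, the first ranks it by \<open>q\<close> and the second by
  its position \<open>rc q\<close> in the table of side \<open>X\<close>.
\<close>

locale tables =
  fixes X :: side and I :: "'v inst" and m :: nat
    and xo xe yo ye :: "nat \<Rightarrow> 'v" and cr rc :: "nat \<Rightarrow> nat"
  assumes inst: "stable_assignment_instance I"
    and xt: "table I X m xo xe"
    and yt: "table I (opposite X) m yo ye"
    and cr_spec: "\<forall>p \<in> {1..m}. cr p \<in> {1..m} \<and> yo (cr p) = xe p \<and> ye (cr p) = xo p \<and> rc (cr p) = p"
begin

definition ids :: "nat set" where "ids = {1..m}"

definition edge :: "nat \<Rightarrow> 'v set" where "edge q = {yo q, ye q}"

abbreviation xs :: "'v set" where "xs \<equiv> members I X"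
abbreviation ys :: "'v set" where "ys \<equiv> members I (opposite X)"

lemma finite_ids [simp]: "finite ids"
  by (simp add: ids_def)

lemma opposite_opposite [simp]: "opposite (opposite Z) = Z"
  by (cases Z) simp_all

lemma disjoint: "xs \<inter> ys = {}"
  using members_disjoint[OF inst] .

lemma y_mem: "q \<in> ids \<Longrightarrow> yo q \<in> ys" and x_mem: "q \<in> ids \<Longrightarrow> ye q \<in> xs"
  using yt by (auto simp: table_def ids_def)

lemma edges_eq: "edges I = edge ` ids"
  using yt unfolding table_def ids_def edge_def by simp

lemma inj_edge: "inj_on edge ids"
  using yt unfolding table_def ids_def edge_def by simp

lemma edge_inj: "q \<in> ids \<Longrightarrow> q' \<in> ids \<Longrightarrow> yo q = yo q' \<Longrightarrow> ye q = ye q' \<Longrightarrow> q = q'"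
  using inj_edge by (auto simp: edge_def inj_on_def)

lemma cr:
  assumes "p \<in> ids" shows "cr p \<in> ids" "yo (cr p) = xe p" "ye (cr p) = xo p" "rc (cr p) = p"
  using cr_spec assms by (simp_all add: ids_def)

text \<open>An injective map of a finite set into itself is onto. Hence the left inverse
  \<open>rc\<close> is two-sided, and linking the tables has to establish only one
  composition.\<close>

lemma cr_image: "cr ` ids = ids"
proof (rule endo_inj_surj)
  show "cr ` ids \<subseteq> ids" using cr(1) by auto
  show "inj_on cr ids" using cr(4) by (metis inj_onI)
qed simp

lemma rc:
  assumes "q \<in> ids" shows "rc q \<in> ids" "cr (rc q) = q" "xo (rc q) = ye q" "xe (rc q) = yo q"
proof -
  obtain p where "p \<in> ids" "q = cr p" using cr_image assms by blast
  then show "rc q \<in> ids" "cr (rc q) = q" "xo (rc q) = ye q" "xe (rc q) = yo q" using cr by simp_all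
qed

lemma rc_inj: "q \<in> ids \<Longrightarrow> q' \<in> ids \<Longrightarrow> rc q = rc q' \<Longrightarrow> q = q'"
  using rc(2) by metis

lemma pref_asym:
  assumes "v \<in> xs \<union> ys" "u \<in> partners (edges I) v" "u' \<in> partners (edges I) v" "pref I v u u'"
  shows "\<not> pref I v u' u"
proof
  assume "pref I v u' u"
  moreover have "v \<in> students I \<union> schools I" using assms(1) by (cases X) auto
  then have "irreflp_on (partners (edges I) v) (pref I v)" "transp_on (partners (edges I) v) (pref I v)"
    using inst by (simp_all add: stable_assignment_instance_def)
  ultimately show False using assms by (meson irreflp_onD transp_onD)
qed

lemma partner_y: "q \<in> ids \<Longrightarrow> ye q \<in> partners (edges I) (yo q)"
  by (auto simp: partners_def edges_eq edge_def)

lemma partner_x: "q \<in> ids \<Longrightarrow> yo q \<in> partners (edges I) (ye q)"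
  by (auto simp: partners_def edges_eq edge_def insert_commute)

lemma pref_irrefl: "v \<in> xs \<union> ys \<Longrightarrow> u \<in> partners (edges I) v \<Longrightarrow> \<not> pref I v u u"
  using pref_asym by blast

text \<open>The table gives one direction, asymmetry of the preference the other. From here on,
  preferences of \<open>Y\<close> are comparisons of numbers; \<open>pref_x\<close> does the same
  for \<open>X\<close>.\<close>

lemma pref_y:
  assumes "q \<in> ids" "q' \<in> ids" "yo q = yo q'"
  shows "pref I (yo q) (ye q) (ye q') \<longleftrightarrow> q < q'"
proof -
  have up: "pref I (yo q) (ye q) (ye q')" if "q \<in> ids" "q' \<in> ids" "yo q = yo q'" "q < q'" for q q'
    using yt that unfolding table_def ids_def by auto
  have "\<not> pref I (yo q) (ye q) (ye q')" if "q' \<le> q"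
  proof (cases "q' = q")
    case True
    then show ?thesis using pref_irrefl partner_y y_mem assms by auto
  next
    case False
    then have "pref I (yo q) (ye q') (ye q)" using up[of q' q] that assms by simp
    then show ?thesis
      using pref_asym[of "yo q" "ye q'" "ye q"] partner_y[OF assms(1)] partner_y[OF assms(2)]
        y_mem assms by auto
  qed
  then show ?thesis using up[OF assms] by (meson not_less)
qed

lemma pref_x:
  assumes "q \<in> ids" "q' \<in> ids" "ye q = ye q'"
  shows "pref I (ye q) (yo q) (yo q') \<longleftrightarrow> rc q < rc q'"
proof -
  have up: "pref I (ye q) (yo q) (yo q')" if "q \<in> ids" "q' \<in> ids" "ye q = ye q'" "rc q < rc q'" for q q'
  proof -
    have "pref I (xo (rc q)) (xe (rc q)) (xe (rc q'))"
      using xt that rc[OF that(1)] rc[OF that(2)] unfolding table_def ids_def atLeastAtMost_iff by metis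
    then show ?thesis using rc[OF that(1)] rc[OF that(2)] by simp
  qed
  have "\<not> pref I (ye q) (yo q) (yo q')" if "rc q' \<le> rc q"
  proof (cases "rc q' = rc q")
    case True
    then have "q' = q" using rc_inj assms by blast
    then show ?thesis using pref_irrefl partner_x x_mem assms by auto
  next
    case False
    then have "pref I (ye q) (yo q') (yo q)" using up[of q' q] that assms by simp
    then show ?thesis
      using pref_asym[of "ye q" "yo q'" "yo q"] partner_x[OF assms(1)] partner_x[OF assms(2)]
        x_mem assms by auto
  qed
  then show ?thesis using up[OF assms] by (meson not_less)
qed

definition at_y :: "nat set \<Rightarrow> 'v \<Rightarrow> nat set" where "at_y H y = {q \<in> H. yo q = y}"
definition at_x :: "nat set \<Rightarrow> 'v \<Rightarrow> nat set" where "at_x H x = {q \<in> H. ye q = x}"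

lemma finite_at [simp]: "H \<subseteq> ids \<Longrightarrow> finite (at_y H y)" "H \<subseteq> ids \<Longrightarrow> finite (at_x H x)"
  using finite_subset[of H ids] by (auto simp: at_y_def at_x_def)

lemma edge_mem:
  assumes "H \<subseteq> ids" "q \<in> ids" shows "edge q \<in> edge ` H \<longleftrightarrow> q \<in> H"
  using inj_edge assms by (auto simp: inj_on_def)

lemma partners_y:
  assumes "H \<subseteq> ids" "y \<in> ys" shows "partners (edge ` H) y = ye ` at_y H y"
proof -
  have "yo q = y \<and> ye q = v" if "{y, v} = {yo q, ye q}" "q \<in> H" for q v
    using that assms x_mem[of q] disjoint by (auto simp: doubleton_eq_iff)
  then show ?thesis by (auto simp: partners_def at_y_def edge_def)
qed

lemma partners_x:
  assumes "H \<subseteq> ids" "x \<in> xs" shows "partners (edge ` H) x = yo ` at_x H x"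
proof -
  have "ye q = x \<and> yo q = v" if "{x, v} = {yo q, ye q}" "q \<in> H" for q v
    using that assms y_mem[of q] disjoint by (auto simp: doubleton_eq_iff)
  then show ?thesis by (auto simp: partners_def at_x_def edge_def insert_commute)
qed

lemma card_partners_y:
  assumes "H \<subseteq> ids" "y \<in> ys" shows "card (partners (edge ` H) y) = card (at_y H y)"
  unfolding partners_y[OF assms]
  by (rule card_image) (use edge_inj assms in \<open>auto simp: at_y_def inj_on_def subset_eq\<close>)

lemma card_partners_x:
  assumes "H \<subseteq> ids" "x \<in> xs" shows "card (partners (edge ` H) x) = card (at_x H x)"
  unfolding partners_x[OF assms]
  by (rule card_image) (use edge_inj assms in \<open>auto simp: at_x_def inj_on_def subset_eq\<close>)

section \<open>Stability and optimality in terms of positions\<close>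

definition wants :: "'v set set \<Rightarrow> 'v \<Rightarrow> 'v \<Rightarrow> bool" where
  "wants M v u \<longleftrightarrow> card (partners M v) < quota I v \<or> (\<exists>u' \<in> partners M v. pref I v u u')"

text \<open>A student has at most one partner. Without a partner both conditions on \<open>a\<close>
  hold, as quota 1 is not filled; with a partner \<open>b'\<close>, irreflexivity turns
  \<open>pref I a b b'\<close> into the additional information that \<open>b\<close> differs from
  \<open>b'\<close>.\<close>

lemma blocks_iff_wants:
  assumes "assignment I M" "a \<in> students I" "b \<in> schools I" "{a, b} \<in> edges I"
  shows "blocks I M a b \<longleftrightarrow> {a, b} \<notin> M \<and> wants M a b \<and> wants M b a"
proof -
  have a: "a \<in> xs \<union> ys" using assms(2) by (cases X) auto
  have q: "quota I a = 1" using assms(2) inst by (simp add: stable_assignment_instance_def)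
  have c: "card (partners M a) \<le> 1" using assms(1,2) q unfolding assignment_def by (metis UnI1)
  have "M \<subseteq> edges I" using assms(1) by (simp add: assignment_def)
  then have sub: "partners M a \<subseteq> partners (edges I) a" by (auto simp: partners_def)
  have "finite (edges I)" by (simp add: edges_eq)
  moreover have "inj_on (\<lambda>y. {a, y}) (partners (edges I) a)" by (auto simp: inj_on_def doubleton_eq_iff)
  moreover have "(\<lambda>y. {a, y}) ` partners (edges I) a \<subseteq> edges I" by (auto simp: partners_def)
  ultimately have "finite (partners (edges I) a)" by (meson finite_imageD finite_subset)
  then have fin: "finite (partners M a)" using sub finite_subset by blast
  have irr: "\<not> pref I a b b"
    using pref_irrefl[OF a] assms(4) by (auto simp: partners_def)
  have "(\<forall>b' \<in> partners M a. pref I a b b') \<longleftrightarrow> {a, b} \<notin> M \<and> wants M a b"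
  proof (cases "partners M a = {}")
    case True
    then show ?thesis by (auto simp: wants_def q partners_def)
  next
    case False
    then obtain b' where "partners M a = {b'}"
      using c fin by (metis card_0_eq card_1_singletonE le_antisym less_one not_le)
    then show ?thesis using irr by (auto simp: wants_def q partners_def)
  qed
  then show ?thesis using assms by (auto simp: blocks_def wants_def)
qed

definition y_wants :: "nat set \<Rightarrow> nat \<Rightarrow> bool" where
  "y_wants H q \<longleftrightarrow> card (at_y H (yo q)) < quota I (yo q) \<or> (\<exists>q' \<in> H. yo q' = yo q \<and> q < q')"

definition x_wants :: "nat set \<Rightarrow> nat \<Rightarrow> bool" where
  "x_wants H q \<longleftrightarrow> card (at_x H (ye q)) < quota I (ye q) \<or> (\<exists>q' \<in> H. ye q' = ye q \<and> rc q < rc q')"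

definition stab :: "nat set \<Rightarrow> bool" where
  "stab H \<longleftrightarrow> H \<subseteq> ids \<and> (\<forall>y \<in> ys. card (at_y H y) \<le> quota I y) \<and>
     (\<forall>x \<in> xs. card (at_x H x) \<le> quota I x) \<and>
     (\<forall>q \<in> ids - H. \<not> (y_wants H q \<and> x_wants H q))"

lemma wants_y:
  assumes "H \<subseteq> ids" "q \<in> ids" shows "wants (edge ` H) (yo q) (ye q) \<longleftrightarrow> y_wants H q"
proof -
  have "pref I (yo q) (ye q) (ye q') \<longleftrightarrow> q < q'" if "q' \<in> H" "yo q' = yo q" for q'
    using pref_y[of q q'] that assms by auto
  then have "(\<exists>u' \<in> partners (edge ` H) (yo q). pref I (yo q) (ye q) u') \<longleftrightarrow> (\<exists>q' \<in> H. yo q' = yo q \<and> q < q')"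
    unfolding partners_y[OF assms(1) y_mem[OF assms(2)]] by (auto simp: at_y_def)
  then show ?thesis
    by (simp add: wants_def y_wants_def card_partners_y[OF assms(1) y_mem[OF assms(2)]])
qed

lemma wants_x:
  assumes "H \<subseteq> ids" "q \<in> ids" shows "wants (edge ` H) (ye q) (yo q) \<longleftrightarrow> x_wants H q"
proof -
  have "pref I (ye q) (yo q) (yo q') \<longleftrightarrow> rc q < rc q'" if "q' \<in> H" "ye q' = ye q" for q'
    using pref_x[of q q'] that assms by auto
  then have "(\<exists>u' \<in> partners (edge ` H) (ye q). pref I (ye q) (yo q) u') \<longleftrightarrow> (\<exists>q' \<in> H. ye q' = ye q \<and> rc q < rc q')"
    unfolding partners_x[OF assms(1) x_mem[OF assms(2)]] by (auto simp: at_x_def)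
  then show ?thesis
    by (simp add: wants_def x_wants_def card_partners_x[OF assms(1) x_mem[OF assms(2)]])
qed

lemma assignment_iff:
  assumes "H \<subseteq> ids"
  shows "assignment I (edge ` H) \<longleftrightarrow> (\<forall>y \<in> ys. card (at_y H y) \<le> quota I y) \<and> (\<forall>x \<in> xs. card (at_x H x) \<le> quota I x)"
proof -
  have "students I \<union> schools I = xs \<union> ys" by (cases X) auto
  moreover have "edge ` H \<subseteq> edges I" using assms by (auto simp: edges_eq)
  ultimately show ?thesis
    by (simp add: assignment_def ball_Un card_partners_y[OF assms] card_partners_x[OF assms] conj_commute)
qed

lemma stable_iff:
  assumes "H \<subseteq> ids" shows "stable I (edge ` H) \<longleftrightarrow> stab H"
proof (cases "assignment I (edge ` H)")
  case True
  let ?M = "edge ` H"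
  have "(\<forall>a b. \<not> blocks I ?M a b) \<longleftrightarrow> (\<forall>q \<in> ids - H. \<not> (y_wants H q \<and> x_wants H q))"
  proof safe
    fix q assume nb: "\<forall>a b. \<not> blocks I ?M a b" and q: "q \<in> ids" "q \<notin> H" "y_wants H q" "x_wants H q"
    have w: "wants ?M (yo q) (ye q)" "wants ?M (ye q) (yo q)" using q wants_y wants_x assms by auto
    have e: "{yo q, ye q} \<in> edges I" "{yo q, ye q} \<notin> ?M"
      using q edge_mem[OF assms q(1)] by (auto simp: edges_eq edge_def)
    show False
    proof (cases X)
      case Students
      then have "blocks I ?M (ye q) (yo q)"
        using blocks_iff_wants[OF True, of "ye q" "yo q"] y_mem x_mem q e w by (simp add: insert_commute)
      then show False using nb by blast
    next
      case Schools
      then have "blocks I ?M (yo q) (ye q)"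
        using blocks_iff_wants[OF True, of "yo q" "ye q"] y_mem x_mem q e w by simp
      then show False using nb by blast
    qed
  next
    fix a b assume nw: "\<forall>q \<in> ids - H. \<not> (y_wants H q \<and> x_wants H q)" and bl: "blocks I ?M a b"
    then have ab: "a \<in> students I" "b \<in> schools I" "{a, b} \<in> edges I" by (auto simp: blocks_def)
    have w: "{a, b} \<notin> ?M" "wants ?M a b" "wants ?M b a" using blocks_iff_wants[OF True ab] bl by auto
    obtain q where q: "q \<in> ids" "{a, b} = {yo q, ye q}" using ab by (auto simp: edges_eq edge_def)
    have "q \<notin> H" using w(1) q by (auto simp: edge_def)
    moreover have "wants ?M (yo q) (ye q) \<and> wants ?M (ye q) (yo q)"
      using q(2) w by (auto simp: doubleton_eq_iff)
    ultimately show False using nw q wants_y wants_x assms by blast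
  qed
  then show ?thesis using True assms by (auto simp: stable_def stab_def assignment_iff)
next
  case False
  then show ?thesis using assms by (auto simp: stable_def stab_def assignment_iff)
qed

lemma stable_ids:
  assumes "stable I M" obtains H where "M = edge ` H" "stab H"
proof -
  have "M \<subseteq> edge ` ids" using assms by (auto simp: stable_def assignment_def edges_eq)
  then obtain H where "H \<subseteq> ids" "M = edge ` H" by (auto simp: subset_image_iff)
  then show ?thesis using that stable_iff assms by blast
qed

lemma quota_pos: "v \<in> xs \<union> ys \<Longrightarrow> 1 \<le> quota I v"
  using inst by (cases X) (auto simp: stable_assignment_instance_def)

text \<open>Optimality is defined through the students only. If they are \<open>X\<close>,
  \<open>opt_x\<close> says that they do at least as well in every other stable assignment; if they
  are \<open>Y\<close>, \<open>opt_y\<close> says that they do at least as well in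
  \<open>H\<close>.\<close>

lemma side_optimalI:
  assumes H: "stab H"
    and opt_x: "\<And>H' q. stab H' \<Longrightarrow> q \<in> H \<Longrightarrow> \<exists>q' \<in> H'. ye q' = ye q \<and> rc q' \<le> rc q"
    and opt_y: "\<And>H' q. stab H' \<Longrightarrow> q \<in> H' \<Longrightarrow> \<exists>q' \<in> H. yo q' = yo q \<and> q' \<le> q"
  shows "side_optimal (opposite X) I (edge ` H)"
proof -
  have sub: "H \<subseteq> ids" using H by (simp add: stab_def)
  have st: "stable I (edge ` H)" using H stable_iff sub by blast
  show ?thesis
  proof (cases X)
    case Students
    have "students_prefer I M' (edge ` H)" if M': "stable I M'" for M'
    proof -
      obtain H' where H': "M' = edge ` H'" "stab H'" using stable_ids[OF M'] .
      then have sub': "H' \<subseteq> ids" by (simp add: stab_def)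
      show ?thesis unfolding students_prefer_def
      proof (intro ballI)
        fix a b' assume a: "a \<in> students I" and b': "b' \<in> partners (edge ` H) a"
        have ax: "a \<in> xs" using a Students by simp
        obtain q where q: "q \<in> H" "ye q = a" "yo q = b'"
          using b' partners_x[OF sub ax] by (auto simp: at_x_def)
        obtain q' where q': "q' \<in> H'" "ye q' = a" "rc q' \<le> rc q" using opt_x[OF H'(2) q(1)] q by auto
        have i: "q \<in> ids" "q' \<in> ids" using q q' sub sub' by auto
        have "yo q' = b' \<or> pref I a (yo q') b'"
        proof (cases "rc q' = rc q")
          case True
          then show ?thesis using rc_inj i q by blast
        next
          case False
          then show ?thesis using pref_x[OF i(2,1)] q q' by simp
        qed
        moreover have "yo q' \<in> partners M' a"
          using q' partners_x[OF sub' ax] H' by (auto simp: at_x_def)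
        ultimately show "\<exists>b \<in> partners M' a. b = b' \<or> pref I a b b'" by blast
      qed
    qed
    then show ?thesis using st Students by simp
  next
    case Schools
    have "students_prefer I (edge ` H) M'" if M': "stable I M'" for M'
    proof -
      obtain H' where H': "M' = edge ` H'" "stab H'" using stable_ids[OF M'] .
      then have sub': "H' \<subseteq> ids" by (simp add: stab_def)
      show ?thesis unfolding students_prefer_def
      proof (intro ballI)
        fix a b' assume a: "a \<in> students I" and b': "b' \<in> partners M' a"
        have ay: "a \<in> ys" using a Schools by simp
        obtain q where q: "q \<in> H'" "yo q = a" "ye q = b'"
          using b' partners_y[OF sub' ay] H' by (auto simp: at_y_def)
        obtain q' where q': "q' \<in> H" "yo q' = a" "q' \<le> q" using opt_y[OF H'(2) q(1)] q by auto
        have i: "q \<in> ids" "q' \<in> ids" using q q' sub sub' by auto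
        have "ye q' = b' \<or> pref I a (ye q') b'"
        proof (cases "q' = q")
          case False
          then show ?thesis using pref_y[OF i(2,1)] q q' by simp
        qed (use q in simp)
        moreover have "ye q' \<in> partners (edge ` H) a"
          using q' partners_y[OF sub ay] by (auto simp: at_y_def)
        ultimately show "\<exists>b \<in> partners (edge ` H) a. b = b' \<or> pref I a b b'" by blast
      qed
    qed
    then show ?thesis using st Schools by simp
  qed
qed

end

section \<open>Deferred acceptance\<close>

context tables
begin

lemma at_y_insert: "at_y (insert q H) y = (if yo q = y then insert q (at_y H y) else at_y H y)"
  and at_x_insert: "at_x (insert q H) x = (if ye q = x then insert q (at_x H x) else at_x H x)"
  and at_y_remove: "at_y (H - {q}) y = at_y H y - {q}"
  and at_x_remove: "at_x (H - {q}) x = at_x H x - {q}"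
  by (auto simp: at_y_def at_x_def)

text \<open>
  \<open>H\<close> is the set of held proposals and \<open>py y\<close> the next position at which \<open>y\<close> proposes. All positions
  of \<open>x\<close> beyond \<open>wx x\<close> are rejected, and one of them has been rejected only if the quota of \<open>x\<close> is
  filled. While \<open>ov\<close> holds, \<open>xv\<close> exceeds its quota by one.
\<close>

definition da_inv ::
  "nat set \<Rightarrow> ('v \<Rightarrow> nat) \<Rightarrow> ('v \<Rightarrow> nat) \<Rightarrow> ('v \<Rightarrow> nat) \<Rightarrow> ('v \<Rightarrow> nat) \<Rightarrow> bool \<Rightarrow> 'v \<Rightarrow> bool" where
  "da_inv H py wx cx cy ov xv \<longleftrightarrow> H \<subseteq> ids \<and>
     (\<forall>q \<in> H. q < py (yo q)) \<and>
     (\<forall>y \<in> ys. cy y = card (at_y H y) \<and> cy y \<le> quota I y) \<and>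
     (\<forall>x \<in> xs. cx x = card (at_x H x) \<and> cx x \<le> (if ov \<and> x = xv then Suc (quota I x) else quota I x)) \<and>
     (ov \<longrightarrow> xv \<in> xs \<and> cx xv = Suc (quota I xv)) \<and>
     (\<forall>x \<in> xs. wx x \<le> last_pos xo m x \<and> (wx x < last_pos xo m x \<longrightarrow> quota I x \<le> cx x)) \<and>
     (\<forall>q \<in> H. rc q \<le> wx (ye q)) \<and>
     (\<forall>q \<in> ids - H. q < py (yo q) \<longrightarrow> wx (ye q) < rc q \<and> (\<forall>H'. stab H' \<longrightarrow> q \<notin> H')) \<and>
     (\<forall>q \<in> ids. first_pos yo m (yo q) \<le> py (yo q))"

lemma da_invD:
  assumes "da_inv H py wx cx cy ov xv"
  shows "H \<subseteq> ids"
    and "\<And>q. q \<in> H \<Longrightarrow> q < py (yo q)"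
    and "\<And>y. y \<in> ys \<Longrightarrow> cy y = card (at_y H y)"
    and "\<And>y. y \<in> ys \<Longrightarrow> cy y \<le> quota I y"
    and "\<And>x. x \<in> xs \<Longrightarrow> cx x = card (at_x H x)"
    and "\<And>x. x \<in> xs \<Longrightarrow> cx x \<le> (if ov \<and> x = xv then Suc (quota I x) else quota I x)"
    and "ov \<Longrightarrow> xv \<in> xs"
    and "ov \<Longrightarrow> cx xv = Suc (quota I xv)"
    and "\<And>x. x \<in> xs \<Longrightarrow> wx x \<le> last_pos xo m x"
    and "\<And>x. x \<in> xs \<Longrightarrow> wx x < last_pos xo m x \<Longrightarrow> quota I x \<le> cx x"
    and "\<And>q. q \<in> H \<Longrightarrow> rc q \<le> wx (ye q)"
    and "\<And>q. q \<in> ids \<Longrightarrow> q \<notin> H \<Longrightarrow> q < py (yo q) \<Longrightarrow> wx (ye q) < rc q"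
    and "\<And>q H'. q \<in> ids \<Longrightarrow> q \<notin> H \<Longrightarrow> q < py (yo q) \<Longrightarrow> stab H' \<Longrightarrow> q \<notin> H'"
    and "\<And>q. q \<in> ids \<Longrightarrow> first_pos yo m (yo q) \<le> py (yo q)"
  using assms unfolding da_inv_def by blast+

lemma da_invI:
  assumes "H \<subseteq> ids"
    and "\<And>q. q \<in> H \<Longrightarrow> q < py (yo q)"
    and "\<And>y. y \<in> ys \<Longrightarrow> cy y = card (at_y H y)"
    and "\<And>y. y \<in> ys \<Longrightarrow> cy y \<le> quota I y"
    and "\<And>x. x \<in> xs \<Longrightarrow> cx x = card (at_x H x)"
    and "\<And>x. x \<in> xs \<Longrightarrow> cx x \<le> (if ov \<and> x = xv then Suc (quota I x) else quota I x)"
    and "ov \<Longrightarrow> xv \<in> xs"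
    and "ov \<Longrightarrow> cx xv = Suc (quota I xv)"
    and "\<And>x. x \<in> xs \<Longrightarrow> wx x \<le> last_pos xo m x"
    and "\<And>x. x \<in> xs \<Longrightarrow> wx x < last_pos xo m x \<Longrightarrow> quota I x \<le> cx x"
    and "\<And>q. q \<in> H \<Longrightarrow> rc q \<le> wx (ye q)"
    and "\<And>q. q \<in> ids \<Longrightarrow> q \<notin> H \<Longrightarrow> q < py (yo q) \<Longrightarrow> wx (ye q) < rc q"
    and "\<And>q H'. q \<in> ids \<Longrightarrow> q \<notin> H \<Longrightarrow> q < py (yo q) \<Longrightarrow> stab H' \<Longrightarrow> q \<notin> H'"
    and "\<And>q. q \<in> ids \<Longrightarrow> first_pos yo m (yo q) \<le> py (yo q)"
  shows "da_inv H py wx cx cy ov xv"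
  unfolding da_inv_def using assms by blast

lemma da_init: "da_inv {} (first_pos yo m) (last_pos xo m) (\<lambda>_. 0) (\<lambda>_. 0) False xv"
proof -
  have "\<not> q < first_pos yo m (yo q)" if "q \<in> ids" for q
    using first_pos_le[of q m yo] that by (simp add: ids_def)
  then show ?thesis by (intro da_invI) (simp_all add: at_y_def at_x_def)
qed

text \<open>Otherwise \<open>y = yo q\<close> has its quota filled in \<open>H'\<close> by edges not
  after \<open>q\<close>. All of these have been proposed, and none was rejected because
  \<open>H'\<close> is stable; so \<open>y\<close> holds all of them and \<open>q\<close> as well,
  which exceeds its quota.\<close>

lemma da_y_wants:
  assumes inv: "da_inv H py wx cx cy ov xv" and st: "stab H'" and q: "q \<in> H" "q \<notin> H'"
  shows "y_wants H' q"
proof (rule ccontr)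
  note D = da_invD[OF inv]
  assume "\<not> y_wants H' q"
  then have full: "quota I (yo q) \<le> card (at_y H' (yo q))"
    and le: "\<And>q'. q' \<in> H' \<Longrightarrow> yo q' = yo q \<Longrightarrow> q' \<le> q"
    by (auto simp: y_wants_def)
  have sub: "H \<subseteq> ids" "H' \<subseteq> ids" using D(1) st by (simp_all add: stab_def)
  have "at_y H' (yo q) \<subseteq> at_y H (yo q) - {q}"
  proof
    fix q' assume "q' \<in> at_y H' (yo q)"
    then have a: "q' \<in> H'" "yo q' = yo q" by (simp_all add: at_y_def)
    then have "q' < py (yo q')" using le[of q'] D(2)[OF q(1)] by simp
    then have "q' \<in> H" using D(13)[OF _ _ _ st] a sub by blast
    then show "q' \<in> at_y H (yo q) - {q}" using a q by (auto simp: at_y_def)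
  qed
  then have "card (at_y H' (yo q)) \<le> card (at_y H (yo q) - {q})"
    using sub by (intro card_mono) simp_all
  also have "\<dots> < card (at_y H (yo q))"
    using sub q finite_at(1)[of H "yo q"] by (intro card_Diff1_less) (simp_all add: at_y_def)
  also have "\<dots> \<le> quota I (yo q)" using D(3,4)[of "yo q"] q y_mem sub by (metis subsetD)
  finally show False using full by simp
qed

text \<open>A stable \<open>H'\<close> with \<open>q\<close> cannot contain all of \<open>B\<close>
  by the quota of \<open>x = ye q\<close>. A missing edge of \<open>B\<close> is wanted by its end
  in \<open>Y\<close> by \<open>da_y_wants\<close> and preferred to \<open>q\<close> by
  \<open>x\<close>, so it blocks \<open>H'\<close>. The set \<open>B\<close> is a parameter because
  a bump and an outright rejection supply different witnesses.\<close>

lemma da_rejected: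
  assumes inv: "da_inv H py wx cx cy ov xv" and st: "stab H'" and i: "q \<in> ids"
    and B: "B \<subseteq> H" "quota I (ye q) \<le> card B" "\<And>q'. q' \<in> B \<Longrightarrow> ye q' = ye q \<and> rc q' < rc q"
  shows "q \<notin> H'"
proof
  assume q: "q \<in> H'"
  have sub: "H \<subseteq> ids" "H' \<subseteq> ids" using da_invD(1)[OF inv] st by (simp_all add: stab_def)
  have "\<not> B \<subseteq> H'"
  proof
    assume "B \<subseteq> H'"
    then have "insert q B \<subseteq> at_x H' (ye q)" using q B(3) by (auto simp: at_x_def)
    then have "card (insert q B) \<le> card (at_x H' (ye q))" using sub by (intro card_mono) simp_all
    moreover have "finite B" using B(1) sub(1) finite_ids by (meson finite_subset)
    moreover have "q \<notin> B" using B(3) by blast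
    moreover have "card (at_x H' (ye q)) \<le> quota I (ye q)"
      using st x_mem[OF i] by (simp add: stab_def)
    ultimately show False using B(2) by simp
  qed
  then obtain q' where q': "q' \<in> B" "q' \<notin> H'" by blast
  then have "y_wants H' q'" using da_y_wants[OF inv st] B(1) by blast
  moreover have "x_wants H' q'" unfolding x_wants_def using q B(3)[OF q'(1)] by metis
  moreover have "q' \<in> ids - H'" using q' B(1) sub by blast
  ultimately show False using st unfolding stab_def by blast
qed

text \<open>Above its quota, \<open>x\<close> holds some edge, and \<open>wx x\<close> lies between
  the position of this edge and the end of the list; so the tables may be read there.\<close>

lemma da_over:
  assumes inv: "da_inv H py wx cx cy True x"
  shows "x \<in> xs" "wx x \<in> ids" "xo (wx x) = x"
proof -
  note D = da_invD[OF inv]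
  show x: "x \<in> xs" using D(7) by blast
  have "card (at_x H x) = Suc (quota I x)" using D(5)[OF x] D(8) by simp
  then obtain q where "q \<in> at_x H x" by (metis card.empty ex_in_conv nat.distinct(1))
  then have q: "q \<in> H" "ye q = x" by (simp_all add: at_x_def)
  then have i: "q \<in> ids" using D(1) by blast
  have r: "rc q \<le> wx x" using D(11)[OF q(1)] q(2) by simp
  have p: "rc q \<in> {1..m}" "xo (rc q) = x" using rc[OF i] q by (simp_all add: ids_def)
  have "first_pos xo m x \<le> rc q" using first_pos_le[of "rc q" m xo] p by simp
  then show "wx x \<in> ids" "xo (wx x) = x"
    using table_owner_between[OF xt p(1), of "wx x"] p(2) r D(9)[OF x] by (simp_all add: ids_def)
qed

text \<open>The position that the pointer leaves becomes rejected. This is permitted because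
  \<open>x\<close> is above its quota, and no held edge is affected since the position is
  unheld.\<close>

lemma da_lower:
  assumes inv: "da_inv H py wx cx cy True x" and unheld: "cr (wx x) \<notin> H"
  shows "da_inv H py (wx(x := wx x - 1)) cx cy True x"
proof -
  note D = da_invD[OF inv]
  have 1: "rc q \<le> wx x - 1" if "q \<in> H" "ye q = x" for q
  proof -
    have "rc q \<noteq> wx x" using rc(2)[of q] D(1) that(1) unheld by auto
    then show ?thesis using D(11)[OF that(1)] that(2) by simp
  qed
  have 2: "wx x - 1 < rc q" if "q \<in> ids" "q \<notin> H" "q < py (yo q)" "ye q = x" for q
    using D(12)[OF that(1-3)] that(4) by simp
  show ?thesis
  proof (rule da_invI)
    show "(wx(x := wx x - 1)) x' \<le> last_pos xo m x'" if "x' \<in> xs" for x'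
      using D(9)[OF that] by auto
    show "quota I x' \<le> cx x'" if "x' \<in> xs" "(wx(x := wx x - 1)) x' < last_pos xo m x'" for x'
      using D(8) D(10)[OF that(1)] that(2) by (cases "x' = x") simp_all
    show "rc q \<le> (wx(x := wx x - 1)) (ye q)" if "q \<in> H" for q
      using 1[OF that] D(11)[OF that] by simp
    show "(wx(x := wx x - 1)) (ye q) < rc q" if "q \<in> ids" "q \<notin> H" "q < py (yo q)" for q
      using 2[OF that] D(12)[OF that] by simp
  qed (fact D)+
qed

text \<open>\<open>wx x\<close> bounds the held positions of \<open>x\<close>, so a held edge at
  \<open>wx x\<close> is the worst one; the other \<open>quota I x\<close> held edges of
  \<open>x\<close> are the witnesses for \<open>da_rejected\<close>.\<close>

lemma da_bump:
  assumes inv: "da_inv H py wx cx cy True x" and held: "cr (wx x) \<in> H"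
  shows "da_inv (H - {cr (wx x)}) py (wx(x := wx x - 1)) (cx(x := cx x - 1))
    (cy(xe (wx x) := cy (xe (wx x)) - 1)) False x"
proof -
  note D = da_invD[OF inv] and ov = da_over[OF inv]
  define q where "q = cr (wx x)"
  define y where "y = xe (wx x)"
  have c: "yo q = y" "ye q = x" "rc q = wx x" "q \<in> ids"
    using cr[OF ov(2)] ov(3) by (simp_all add: q_def y_def)
  have held: "q \<in> H" using held by (simp add: q_def)
  have B: "rc q' < wx x" if "q' \<in> H" "q' \<noteq> q" "ye q' = x" for q'
  proof -
    have "rc q' \<noteq> wx x" using rc(2)[of q'] D(1) that(1,2) by (auto simp: q_def)
    then show ?thesis using D(11)[OF that(1)] that(3) by simp
  qed
  have cx: "card (at_x H x) = Suc (quota I x)" "cx x = Suc (quota I x)"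
    using D(5)[OF ov(1)] D(8) by simp_all
  have at: "q \<in> at_x H x" "q \<in> at_y H y" using held c by (simp_all add: at_x_def at_y_def)
  have cd: "card (at_x H x - {q}) = quota I x" using cx at D(1) by simp
  have rej: "q \<notin> H'" if "stab H'" for H'
  proof (rule da_rejected[OF inv that c(4), of "at_x H x - {q}"])
    show "ye q' = ye q \<and> rc q' < rc q" if "q' \<in> at_x H x - {q}" for q'
      using B[of q'] that c by (simp add: at_x_def)
    show "at_x H x - {q} \<subseteq> H" by (auto simp: at_x_def)
  qed (use cd c in simp)
  have 1: "(cy(y := cy y - 1)) y' = card (at_y (H - {q}) y')" if "y' \<in> ys" for y'
  proof (cases "y' = y")
    case True
    then show ?thesis using D(3)[OF that] at D(1) by (simp add: at_y_remove)
  next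
    case False
    then have "q \<notin> at_y H y'" using c by (simp add: at_y_def)
    then show ?thesis using D(3)[OF that] False by (simp add: at_y_remove)
  qed
  have 2: "(cx(x := cx x - 1)) x' = card (at_x (H - {q}) x')" if "x' \<in> xs" for x'
  proof (cases "x' = x")
    case True
    then show ?thesis using cx cd by (simp add: at_x_remove)
  next
    case False
    then have "q \<notin> at_x H x'" using c by (simp add: at_x_def)
    then show ?thesis using D(5)[OF that] False by (simp add: at_x_remove)
  qed
  have w: "1 \<le> wx x" using ov(2) by (simp add: ids_def)
  have "da_inv (H - {q}) py (wx(x := wx x - 1)) (cx(x := cx x - 1)) (cy(y := cy y - 1)) False x"
  proof (rule da_invI)
    show "H - {q} \<subseteq> ids" using D(1) by blast
    show "q' < py (yo q')" if "q' \<in> H - {q}" for q' using D(2) that by blast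
    show "(cy(y := cy y - 1)) y' \<le> quota I y'" if "y' \<in> ys" for y'
      using D(4)[OF that] by auto
    show "(cx(x := cx x - 1)) x' \<le> (if False \<and> x' = x then Suc (quota I x') else quota I x')"
      if "x' \<in> xs" for x'
      using D(6)[OF that] cx by auto
    show "(wx(x := wx x - 1)) x' \<le> last_pos xo m x'" if "x' \<in> xs" for x'
      using D(9)[OF that] by auto
    show "quota I x' \<le> (cx(x := cx x - 1)) x'" if "x' \<in> xs" "(wx(x := wx x - 1)) x' < last_pos xo m x'" for x'
      using cx D(10)[OF that(1)] that(2) by (cases "x' = x") simp_all
    show "rc q' \<le> (wx(x := wx x - 1)) (ye q')" if "q' \<in> H - {q}" for q'
      using B[of q'] D(11)[of q'] that by auto
    show "(wx(x := wx x - 1)) (ye q') < rc q'" if "q' \<in> ids" "q' \<notin> H - {q}" "q' < py (yo q')" for q'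
    proof (cases "q' = q")
      case True
      then show ?thesis using c w by simp
    next
      case False
      then show ?thesis using D(12)[OF that(1) _ that(3)] that(2) by auto
    qed
    show "q' \<notin> H'" if "q' \<in> ids" "q' \<notin> H - {q}" "q' < py (yo q')" "stab H'" for q' H'
      using D(13)[OF that(1) _ that(3,4)] rej[OF that(4)] that(2) by blast
  qed (use 1 2 D(14) in simp_all)
  then show ?thesis by (simp only: q_def y_def)
qed

lemma da_proposal:
  assumes inv: "da_inv H py wx cx cy ov xv" and "y \<in> yo ` ids" and "py y \<le> last_pos yo m y"
  shows "py y \<in> ids" "yo (py y) = y" "py y \<notin> H"
proof -
  note D = da_invD[OF inv]
  obtain q where q: "q \<in> ids" "yo q = y" using assms(2) by blast
  have "first_pos yo m y \<le> py y" using D(14)[OF q(1)] q(2) by simp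
  then show i: "py y \<in> ids" and y: "yo (py y) = y"
    using table_owner_between[OF yt, of q "py y"] q assms(3) by (simp_all add: ids_def)
  show "py y \<notin> H" using D(2)[of "py y"] y by auto
qed

text \<open>A pointer \<open>wx\<close> before the end of its list implies a filled quota, so the
  held edges of \<open>x\<close>, all better than the proposal, are the witnesses for
  \<open>da_rejected\<close>.\<close>

lemma da_reject:
  assumes inv: "da_inv H py wx cx cy False xv" and "y \<in> yo ` ids" and "py y \<le> last_pos yo m y"
    and w: "wx (ye (py y)) < rc (py y)"
  shows "da_inv H (py(y := Suc (py y))) wx cx cy False xv"
proof -
  note D = da_invD[OF inv] and q = da_proposal[OF inv assms(2,3)]
  let ?q = "py y" and ?x = "ye (py y)"
  have x: "?x \<in> xs" using x_mem q by simp
  have "rc ?q \<le> last_pos xo m ?x"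
    using last_pos_ge[of "rc ?q" m xo] rc[OF q(1)] by (simp add: ids_def)
  then have full: "quota I ?x \<le> card (at_x H ?x)" using D(5,10)[OF x] w by simp
  have rej: "?q \<notin> H'" if "stab H'" for H'
  proof (rule da_rejected[OF inv that q(1), of "at_x H ?x"])
    show "ye q' = ?x \<and> rc q' < rc ?q" if "q' \<in> at_x H ?x" for q'
      using that D(11)[of q'] w by (simp add: at_x_def)
    show "at_x H ?x \<subseteq> H" by (auto simp: at_x_def)
  qed (use full in simp)
  have old: "q' < py (yo q')" if "q' < (py(y := Suc ?q)) (yo q')" "q' \<noteq> ?q" for q'
    using that by (simp split: if_splits)
  show ?thesis
  proof (rule da_invI)
    show "q' < (py(y := Suc ?q)) (yo q')" if "q' \<in> H" for q' using D(2)[OF that] by auto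
    show "first_pos yo m (yo q') \<le> (py(y := Suc ?q)) (yo q')" if "q' \<in> ids" for q'
      using D(14)[OF that] by auto
    show "wx (ye q') < rc q'" if "q' \<in> ids" "q' \<notin> H" "q' < (py(y := Suc ?q)) (yo q')" for q'
      using D(12)[OF that(1,2)] old[OF that(3)] w by (cases "q' = ?q") simp_all
    show "q' \<notin> H'" if "q' \<in> ids" "q' \<notin> H" "q' < (py(y := Suc ?q)) (yo q')" "stab H'" for q' H'
      using D(13)[OF that(1,2) _ that(4)] old[OF that(3)] rej[OF that(4)] by (cases "q' = ?q") simp_all
  qed (fact D)+
qed

lemma da_accept:
  assumes inv: "da_inv H py wx cx cy False xv" and "y \<in> yo ` ids" and "py y \<le> last_pos yo m y"
    and w: "rc (py y) \<le> wx (ye (py y))" and cy: "cy y < quota I y" and x: "x = ye (py y)"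
  shows "da_inv (insert (py y) H) (py(y := Suc (py y))) wx (cx(x := Suc (cx x))) (cy(y := Suc (cy y)))
    (quota I x < Suc (cx x)) x"
proof -
  note D = da_invD[OF inv] and q = da_proposal[OF inv assms(2,3)]
  let ?q = "py y"
  have xs: "x \<in> xs" using x_mem q x by simp
  have fin: "finite (at_y H y)" "finite (at_x H x)" using D(1) by simp_all
  have nin: "?q \<notin> at_y H y" "?q \<notin> at_x H x" using q by (simp_all add: at_y_def at_x_def)
  have cxx: "cx x \<le> quota I x" using D(6)[OF xs] by simp
  have old: "q' < py (yo q')" if "q' < (py(y := Suc ?q)) (yo q')" "q' \<notin> insert ?q H" for q'
    using that by (simp split: if_splits)
  show ?thesis
  proof (rule da_invI)
    show "insert ?q H \<subseteq> ids" using D(1) q by simp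
    show "q' < (py(y := Suc ?q)) (yo q')" if "q' \<in> insert ?q H" for q'
      using D(2)[of q'] that q by auto
    show "first_pos yo m (yo q') \<le> (py(y := Suc ?q)) (yo q')" if "q' \<in> ids" for q'
      using D(14)[OF that] by auto
    show "(cy(y := Suc (cy y))) y' = card (at_y (insert ?q H) y')" if "y' \<in> ys" for y'
      using D(3)[OF that] q fin nin by (cases "y' = y") (simp_all add: at_y_insert)
    show "(cy(y := Suc (cy y))) y' \<le> quota I y'" if "y' \<in> ys" for y'
      using D(4)[OF that] cy by simp
    show "(cx(x := Suc (cx x))) x' = card (at_x (insert ?q H) x')" if "x' \<in> xs" for x'
      using D(5)[OF that] x fin nin by (cases "x' = x") (simp_all add: at_x_insert)
    show "(cx(x := Suc (cx x))) x' \<le> (if quota I x < Suc (cx x) \<and> x' = x then Suc (quota I x') else quota I x')"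
      if "x' \<in> xs" for x'
      using D(6)[OF that] cxx by auto
    show "(cx(x := Suc (cx x))) x = Suc (quota I x)" if "quota I x < Suc (cx x)"
      using that cxx by simp
    show "wx x' \<le> last_pos xo m x'" if "x' \<in> xs" for x' using D(9)[OF that] .
    show "quota I x' \<le> (cx(x := Suc (cx x))) x'" if "x' \<in> xs" "wx x' < last_pos xo m x'" for x'
      using D(10)[OF that] by auto
    show "rc q' \<le> wx (ye q')" if "q' \<in> insert ?q H" for q' using D(11)[of q'] that w by auto
    show "wx (ye q') < rc q'" if "q' \<in> ids" "q' \<notin> insert ?q H" "q' < (py(y := Suc ?q)) (yo q')" for q'
      using D(12)[OF that(1)] old[OF that(3,2)] that(2) by blast
    show "q' \<notin> H'" if "q' \<in> ids" "q' \<notin> insert ?q H" "q' < (py(y := Suc ?q)) (yo q')" "stab H'" for q' H'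
      using D(13)[OF that(1) _ _ that(4)] old[OF that(3,2)] that(2) by blast
  qed (rule xs)
qed

text \<open>A position that was proposed but is not held is unwanted by its end in \<open>X\<close>.
  A position not yet proposed belongs to a \<open>y\<close> whose quota is filled by earlier
  positions.\<close>

lemma da_final:
  assumes inv: "da_inv H py wx cx cy False xv"
    and exhausted: "\<And>q. q \<in> ids \<Longrightarrow> last_pos yo m (yo q) < py (yo q) \<or> quota I (yo q) \<le> cy (yo q)"
  shows "side_optimal (opposite X) I (edge ` H)"
proof (rule side_optimalI)
  note D = da_invD[OF inv]
  have late: "quota I (yo q) \<le> card (at_y H (yo q))" if "q \<in> ids" "py (yo q) \<le> q" for q
  proof -
    have "q \<le> last_pos yo m (yo q)" using last_pos_ge[of q m yo] that by (simp add: ids_def)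
    then show ?thesis using exhausted[OF that(1)] that(2) D(3)[OF y_mem[OF that(1)]] by simp
  qed
  show "stab H"
    unfolding stab_def
  proof (intro conjI ballI)
    show "H \<subseteq> ids" by (fact D)
    show "card (at_y H y) \<le> quota I y" if "y \<in> ys" for y using D(3,4)[OF that] by simp
    show "card (at_x H x) \<le> quota I x" if "x \<in> xs" for x using D(5,6)[OF that] by simp
  next
    fix q assume "q \<in> ids - H"
    then have q: "q \<in> ids" "q \<notin> H" by simp_all
    show "\<not> (y_wants H q \<and> x_wants H q)"
    proof (cases "q < py (yo q)")
      case True
      note w = D(12)[OF q True]
      have "rc q \<le> last_pos xo m (ye q)"
        using last_pos_ge[of "rc q" m xo] rc[OF q(1)] by (simp add: ids_def)
      then have "quota I (ye q) \<le> card (at_x H (ye q))"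
        using D(5,10)[OF x_mem[OF q(1)]] w by simp
      moreover have "\<not> rc q < rc q'" if "q' \<in> H" "ye q' = ye q" for q'
        using D(11)[OF that(1)] that(2) w by simp
      ultimately show ?thesis by (auto simp: x_wants_def)
    next
      case False
      then have "quota I (yo q) \<le> card (at_y H (yo q))" using late[OF q(1)] by simp
      moreover have "\<not> q < q'" if "q' \<in> H" "yo q' = yo q" for q'
        using D(2)[OF that(1)] that(2) False by simp
      ultimately show ?thesis by (auto simp: y_wants_def)
    qed
  qed
next
  fix H' q assume H': "stab H'" and q: "q \<in> H"
  show "\<exists>q' \<in> H'. ye q' = ye q \<and> rc q' \<le> rc q"
  proof (cases "q \<in> H'")
    case False
    have i: "q \<in> ids" using da_invD(1)[OF inv] q by blast
    \<comment> \<open>Since \<open>yo q\<close> wants \<open>q\<close>, stability of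
      \<open>H'\<close> forces \<open>ye q\<close> not to: its quota is filled by edges at least as
      good, and a positive quota yields one of them.\<close>
    have "\<not> x_wants H' q"
      using da_y_wants[OF inv H' q False] H' False i unfolding stab_def by blast
    then have full: "quota I (ye q) \<le> card (at_x H' (ye q))"
      and le: "\<And>q'. q' \<in> H' \<Longrightarrow> ye q' = ye q \<Longrightarrow> rc q' \<le> rc q" by (auto simp: x_wants_def)
    have "0 < card (at_x H' (ye q))" using full quota_pos[of "ye q"] x_mem[OF i] by simp
    then obtain q' where "q' \<in> at_x H' (ye q)" by (metis card.empty ex_in_conv less_numeral_extra(3))
    then show ?thesis using le by (auto simp: at_x_def)
  qed blast
next
  fix H' q assume H': "stab H'" and q: "q \<in> H'"
  note D = da_invD[OF inv]
  have i: "q \<in> ids" using H' q by (auto simp: stab_def)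
  show "\<exists>q' \<in> H. yo q' = yo q \<and> q' \<le> q"
  proof (cases "q < py (yo q)")
    case True
    then have "q \<in> H" using D(13)[OF i _ True H'] q by blast
    then show ?thesis by blast
  next
    case False
    have "q \<le> last_pos yo m (yo q)" using last_pos_ge[of q m yo] i by (simp add: ids_def)
    then have "quota I (yo q) \<le> card (at_y H (yo q))"
      using exhausted[OF i] False D(3)[OF y_mem[OF i]] by simp
    then have "0 < card (at_y H (yo q))" using quota_pos[of "yo q"] y_mem[OF i] by simp
    then obtain q' where "q' \<in> at_y H (yo q)" by (metis card.empty ex_in_conv less_numeral_extra(3))
    then have q': "q' \<in> H" "yo q' = yo q" by (simp_all add: at_y_def)
    then have "q' \<le> q" using D(2)[OF q'(1)] False by simp
    then show ?thesis using q' by blast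
  qed
qed

end

section \<open>Rotation digraphs in terms of table positions\<close>

lemma interleave_nth:
  assumes "t < length \<rho>"
  shows "concat (map (\<lambda>(y, x). [Some y, Some x]) \<rho>) ! (2 * t) = Some (fst (\<rho> ! t))"
    and "concat (map (\<lambda>(y, x). [Some y, Some x]) \<rho>) ! Suc (2 * t) = Some (snd (\<rho> ! t))"
  using assms
proof (induction \<rho> arbitrary: t)
  case (Cons z \<rho>)
  { case 1 then show ?case using Cons.IH(1) by (cases t; cases z) simp_all }
  { case 2 then show ?case using Cons.IH(2) by (cases t; cases z) simp_all }
qed simp_all

lemma interleave_length: "length (concat (map (\<lambda>(y, x). [Some y, Some x]) \<rho>)) = 2 * length \<rho>"
  by (induction \<rho>) auto

lemma interleave_set:
  "set (concat (map (\<lambda>(y, x). [Some y, Some x]) \<rho>)) = Some ` fst ` set \<rho> \<union> Some ` snd ` set \<rho>"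
  by (induction \<rho>) auto

lemma interleave_distinct:
  assumes "distinct (map fst \<rho>)" "distinct (map snd \<rho>)" "fst ` set \<rho> \<inter> snd ` set \<rho> = {}"
  shows "distinct (concat (map (\<lambda>(y, x). [Some y, Some x]) \<rho>))"
  using assms
proof (induction \<rho>)
  case (Cons z \<rho>)
  let ?C = "concat (map (\<lambda>(y, x). [Some y, Some x]) \<rho>)"
  have "distinct ?C" using Cons by auto
  moreover have "Some (fst z) \<notin> set ?C" "Some (snd z) \<notin> set ?C"
    unfolding interleave_set using Cons.prems by auto
  moreover have "fst z \<noteq> snd z" using Cons.prems(3) by auto
  moreover have "concat (map (\<lambda>(y, x). [Some y, Some x]) (z # \<rho>)) = Some (fst z) # Some (snd z) # ?C"
    by (cases z) simp
  ultimately show ?case by (simp del: set_concat)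
qed simp

text \<open>Even indices of the vertex list carry \<open>Y\<close>, odd ones \<open>X\<close>. The
  list can wrap around only after an odd index \<open>2 * t + 1\<close>, where the successor modulo
  \<open>2 * r\<close> is twice the successor of \<open>t\<close> modulo \<open>r\<close>.\<close>

lemma directed_cycle_interleaveI:
  assumes "\<rho> \<noteq> []" "distinct (map fst \<rho>)" "distinct (map snd \<rho>)" "fst ` set \<rho> \<inter> snd ` set \<rho> = {}"
    and yx: "\<And>t. t < length \<rho> \<Longrightarrow> (Some (fst (\<rho> ! t)), Some (snd (\<rho> ! t))) \<in> D"
    and xy: "\<And>t. t < length \<rho> \<Longrightarrow> (Some (snd (\<rho> ! t)), Some (fst (\<rho> ! (Suc t mod length \<rho>)))) \<in> D"
  shows "directed_cycle D (concat (map (\<lambda>(y, x). [Some y, Some x]) \<rho>))"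
proof -
  let ?C = "concat (map (\<lambda>(y, x). [Some y, Some x]) \<rho>)" and ?r = "length \<rho>"
  have r: "0 < ?r" using assms(1) by simp
  have "(?C ! i, ?C ! (Suc i mod (2 * ?r))) \<in> D" if i: "i < 2 * ?r" for i
  proof -
    obtain t where "i = 2 * t \<or> i = Suc (2 * t)" by (metis even_Suc evenE odd_Suc_minus_one dvd_def odd_two_times_div_two_succ Suc_eq_plus1)
    then show ?thesis
    proof
      assume t: "i = 2 * t"
      then have "t < ?r" using i by simp
      then show ?thesis using t yx interleave_nth[of t \<rho>] by simp
    next
      assume t: "i = Suc (2 * t)"
      then have tr: "t < ?r" using i by simp
      have "Suc i mod (2 * ?r) = 2 * (Suc t mod ?r)" using t by (metis mult_Suc_right mult_mod_right add_2_eq_Suc)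
      moreover have "Suc t mod ?r < ?r" using r by simp
      ultimately show ?thesis using t xy[OF tr] interleave_nth[of t \<rho>] interleave_nth[of "Suc t mod ?r" \<rho>] tr by simp
    qed
  qed
  moreover have "?C \<noteq> []" using r interleave_length[of \<rho>] by (metis length_0_conv mult_is_0 not_gr0 zero_neq_numeral)
  ultimately show ?thesis
    unfolding directed_cycle_def interleave_length using interleave_distinct[OF assms(2-4)] by blast
qed

context tables
begin

definition inst_of :: "nat set \<Rightarrow> 'v inst" where
  "inst_of G = I\<lparr>edges := edge ` G\<rparr>"

text \<open>The edges from \<open>ye q\<close> to the elements of \<open>s_candidates\<close> in the
  graph \<open>G\<close>, made precise by \<open>candidates_eq\<close>.\<close>

definition cand :: "nat set \<Rightarrow> nat set \<Rightarrow> nat \<Rightarrow> bool" where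
  "cand G H q \<longleftrightarrow> q \<in> G \<and> q \<notin> H \<and> (\<exists>q' \<in> H. yo q' = yo q \<and> q < q')"

lemma inst_of_simps [simp]:
  "members (inst_of G) Z = members I Z" "edges (inst_of G) = edge ` G"
  "pref (inst_of G) = pref I" "quota (inst_of G) = quota I"
  by (cases Z) (simp_all add: inst_of_def)

lemma inst_of_ids: "inst_of ids = I"
  by (simp add: inst_of_def edges_eq[symmetric])

lemma candidates_eq:
  assumes "H \<subseteq> G" "G \<subseteq> ids" "x \<in> xs"
  shows "s_candidates (inst_of G) (edge ` H) x = yo ` {q. cand G H q \<and> ye q = x}"
proof -
  have H: "H \<subseteq> ids" using assms by blast
  have "(yo q \<notin> partners (edge ` H) x \<and> (\<exists>x' \<in> partners (edge ` H) (yo q). pref I (yo q) x x')) \<longleftrightarrow> cand G H q"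
    if q: "q \<in> G" "ye q = x" for q
  proof -
    have i: "q \<in> ids" using q assms by blast
    have 1: "yo q \<in> partners (edge ` H) x \<longleftrightarrow> q \<in> H"
      using edge_mem[OF H i] q(2) by (simp add: partners_def edge_def insert_commute)
    have "pref I (yo q) x (ye q') \<longleftrightarrow> q < q'" if "q' \<in> H" "yo q' = yo q" for q'
      using pref_y[OF i, of q'] that H q(2) by auto
    then have 2: "(\<exists>x' \<in> partners (edge ` H) (yo q). pref I (yo q) x x') \<longleftrightarrow> (\<exists>q' \<in> H. yo q' = yo q \<and> q < q')"
      unfolding partners_y[OF H y_mem[OF i]] by (auto simp: at_y_def)
    show ?thesis using 1 2 q(1) by (simp add: cand_def)
  qed
  then show ?thesis
    unfolding s_candidates_def inst_of_simps partners_x[OF assms(2,3)]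
    by (auto simp: at_x_def) (auto simp: cand_def)
qed

lemma s_agent_eq:
  assumes "H \<subseteq> G" "G \<subseteq> ids" "cand G H q"
    and "\<And>q'. cand G H q' \<Longrightarrow> ye q' = ye q \<Longrightarrow> rc q \<le> rc q'"
  shows "s_agent (inst_of G) (edge ` H) (ye q) = Some (yo q)"
proof -
  have sub: "q' \<in> ids" if "cand G H q'" for q' using that assms(2) by (auto simp: cand_def)
  have x: "ye q \<in> xs" using x_mem sub assms(3) by blast
  let ?C = "yo ` {q'. cand G H q' \<and> ye q' = ye q}"
  have "most_preferred (inst_of G) (ye q) ?C = yo q"
    unfolding most_preferred_def inst_of_simps
  proof (rule the_equality)
    have best: "pref I (ye q) (yo q) (yo q')" if "cand G H q'" "ye q' = ye q" "yo q' \<noteq> yo q" for q'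
    proof -
      have "rc q' \<noteq> rc q" using rc_inj[OF sub[OF that(1)] sub[OF assms(3)]] that(3) by blast
      then have "rc q < rc q'" using assms(4)[OF that(1,2)] by simp
      then show ?thesis using pref_x[OF sub[OF assms(3)] sub[OF that(1)]] that(2) by simp
    qed
    then show "yo q \<in> ?C \<and> (\<forall>z \<in> ?C. z \<noteq> yo q \<longrightarrow> pref I (ye q) (yo q) z)"
      using assms(3) by auto
    fix y assume y: "y \<in> ?C \<and> (\<forall>z \<in> ?C. z \<noteq> y \<longrightarrow> pref I (ye q) y z)"
    show "y = yo q"
    proof (rule ccontr)
      assume ne: "y \<noteq> yo q"
      obtain q' where q': "cand G H q'" "ye q' = ye q" "y = yo q'" using y by auto
      have "yo q \<in> ?C" using assms(3) by blast
      then have "pref I (ye q) y (yo q)" using y ne by auto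
      moreover have "pref I (ye q) (yo q) y" using best q' ne by blast
      moreover have "y \<in> partners (edges I) (ye q)" "yo q \<in> partners (edges I) (ye q)"
        using partner_x[OF sub[OF q'(1)]] partner_x[OF sub[OF assms(3)]] q' by simp_all
      ultimately show False using pref_asym[of "ye q"] x by blast
    qed
  qed
  then show ?thesis
    using assms(3) unfolding s_agent_def candidates_eq[OF assms(1,2) x] by auto
qed

lemma s_agent_None:
  assumes "H \<subseteq> G" "G \<subseteq> ids" "x \<in> xs" "\<And>q. cand G H q \<Longrightarrow> ye q \<noteq> x"
  shows "s_agent (inst_of G) (edge ` H) x = None"
  using assms(4) unfolding s_agent_def candidates_eq[OF assms(1-3)] by auto

text \<open>Needed for \<open>sink_x\<close>: an arc leaving \<open>Some x\<close> could otherwise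
  be of the second kind, with \<open>x\<close> in the role of \<open>y\<close>.\<close>

lemma s_agent_in_ys:
  assumes "H \<subseteq> G" "G \<subseteq> ids" "x \<in> xs" "s_agent (inst_of G) (edge ` H) x = Some y"
  shows "y \<in> ys"
proof -
  obtain q where "cand G H q" "ye q = x" using s_agent_None[OF assms(1-3)] assms(4) by fastforce
  then obtain q where q: "cand G H q \<and> ye q = x" and min: "\<And>q'. cand G H q' \<and> ye q' = x \<Longrightarrow> rc q \<le> rc q'"
    using ex_has_least_nat[of "\<lambda>q. cand G H q \<and> ye q = x" q rc] by blast
  have "s_agent (inst_of G) (edge ` H) (ye q) = Some (yo q)"
    by (rule s_agent_eq[OF assms(1,2)]) (use q min in auto)
  then have "y = yo q" using q assms(4) by simp
  then show ?thesis using y_mem q assms(2) by (auto simp: cand_def)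
qed

lemma next_agent_eq:
  assumes "H \<subseteq> ids" "s_agent (inst_of G) (edge ` H) x = Some (yo w)"
    and "w \<in> H" "\<And>q. q \<in> H \<Longrightarrow> yo q = yo w \<Longrightarrow> q \<le> w"
  shows "next_agent (inst_of G) (edge ` H) x =
    (if card (at_y H (yo w)) < quota I (yo w) then None else Some (ye w))"
proof -
  have i: "w \<in> ids" using assms by blast
  let ?C = "ye ` at_y H (yo w)"
  have "least_preferred (inst_of G) (yo w) ?C = ye w"
    unfolding least_preferred_def inst_of_simps
  proof (rule the_equality)
    have worst: "pref I (yo w) (ye q) (ye w)" if "q \<in> H" "yo q = yo w" "ye q \<noteq> ye w" for q
    proof -
      have "q < w" using assms(4)[OF that(1,2)] that(3) by (cases "q = w") auto
      then show ?thesis using pref_y[of q w] that assms(1) i by auto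
    qed
    then show "ye w \<in> ?C \<and> (\<forall>z \<in> ?C. z \<noteq> ye w \<longrightarrow> pref I (yo w) z (ye w))"
      using assms(3) by (auto simp: at_y_def)
    fix x assume x: "x \<in> ?C \<and> (\<forall>z \<in> ?C. z \<noteq> x \<longrightarrow> pref I (yo w) z x)"
    show "x = ye w"
    proof (rule ccontr)
      assume ne: "x \<noteq> ye w"
      obtain q where q: "q \<in> H" "yo q = yo w" "x = ye q" using x by (auto simp: at_y_def)
      have "ye w \<in> ?C" using assms(3) by (auto simp: at_y_def)
      then have "pref I (yo w) (ye w) x" using x ne by auto
      moreover have "pref I (yo w) x (ye w)" using worst q ne by blast
      moreover have "x \<in> partners (edges I) (yo w)" "ye w \<in> partners (edges I) (yo w)"
        using partner_y[of q] partner_y[OF i] q assms(1) by auto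
      ultimately show False using pref_asym[of "yo w"] y_mem[OF i] by blast
    qed
  qed
  then show ?thesis
    using card_partners_y[OF assms(1) y_mem[OF i]] unfolding next_agent_def assms(2)
    by (simp add: partners_y[OF assms(1) y_mem[OF i]])
qed

section \<open>Arcs, sinks and initial segments of runs\<close>

lemma arc_x: "x \<in> xs \<Longrightarrow> s_agent (inst_of G) M x = Some y \<Longrightarrow> (Some x, Some y) \<in> rotation_arcs X (inst_of G) M"
  by (auto simp: rotation_arcs_def)

lemma arc_y: "x \<in> xs \<Longrightarrow> s_agent (inst_of G) M x = Some y \<Longrightarrow>
    (Some y, next_agent (inst_of G) M x) \<in> rotation_arcs X (inst_of G) M"
  unfolding rotation_arcs_def inst_of_simps by blast

lemma sink_None: "(None, z) \<notin> rotation_arcs X (inst_of G) M"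
  by (auto simp: rotation_arcs_def)

lemma sink_x:
  assumes "H \<subseteq> G" "G \<subseteq> ids" "x \<in> xs" "\<And>q. cand G H q \<Longrightarrow> ye q \<noteq> x"
  shows "(Some x, z) \<notin> rotation_arcs X (inst_of G) (edge ` H)"
  using s_agent_None[OF assms] s_agent_in_ys[OF assms(1,2)] disjoint assms(3)
  by (auto simp: rotation_arcs_def)

lemma no_arcs:
  assumes "H \<subseteq> G" "G \<subseteq> ids" "\<And>q. \<not> cand G H q"
  shows "rotation_arcs X (inst_of G) (edge ` H) = {}"
  using s_agent_None[OF assms(1,2)] assms(3) by (auto simp: rotation_arcs_def)

text \<open>\<open>rr_loop\<close> builds a run from its last iteration backwards, whereas the
  program performs iterations forwards. Quantifying over all continuations makes it possible to
  append an operation at the end.\<close>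

definition reached :: "'v set set \<Rightarrow> 'v operation list \<Rightarrow> nat set \<Rightarrow> nat set \<Rightarrow> bool" where
  "reached M0 ops G H \<longleftrightarrow>
     (\<forall>ops' M'. rr_loop X (inst_of G) (edge ` H) ops' M' \<longrightarrow> rr_loop X I M0 (ops @ ops') M')"

lemma reached_init: "reached (edge ` H) [] ids H"
  by (simp add: reached_def inst_of_ids)

lemma reached_stop:
  assumes "reached M0 ops G H" "H \<subseteq> G" "G \<subseteq> ids" "\<And>q. \<not> cand G H q"
  shows "rr_loop X I M0 ops (edge ` H)"
  using assms(1) rr_loop.stop[OF no_arcs[OF assms(2-4)]] unfolding reached_def by fastforce

lemma reached_remove:
  assumes "reached M0 ops G H" "G \<subseteq> ids" "q \<in> G"
    and "(Some (ye q), Some (yo q)) \<in> rotation_arcs X (inst_of G) (edge ` H)"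
    and "(Some (yo q), z) \<in> rotation_arcs X (inst_of G) (edge ` H)"
    and "\<And>u. (z, u) \<notin> rotation_arcs X (inst_of G) (edge ` H)"
  shows "reached M0 (ops @ [Remove (ye q) (yo q)]) (G - {q}) H"
proof -
  have "edge ` G - {{ye q, yo q}} = edge ` (G - {q})"
    using inj_on_image_set_diff[OF inj_edge, of G "{q}"] assms(2,3) by (auto simp: edge_def insert_commute)
  then have i: "(inst_of G)\<lparr>edges := edges (inst_of G) - {{ye q, yo q}}\<rparr> = inst_of (G - {q})"
    by (simp add: inst_of_def)
  have "q \<in> ids" using assms(2,3) by blast
  then have "rr_loop X (inst_of G) (edge ` H) (Remove (ye q) (yo q) # ops') M'"
    if "rr_loop X (inst_of (G - {q})) (edge ` H) ops' M'" for ops' M'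
    using rr_loop.remove[of "ye q" "inst_of G" X "yo q" "edge ` H" z ops' M'] assms(4-6) that i
    by (simp add: y_mem x_mem)
  then show ?thesis using assms(1) by (simp add: reached_def)
qed

lemma reached_eliminate:
  assumes "reached M0 ops G H" "is_rotation X (inst_of G) (edge ` H) \<rho>"
    and "eliminate (edge ` H) \<rho> = edge ` H'"
  shows "reached M0 (ops @ [Eliminate \<rho>]) G H'"
  using assms rr_loop.eliminate[of X "inst_of G" "edge ` H" \<rho>] by (simp add: reached_def)

end

section \<open>The search for rotations\<close>

context tables
begin

text \<open>
  \<open>px x\<close> is a position in the list of \<open>x\<close> before which there is no candidate for \<open>s x\<close>, and \<open>wy y\<close>
  a position in the list of \<open>y\<close> beyond which there is no partner of \<open>y\<close>.
\<close>

definition rr_core :: "nat set \<Rightarrow> nat set \<Rightarrow> ('v \<Rightarrow> nat) \<Rightarrow> ('v \<Rightarrow> nat) \<Rightarrow> ('v \<Rightarrow> nat) \<Rightarrow> bool" where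
  "rr_core G H px wy cy \<longleftrightarrow> H \<subseteq> G \<and> G \<subseteq> ids \<and>
     (\<forall>p \<in> ids. px (xo p) \<le> p \<longrightarrow> cr p \<in> G) \<and>
     (\<forall>p \<in> ids. p < px (xo p) \<longrightarrow> \<not> cand G H (cr p)) \<and>
     (\<forall>q \<in> H. q \<le> wy (yo q)) \<and>
     (\<forall>y. wy y \<le> last_pos yo m y) \<and>
     (\<forall>y \<in> ys. card (at_y H y) = cy y) \<and>
     (\<forall>p \<in> ids. first_pos xo m (xo p) \<le> px (xo p))"

lemma rr_coreD:
  assumes "rr_core G H px wy cy"
  shows "H \<subseteq> G" "G \<subseteq> ids"
    and "\<And>p. p \<in> ids \<Longrightarrow> px (xo p) \<le> p \<Longrightarrow> cr p \<in> G"
    and "\<And>p. p \<in> ids \<Longrightarrow> p < px (xo p) \<Longrightarrow> \<not> cand G H (cr p)"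
    and "\<And>q. q \<in> H \<Longrightarrow> q \<le> wy (yo q)"
    and "\<And>y. wy y \<le> last_pos yo m y"
    and "\<And>y. y \<in> ys \<Longrightarrow> card (at_y H y) = cy y"
    and "\<And>p. p \<in> ids \<Longrightarrow> first_pos xo m (xo p) \<le> px (xo p)"
  using assms unfolding rr_core_def by blast+

lemma rr_coreI:
  assumes "H \<subseteq> G" "G \<subseteq> ids"
    and "\<And>p. p \<in> ids \<Longrightarrow> px (xo p) \<le> p \<Longrightarrow> cr p \<in> G"
    and "\<And>p. p \<in> ids \<Longrightarrow> p < px (xo p) \<Longrightarrow> \<not> cand G H (cr p)"
    and "\<And>q. q \<in> H \<Longrightarrow> q \<le> wy (yo q)"
    and "\<And>y. wy y \<le> last_pos yo m y"
    and "\<And>y. y \<in> ys \<Longrightarrow> card (at_y H y) = cy y"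
    and "\<And>p. p \<in> ids \<Longrightarrow> first_pos xo m (xo p) \<le> px (xo p)"
  shows "rr_core G H px wy cy"
  unfolding rr_core_def using assms by blast

lemma rr_core_init:
  assumes "H \<subseteq> ids" "\<And>y. y \<in> ys \<Longrightarrow> card (at_y H y) = cy y"
  shows "rr_core ids H (first_pos xo m) (last_pos yo m) cy"
proof (rule rr_coreI)
  show "\<not> cand ids H (cr p)" if "p \<in> ids" "p < first_pos xo m (xo p)" for p
    using first_pos_le[of p m xo] that by (simp add: ids_def)
  show "q \<le> last_pos yo m (yo q)" if "q \<in> H" for q
    using last_pos_ge[of q m yo] that assms(1) by (auto simp: ids_def)
qed (use assms cr(1) in auto)

lemma rr_position:
  assumes "rr_core G H px wy cy" "x \<in> xo ` ids" "px x \<le> last_pos xo m x"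
  shows "px x \<in> ids" "xo (px x) = x" "cr (px x) \<in> G" "ye (cr (px x)) = x" "cr (px x) \<in> ids"
    "yo (cr (px x)) = xe (px x)" "rc (cr (px x)) = px x"
proof -
  note D = rr_coreD[OF assms(1)]
  obtain p where p: "p \<in> ids" "xo p = x" using assms(2) by blast
  have "first_pos xo m x \<le> px x" using D(8)[OF p(1)] p(2) by simp
  then show i: "px x \<in> ids" and x: "xo (px x) = x"
    using table_owner_between[OF xt, of p "px x"] p assms(3) by (simp_all add: ids_def)
  show "cr (px x) \<in> G" using D(3)[OF i] x by simp
  show "ye (cr (px x)) = x" "cr (px x) \<in> ids" "yo (cr (px x)) = xe (px x)" "rc (cr (px x)) = px x"
    using cr[OF i] x by simp_all
qed

text \<open>No position before the pointer is a candidate; hence a candidate under the pointer is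
  the most preferred one.\<close>

lemma rr_s_agent:
  assumes inv: "rr_core G H px wy cy" "x \<in> xo ` ids" "px x \<le> last_pos xo m x"
    and "cand G H (cr (px x))"
  shows "s_agent (inst_of G) (edge ` H) x = Some (yo (cr (px x)))"
proof -
  note D = rr_coreD[OF inv(1)] and P = rr_position[OF inv]
  have "rc (cr (px x)) \<le> rc q'" if "cand G H q'" "ye q' = ye (cr (px x))" for q'
  proof (rule ccontr)
    have i: "q' \<in> ids" using that(1) D(2) by (auto simp: cand_def)
    assume "\<not> rc (cr (px x)) \<le> rc q'"
    then have "rc q' < px (xo (rc q'))" using P that(2) rc[OF i] by simp
    then show False using D(4)[OF rc(1)[OF i]] rc(2)[OF i] that(1) by simp
  qed
  from s_agent_eq[OF D(1,2) assms(4) this] show ?thesis using P by simp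
qed

lemma rr_finished:
  assumes inv: "rr_core G H px wy cy" and "last_pos xo m x < px x" and "cand G H q"
  shows "ye q \<noteq> x"
proof
  assume x: "ye q = x"
  note D = rr_coreD[OF inv]
  have i: "q \<in> ids" using assms(3) D(2) by (auto simp: cand_def)
  have "rc q \<le> last_pos xo m x" using last_pos_ge[of "rc q" m xo] rc[OF i] x by (simp add: ids_def)
  then have "rc q < px (xo (rc q))" using assms(2) rc[OF i] x by simp
  then show False using D(4)[OF rc(1)[OF i]] rc(2)[OF i] assms(3) by simp
qed

text \<open>A candidate precedes some partner in the list of its \<open>y\<close>, and
  \<open>wy\<close> bounds all partners.\<close>

lemma rr_not_cand:
  assumes "rr_core G H px wy cy" "q \<in> H \<or> wy (yo q) < q" shows "\<not> cand G H q"
  using rr_coreD(5)[OF assms(1)] assms(2) by (fastforce simp: cand_def)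

lemma cand_mono: "cand (G - A) H q \<Longrightarrow> cand G H q"
  by (auto simp: cand_def)

text \<open>Covers both ways of passing a position: skipping a non-candidate and removing its edge.
  In either case the position falls behind the pointer, so all edges ahead of pointers remain
  present.\<close>

lemma rr_advance:
  assumes inv: "rr_core G H px wy cy" "x \<in> xo ` ids" "px x \<le> last_pos xo m x"
    and G': "G' = G \<or> G' = G - {cr (px x)} \<and> cr (px x) \<notin> H" and nc: "\<not> cand G' H (cr (px x))"
  shows "rr_core G' H (px(x := Suc (px x))) wy cy"
proof -
  note D = rr_coreD[OF inv(1)] and P = rr_position[OF inv]
  show ?thesis
  proof (rule rr_coreI)
    show "H \<subseteq> G'" "G' \<subseteq> ids" using D(1,2) G' by blast+
    fix p assume p: "p \<in> ids"
    show "cr p \<in> G'" if "(px(x := Suc (px x))) (xo p) \<le> p"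
    proof -
      have "px (xo p) \<le> p" "p \<noteq> px x" using that P(2) by (auto split: if_splits)
      then have "cr p \<in> G" "cr p \<noteq> cr (px x)" using D(3)[OF p] cr(4)[OF p] cr(4)[OF P(1)] by auto
      then show ?thesis using G' by blast
    qed
    show "\<not> cand G' H (cr p)" if "p < (px(x := Suc (px x))) (xo p)"
    proof (cases "p = px x")
      case True
      then show ?thesis using nc by simp
    next
      case False
      then have "p < px (xo p)" using that by (auto split: if_splits)
      then show ?thesis using D(4)[OF p] G' cand_mono by blast
    qed
    show "first_pos xo m (xo p) \<le> (px(x := Suc (px x))) (xo p)" using D(8)[OF p] by auto
  qed (rule D; assumption)+
qed

lemma rr_lower:
  assumes inv: "rr_core G H px wy cy" and "wy y \<notin> H"
  shows "rr_core G H px (wy(y := wy y - 1)) cy"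
proof -
  note D = rr_coreD[OF inv]
  show ?thesis
  proof (rule rr_coreI)
    show "q \<le> (wy(y := wy y - 1)) (yo q)" if "q \<in> H" for q
      using D(5)[OF that] that assms(2) by (cases "q = wy y") auto
    show "(wy(y := wy y - 1)) y' \<le> last_pos yo m y'" for y'
      using D(6)[of y'] by auto
  qed (rule D; assumption)+
qed

text \<open>The path \<open>x \<rightarrow> s x \<rightarrow> x'\<close> in the rotation digraph; \<open>x\<close> does not precede \<open>\<emptyset>\<close>.\<close>

definition step :: "nat set \<Rightarrow> ('v \<Rightarrow> nat) \<Rightarrow> ('v \<Rightarrow> nat) \<Rightarrow> ('v \<Rightarrow> nat) \<Rightarrow> 'v \<Rightarrow> 'v \<Rightarrow> bool" where
  "step H px wy cy x x' \<longleftrightarrow> px x \<le> last_pos xo m x \<and> cr (px x) \<notin> H \<and>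
     cr (px x) < wy (xe (px x)) \<and> wy (xe (px x)) \<in> H \<and> yo (wy (xe (px x))) = xe (px x) \<and>
     ye (wy (xe (px x))) = x' \<and> quota I (xe (px x)) \<le> cy (xe (px x))"

lemma rr_cand:
  assumes inv: "rr_core G H px wy cy" "x \<in> xo ` ids" "px x \<le> last_pos xo m x"
    and "cr (px x) \<notin> H" "cr (px x) \<le> wy (xe (px x))" "wy (xe (px x)) \<in> H"
  shows "cand G H (cr (px x))" "cr (px x) < wy (xe (px x))" "yo (wy (xe (px x))) = xe (px x)"
proof -
  note D = rr_coreD[OF inv(1)] and P = rr_position[OF inv]
  let ?y = "xe (px x)"
  show lt: "cr (px x) < wy ?y" using assms(4-6) by (metis le_neq_implies_less)
  have "first_pos yo m ?y \<le> cr (px x)"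
    using first_pos_le[of "cr (px x)" m yo] P by (simp add: ids_def)
  then show y: "yo (wy ?y) = ?y"
    using table_owner_between[OF yt, of "cr (px x)" "wy ?y"] P D(6)[of ?y] lt by (simp add: ids_def)
  show "cand G H (cr (px x))" unfolding cand_def using P y lt assms(4,6) by metis
qed

lemma rr_arcs:
  assumes inv: "rr_core G H px wy cy" "x \<in> xo ` ids" "px x \<le> last_pos xo m x"
    and h: "cr (px x) \<notin> H" "cr (px x) \<le> wy (xe (px x))" "wy (xe (px x)) \<in> H"
  shows "(Some x, Some (xe (px x))) \<in> rotation_arcs X (inst_of G) (edge ` H)"
    and "(Some (xe (px x)), if cy (xe (px x)) < quota I (xe (px x)) then None else Some (ye (wy (xe (px x)))))
      \<in> rotation_arcs X (inst_of G) (edge ` H)"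
proof -
  note D = rr_coreD[OF inv(1)] and P = rr_position[OF inv] and C = rr_cand[OF inv h]
  let ?y = "xe (px x)"
  have x: "x \<in> xs" using x_mem[OF P(5)] P(4) by simp
  have s: "s_agent (inst_of G) (edge ` H) x = Some ?y" using rr_s_agent[OF inv C(1)] P(6) by simp
  show "(Some x, Some ?y) \<in> rotation_arcs X (inst_of G) (edge ` H)" using arc_x[OF x s] .
  have "next_agent (inst_of G) (edge ` H) x =
      (if card (at_y H (yo (wy ?y))) < quota I (yo (wy ?y)) then None else Some (ye (wy ?y)))"
  proof (rule next_agent_eq)
    show "H \<subseteq> ids" using D(1,2) by blast
    show "s_agent (inst_of G) (edge ` H) x = Some (yo (wy ?y))" using s C(3) by simp
    show "q \<le> wy ?y" if "q \<in> H" "yo q = yo (wy ?y)" for q using D(5)[OF that(1)] that(2) C(3) by simp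
  qed (fact h)
  moreover have "?y \<in> ys" using y_mem[OF P(5)] P(6) by simp
  ultimately show "(Some ?y, if cy ?y < quota I ?y then None else Some (ye (wy ?y))) \<in> rotation_arcs X (inst_of G) (edge ` H)"
    using arc_y[OF x s] C(3) D(7)[of ?y] by simp
qed

text \<open>\<open>pos\<close> inverts \<open>st\<close> and is 0 off the stack, which gives
  distinctness and a membership test in constant time. The bottom comes from a scan over the
  positions \<open>i\<close> of the table of \<open>X\<close> rather than over its agents: the scan
  meets an agent once per position, and after the first time its list is exhausted, so each further
  visit costs a constant.\<close>

definition rr_stack ::
  "nat set \<Rightarrow> ('v \<Rightarrow> nat) \<Rightarrow> ('v \<Rightarrow> nat) \<Rightarrow> ('v \<Rightarrow> nat) \<Rightarrow> (nat \<Rightarrow> 'v) \<Rightarrow> ('v \<Rightarrow> nat) \<Rightarrow> nat \<Rightarrow> nat \<Rightarrow> bool" where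
  "rr_stack H px wy cy st pos sp i \<longleftrightarrow>
     (\<forall>k. 1 \<le> k \<and> k \<le> sp \<longrightarrow> st k \<in> xo ` ids \<and> pos (st k) = k) \<and>
     (\<forall>x. pos x \<noteq> 0 \<longrightarrow> pos x \<le> sp \<and> st (pos x) = x) \<and>
     (\<forall>k. 1 \<le> k \<and> k < sp \<longrightarrow> step H px wy cy (st k) (st (Suc k))) \<and>
     (0 < sp \<longrightarrow> i \<le> m \<and> st 1 = xo i) \<and>
     1 \<le> i \<and> i \<le> Suc m \<and> (\<forall>p. 1 \<le> p \<and> p < i \<longrightarrow> last_pos xo m (xo p) < px (xo p))"

lemma rr_stackD:
  assumes "rr_stack H px wy cy st pos sp i"
  shows "\<And>k. 1 \<le> k \<Longrightarrow> k \<le> sp \<Longrightarrow> st k \<in> xo ` ids"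
    and "\<And>k. 1 \<le> k \<Longrightarrow> k \<le> sp \<Longrightarrow> pos (st k) = k"
    and "\<And>x. pos x \<noteq> 0 \<Longrightarrow> pos x \<le> sp"
    and "\<And>x. pos x \<noteq> 0 \<Longrightarrow> st (pos x) = x"
    and "\<And>k. 1 \<le> k \<Longrightarrow> k < sp \<Longrightarrow> step H px wy cy (st k) (st (Suc k))"
    and "0 < sp \<Longrightarrow> i \<le> m" "0 < sp \<Longrightarrow> st 1 = xo i"
    and "1 \<le> i" "i \<le> Suc m"
    and "\<And>p. 1 \<le> p \<Longrightarrow> p < i \<Longrightarrow> last_pos xo m (xo p) < px (xo p)"
  using assms unfolding rr_stack_def by metis+

lemma rr_stackI:
  assumes "\<And>k. 1 \<le> k \<Longrightarrow> k \<le> sp \<Longrightarrow> st k \<in> xo ` ids"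
    and "\<And>k. 1 \<le> k \<Longrightarrow> k \<le> sp \<Longrightarrow> pos (st k) = k"
    and "\<And>x. pos x \<noteq> 0 \<Longrightarrow> pos x \<le> sp"
    and "\<And>x. pos x \<noteq> 0 \<Longrightarrow> st (pos x) = x"
    and "\<And>k. 1 \<le> k \<Longrightarrow> k < sp \<Longrightarrow> step H px wy cy (st k) (st (Suc k))"
    and "0 < sp \<Longrightarrow> i \<le> m" "0 < sp \<Longrightarrow> st 1 = xo i"
    and "1 \<le> i" "i \<le> Suc m"
    and "\<And>p. 1 \<le> p \<Longrightarrow> p < i \<Longrightarrow> last_pos xo m (xo p) < px (xo p)"
  shows "rr_stack H px wy cy st pos sp i"
  unfolding rr_stack_def by (intro conjI allI impI; (elim conjE)?; rule assms; assumption)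

text \<open>The agents on the stack are distinct owners of positions. The bound lets
  \<open>m - sp\<close> serve as the part of the potential that pays for pushing.\<close>

lemma rr_stack_size:
  assumes "rr_stack H px wy cy st pos sp i" shows "sp \<le> m"
proof -
  note S = rr_stackD[OF assms]
  have "inj_on st {1..sp}" by (rule inj_on_inverseI[of _ pos]) (use S(2) in auto)
  moreover have "st ` {1..sp} \<subseteq> xo ` ids" using S(1) by auto
  ultimately have "card {1..sp} \<le> card (xo ` ids)" by (metis card_image card_mono finite_ids finite_imageI)
  also have "\<dots> \<le> card ids" by (rule card_image_le) simp
  finally show ?thesis by (simp add: ids_def)
qed

lemma rr_stack_init: "rr_stack H px wy cy st (\<lambda>_. 0) 0 1"
  by (rule rr_stackI) auto

text \<open>The steps below the top do not read the pointer of the top, as the agents on the stack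
  are distinct.\<close>

lemma rr_stack_top_px:
  assumes "rr_stack H px wy cy st pos sp i" "1 \<le> sp"
  shows "rr_stack H (px((st sp) := Suc (px (st sp)))) wy cy st pos sp i"
proof -
  note S = rr_stackD[OF assms(1)]
  show ?thesis
  proof (rule rr_stackI)
    fix k assume k: "1 \<le> k" "k < sp"
    have "st k \<noteq> st sp" using S(2)[of k] S(2)[of sp] k by auto
    then show "step H (px((st sp) := Suc (px (st sp)))) wy cy (st k) (st (Suc k))"
      using S(5)[OF k] by (simp add: step_def)
  next
    show "last_pos xo m (xo p) < (px((st sp) := Suc (px (st sp)))) (xo p)" if "1 \<le> p" "p < i" for p
      using S(10)[OF that] by auto
  qed (rule S; assumption)+
qed

text \<open>A step needs a held edge under \<open>wy\<close>, so no step on the stack passes through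
  a \<open>y\<close> whose pointer has to be lowered.\<close>

lemma rr_stack_lower:
  assumes "rr_stack H px wy cy st pos sp i" "wy y \<notin> H"
  shows "rr_stack H px (wy(y := wy y - 1)) cy st pos sp i"
proof -
  note S = rr_stackD[OF assms(1)]
  show ?thesis
  proof (rule rr_stackI)
    fix k assume k: "1 \<le> k" "k < sp"
    have "xe (px (st k)) \<noteq> y" using S(5)[OF k] assms(2) by (auto simp: step_def)
    then show "step H px (wy(y := wy y - 1)) cy (st k) (st (Suc k))"
      using S(5)[OF k] by (simp add: step_def)
  qed (rule S; assumption)+
qed

lemma rr_stack_push:
  assumes "rr_stack H px wy cy st pos sp i" "1 \<le> sp" "step H px wy cy (st sp) x" "pos x = 0" "x \<in> xo ` ids"
  shows "rr_stack H px wy cy (st(Suc sp := x)) (pos(x := Suc sp)) (Suc sp) i"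
proof -
  note S = rr_stackD[OF assms(1)]
  have ne: "st k \<noteq> x" if "1 \<le> k" "k \<le> sp" for k using S(2)[OF that] assms(4) that by auto
  show ?thesis
  proof (rule rr_stackI)
    fix k assume k: "1 \<le> k" "k \<le> Suc sp"
    show "(st(Suc sp := x)) k \<in> xo ` ids" using S(1)[of k] k assms(5) by (cases "k = Suc sp") simp_all
    show "(pos(x := Suc sp)) ((st(Suc sp := x)) k) = k"
      using S(2)[of k] ne[of k] k by (cases "k = Suc sp") simp_all
  next
    fix x' assume x': "(pos(x := Suc sp)) x' \<noteq> 0"
    show "(pos(x := Suc sp)) x' \<le> Suc sp" using S(3)[of x'] x' by (cases "x' = x") simp_all
    show "(st(Suc sp := x)) ((pos(x := Suc sp)) x') = x'"
      using S(3,4)[of x'] x' by (cases "x' = x") auto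
  next
    fix k assume k: "1 \<le> k" "k < Suc sp"
    show "step H px wy cy ((st(Suc sp := x)) k) ((st(Suc sp := x)) (Suc k))"
      using S(5)[of k] k assms(3) by (cases "k = sp") simp_all
  next
    show "i \<le> m" using S(6) assms(2) by simp
    show "(st(Suc sp := x)) 1 = xo i" using S(7) assms(2) by simp
  qed (rule S; assumption)+
qed

lemma rr_stack_first:
  assumes "rr_stack H px wy cy st pos 0 i" "i \<le> m"
  shows "rr_stack H px wy cy (st(1 := xo i)) (pos(xo i := 1)) 1 i"
proof -
  note S = rr_stackD[OF assms(1)]
  have z: "pos x = 0" for x using S(3)[of x] by (cases "pos x = 0") simp_all
  have i: "xo i \<in> xo ` ids" using S(8) assms(2) by (auto simp: ids_def)
  show ?thesis by (rule rr_stackI) (use S(8-10) assms(2) z i in \<open>auto split: if_splits\<close>)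
qed

text \<open>The scan may advance when the bottom \<open>st 1 = xo i\<close> leaves the stack with an
  exhausted list, which is what the scan claims about all positions before \<open>i\<close>.\<close>

lemma rr_stack_pop:
  assumes "rr_stack H px wy cy st pos (Suc n) i"
    and "i' = i \<or> n = 0 \<and> i' = Suc i \<and> last_pos xo m (st 1) < px (st 1)"
  shows "rr_stack H px wy cy st (pos(st (Suc n) := 0)) n i'"
proof -
  note S = rr_stackD[OF assms(1)]
  have ne: "st k \<noteq> st (Suc n)" if "1 \<le> k" "k \<le> n" for k using S(2)[of k] S(2)[of "Suc n"] that by auto
  have im: "i \<le> m" "st 1 = xo i" using S(6,7) by simp_all
  show ?thesis
  proof (rule rr_stackI)
    fix k assume k: "1 \<le> k" "k \<le> n"
    show "st k \<in> xo ` ids" using S(1)[of k] k by simp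
    show "(pos(st (Suc n) := 0)) (st k) = k" using S(2)[of k] k ne by simp
  next
    fix x assume x: "(pos(st (Suc n) := 0)) x \<noteq> 0"
    then have x': "pos x \<noteq> 0" "x \<noteq> st (Suc n)" by (auto split: if_splits)
    have "pos x \<noteq> Suc n" using S(4)[OF x'(1)] x'(2) by auto
    then show "(pos(st (Suc n) := 0)) x \<le> n" using S(3)[OF x'(1)] x' by simp
    show "st ((pos(st (Suc n) := 0)) x) = x" using S(4)[OF x'(1)] x' by simp
  next
    show "step H px wy cy (st k) (st (Suc k))" if "1 \<le> k" "k < n" for k using S(5) that by simp
    show "i' \<le> m" if "0 < n" using assms(2) im that by auto
    show "st 1 = xo i'" if "0 < n" using assms(2) im that by auto
    show "1 \<le> i'" "i' \<le> Suc m" using S(8) im assms(2) by auto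
    show "last_pos xo m (xo p) < px (xo p)" if "1 \<le> p" "p < i'" for p
      using S(10)[of p] assms(2) im that by (cases "p = i") auto
  qed
qed

end

section \<open>Elimination of rotations\<close>

lemma card_exchange:
  assumes "finite A" "a \<notin> A" "b \<in> A" shows "card (insert a (A - {b})) = card A"
proof -
  have "card (insert a (A - {b})) = Suc (card (A - {b}))" using assms by simp
  then show ?thesis using card_Suc_Diff1[OF assms(1,3)] by metis
qed

context tables
begin

lemma step_facts:
  assumes inv: "rr_core G H px wy cy" and x: "x \<in> xo ` ids" and st: "step H px wy cy x x'"
  shows "cr (px x) \<in> G" "cr (px x) \<in> ids" "cr (px x) \<notin> H" "yo (cr (px x)) = xe (px x)" "ye (cr (px x)) = x"
    and "wy (xe (px x)) \<in> H" "wy (xe (px x)) \<in> ids" "yo (wy (xe (px x))) = xe (px x)" "ye (wy (xe (px x))) = x'"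
    and "cr (px x) < wy (xe (px x))" "px x \<in> ids" "xo (px x) = x"
    and "(Some x, Some (xe (px x))) \<in> rotation_arcs X (inst_of G) (edge ` H)"
    and "(Some (xe (px x)), Some x') \<in> rotation_arcs X (inst_of G) (edge ` H)"
proof -
  have p: "px x \<le> last_pos xo m x" and s: "cr (px x) \<notin> H" "cr (px x) \<le> wy (xe (px x))" "wy (xe (px x)) \<in> H"
    and e: "yo (wy (xe (px x))) = xe (px x)" "ye (wy (xe (px x))) = x'" "cr (px x) < wy (xe (px x))"
    and f: "\<not> cy (xe (px x)) < quota I (xe (px x))"
    using st by (simp_all add: step_def)
  note D = rr_coreD[OF inv] and P = rr_position[OF inv x p] and A = rr_arcs[OF inv x p s]
  show "cr (px x) \<in> G" "cr (px x) \<in> ids" "yo (cr (px x)) = xe (px x)" "ye (cr (px x)) = x" "px x \<in> ids" "xo (px x) = x"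
    by (rule P)+
  show "cr (px x) \<notin> H" "wy (xe (px x)) \<in> H" "yo (wy (xe (px x))) = xe (px x)" "ye (wy (xe (px x))) = x'" "cr (px x) < wy (xe (px x))"
    by (rule s e)+
  show "wy (xe (px x)) \<in> ids" using s(3) D(1,2) by blast
  show "(Some x, Some (xe (px x))) \<in> rotation_arcs X (inst_of G) (edge ` H)" by (rule A)
  show "(Some (xe (px x)), Some x') \<in> rotation_arcs X (inst_of G) (edge ` H)" using A(2) f e(2) by simp
qed

text \<open>Each \<open>y\<close> on the rotation trades its worst partner for a better one. So
  \<open>wy\<close> remains a bound, the numbers of partners do not change, and no candidate arises.
  The pointer of each \<open>x\<close> may move on because the edge under it is now in the
  assignment.\<close>

lemma rr_core_rotate:
  assumes inv: "rr_core G H px wy cy" and S: "S \<subseteq> xo ` ids"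
    and st: "\<And>x. x \<in> S \<Longrightarrow> step H px wy cy x (nx x)" and inj: "inj_on nx S"
    and H': "H' = (H - (\<lambda>x. wy (xe (px x))) ` S) \<union> (\<lambda>x. cr (px x)) ` S"
  shows "rr_core G H' (\<lambda>x. if x \<in> S then Suc (px x) else px x) wy cy"
proof -
  note D = rr_coreD[OF inv]
  define q where "q x = cr (px x)" for x
  define y where "y x = xe (px x)" for x
  define w where "w x = wy (y x)" for x
  have F: "q x \<in> G" "q x \<in> ids" "q x \<notin> H" "yo (q x) = y x" "ye (q x) = x"
      "w x \<in> H" "w x \<in> ids" "yo (w x) = y x" "ye (w x) = nx x" "q x < w x" if "x \<in> S" for x
    unfolding q_def y_def w_def by (rule step_facts[OF inv subsetD[OF S that] st[OF that]])+
  have H'2: "H' = (H - w ` S) \<union> q ` S" by (simp add: H' q_def w_def y_def)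
  \<comment> \<open>\<open>y x\<close> determines the edge under its pointer \<open>wy\<close> and
    hence \<open>nx x\<close>; injectivity of \<open>nx\<close> thus makes the agents of
    \<open>Y\<close> on the rotation distinct.\<close>
  have yinj: "x = x'" if "x \<in> S" "x' \<in> S" "y x = y x'" for x x'
  proof -
    have "nx x = nx x'" using F(9)[OF that(1)] F(9)[OF that(2)] that(3) by (simp add: w_def)
    then show ?thesis using inj that by (simp add: inj_on_def)
  qed
  have wmax: "q' \<le> w x" if "x \<in> S" "q' \<in> H" "yo q' = y x" for q' x
    using D(5)[OF that(2)] that(3) by (simp add: w_def)
  have at: "at_y H' (y x) = insert (q x) (at_y H (y x) - {w x})" if x: "x \<in> S" for x
  proof -
    have "q' = w x" if "q' \<in> w ` S" "yo q' = y x" for q'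
    proof -
      obtain x' where x': "x' \<in> S" "q' = w x'" using \<open>q' \<in> w ` S\<close> by blast
      have "x' = x" by (rule yinj) (use x' x that(2) F(8)[OF x'(1)] in simp_all)
      then show ?thesis using x' by simp
    qed
    moreover have "q' = q x" if "q' \<in> q ` S" "yo q' = y x" for q'
    proof -
      obtain x' where x': "x' \<in> S" "q' = q x'" using \<open>q' \<in> q ` S\<close> by blast
      have "x' = x" by (rule yinj) (use x' x that(2) F(4)[OF x'(1)] in simp_all)
      then show ?thesis using x' by simp
    qed
    ultimately show ?thesis using x F(4)[OF x] unfolding H'2 at_y_def by blast
  qed
  have at': "at_y H' v = at_y H v" if "v \<notin> y ` S" for v
    using that F(4,8) unfolding H'2 at_y_def by blast
  have sub: "H \<subseteq> ids" using D(1,2) by blast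
  \<comment> \<open>At a \<open>y\<close> of the rotation, every partner in \<open>H'\<close> is at
    most \<open>w x\<close>; so \<open>q0\<close> precedes \<open>w x\<close>, which is in
    \<open>H\<close>. Since \<open>w x\<close> is the only edge of \<open>y\<close> that was given
    up, \<open>q0\<close> was not in \<open>H\<close> either.\<close>
  have old: "cand G H q0" if c: "cand G H' q0" for q0
  proof (cases "yo q0 \<in> y ` S")
    case True
    then obtain x where x: "x \<in> S" "yo q0 = y x" by blast
    obtain q' where q': "q' \<in> at_y H' (y x)" "q0 < q'" using c x(2) by (auto simp: cand_def at_y_def)
    have "q' \<le> w x" using q'(1) wmax[OF x(1)] F(10)[OF x(1)] unfolding at[OF x(1)] by (auto simp: at_y_def)
    then have lt: "q0 < w x" using q'(2) by simp
    have "q0 \<notin> at_y H' (y x)" using c by (auto simp: cand_def at_y_def)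
    then have "q0 \<notin> H" using lt x(2) unfolding at[OF x(1)] by (auto simp: at_y_def)
    then show ?thesis using c lt x F(6,8)[OF x(1)] unfolding cand_def by metis
  next
    case False
    have "q' \<in> H' \<longleftrightarrow> q' \<in> H" if "yo q' = yo q0" for q'
      using at'[OF False] that by (auto simp: at_y_def)
    then show ?thesis using c unfolding cand_def by blast
  qed
  show ?thesis
  proof (rule rr_coreI)
    show "H' \<subseteq> G" using D(1) F(1) unfolding H'2 by blast
    show "q' \<le> wy (yo q')" if q': "q' \<in> H'" for q'
    proof (cases "q' \<in> H")
      case False
      then obtain x where "x \<in> S" "q' = q x" using q' unfolding H'2 by blast
      then show ?thesis using F(4,10)[of x] by (simp add: w_def)
    qed (rule D)
    show "card (at_y H' v) = cy v" if v: "v \<in> ys" for v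
    proof (cases "v \<in> y ` S")
      case True
      then obtain x where x: "x \<in> S" "v = y x" by blast
      have "q x \<notin> at_y H (y x)" using F(3)[OF x(1)] by (simp add: at_y_def)
      moreover have "w x \<in> at_y H (y x)" using F(6,8)[OF x(1)] by (simp add: at_y_def)
      moreover have "finite (at_y H (y x))" using sub by simp
      ultimately have "card (at_y H' v) = card (at_y H v)" unfolding x(2) at[OF x(1)]
        by (metis card_exchange)
      then show ?thesis using D(7)[OF v] by simp
    next
      case False
      then show ?thesis using at' D(7)[OF v] by simp
    qed
    fix p assume p: "p \<in> ids"
    show "cr p \<in> G" if "(if xo p \<in> S then Suc (px (xo p)) else px (xo p)) \<le> p"
      using D(3)[OF p] that by (simp split: if_splits)
    show "first_pos xo m (xo p) \<le> (if xo p \<in> S then Suc (px (xo p)) else px (xo p))"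
      using D(8)[OF p] by simp
    show "\<not> cand G H' (cr p)" if lt: "p < (if xo p \<in> S then Suc (px (xo p)) else px (xo p))"
    proof (cases "p < px (xo p)")
      case True
      then show ?thesis using D(4)[OF p] old by blast
    next
      case False
      then have "xo p \<in> S" "p = px (xo p)" using lt by (auto split: if_splits)
      then have "cr p \<in> H'" unfolding H'2 q_def by (metis UnI2 imageI)
      then show ?thesis by (simp add: cand_def)
    qed
  qed (rule D; assumption)+
qed

text \<open>In a rotation the agent of \<open>Y\<close> in pair \<open>t\<close> is the
  \<open>s\<close> of the agent of \<open>X\<close> in pair \<open>t - 1\<close>. So the first pair
  takes its \<open>y\<close> from the top of the stack, where the cycle closes.\<close>

definition rotation_of :: "('v \<Rightarrow> nat) \<Rightarrow> (nat \<Rightarrow> 'v) \<Rightarrow> nat \<Rightarrow> nat \<Rightarrow> 'v rotation" where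
  "rotation_of px st j sp =
     map (\<lambda>t. (xe (px (st (if t = 0 then sp else j + t - 1))), st (j + t))) [0..<Suc sp - j]"

definition rotated :: "nat set \<Rightarrow> ('v \<Rightarrow> nat) \<Rightarrow> ('v \<Rightarrow> nat) \<Rightarrow> 'v set \<Rightarrow> nat set" where
  "rotated H px wy S = (H - (\<lambda>x. wy (xe (px x))) ` S) \<union> (\<lambda>x. cr (px x)) ` S"

text \<open>The stack is cut at \<open>j - 1\<close>. The step from \<open>st (j - 1)\<close> to
  \<open>st j\<close> is given up, since it may pass through the same \<open>y\<close> as the
  closing step; the steps further down lead to agents outside the rotation and therefore use other
  agents of \<open>Y\<close>.\<close>

lemma rr_rotate:
  assumes inv: "rr_core G H px wy cy" and stk: "rr_stack H px wy cy st pos sp i"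
    and j: "1 \<le> j" "j \<le> sp" and close: "step H px wy cy (st sp) (st j)"
    and re: "reached M0 ops G H" and S: "S = st ` {j..sp}" and H': "H' = rotated H px wy S"
  shows "reached M0 (ops @ [Eliminate (rotation_of px st j sp)]) G H'"
    and "rr_core G H' (\<lambda>x. if x \<in> S then Suc (px x) else px x) wy cy"
    and "rr_stack H' (\<lambda>x. if x \<in> S then Suc (px x) else px x) wy cy st (\<lambda>x. if x \<in> S then 0 else pos x) (j - 1) i"
proof -
  note D = rr_coreD[OF inv] and K = rr_stackD[OF stk]
  \<comment> \<open>\<open>succ\<close> follows the cycle on stack indices, and
    \<open>pred t\<close> is the index before \<open>j + t\<close>; pair \<open>t\<close> of the
    rotation is \<open>(y (pred t), st (j + t))\<close>.\<close>
  define succ where "succ k = (if k = sp then j else Suc k)" for k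
  define pred where "pred t = (if t = 0 then sp else j + t - 1)" for t
  define r where "r = Suc sp - j"
  define y where "y k = xe (px (st k))" for k
  have stpos: "pos (st k) = k" if "k \<in> {j..sp}" for k using K(2)[of k] that j by simp
  have stinj: "k = k'" if "k \<in> {j..sp}" "k' \<in> {j..sp}" "st k = st k'" for k k'
    using stpos that by metis
  have ids: "st k \<in> xo ` ids" if "k \<in> {j..sp}" for k using K(1)[of k] that j by simp
  have stp: "step H px wy cy (st k) (st (succ k))" if "k \<in> {j..sp}" for k
    using K(5)[of k] close that j by (simp add: succ_def)
  have succ_in: "succ k \<in> {j..sp}" if "k \<in> {j..sp}" for k using that j by (simp add: succ_def)
  have succ_inj: "k = k'" if "k \<in> {j..sp}" "k' \<in> {j..sp}" "succ k = succ k'" for k k'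
    using that by (auto simp: succ_def split: if_splits)
  note F = step_facts[OF inv ids stp, folded y_def]
  have yinj: "k = k'" if "k \<in> {j..sp}" "k' \<in> {j..sp}" "y k = y k'" for k k'
  proof -
    have "st (succ k) = st (succ k')" using F(9)[OF that(1,1)] F(9)[OF that(2,2)] that(3) by simp
    then show ?thesis using stinj succ_in succ_inj that by blast
  qed
  have pred_in: "pred t \<in> {j..sp}" and succ_pred: "succ (pred t) = j + t" and tin: "j + t \<in> {j..sp}"
    and pred_Suc: "pred (Suc t mod r) = j + t" if "t < r" for t
  proof -
    show "pred t \<in> {j..sp}" "succ (pred t) = j + t" "j + t \<in> {j..sp}"
      using that j by (auto simp: pred_def succ_def r_def)
    show "pred (Suc t mod r) = j + t"
    proof (cases "Suc t = r")
      case True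
      then show ?thesis using j by (simp add: pred_def r_def)
    next
      case False
      then show ?thesis using that by (simp add: pred_def)
    qed
  qed
  have pred_inj: "t = t'" if "t < r" "t' < r" "pred t = pred t'" for t t'
  proof -
    have "j + t = j + t'" using succ_pred[OF that(1)] succ_pred[OF that(2)] that(3) by metis
    then show ?thesis by simp
  qed
  define nx where "nx x = st (succ (pos x))" for x
  have nx: "step H px wy cy x (nx x)" if "x \<in> S" for x
  proof -
    obtain k where "k \<in> {j..sp}" "x = st k" using \<open>x \<in> S\<close> unfolding S by blast
    then show ?thesis using stp stpos by (simp add: nx_def)
  qed
  have nxinj: "inj_on nx S"
  proof (rule inj_onI)
    fix x x' assume "x \<in> S" "x' \<in> S" and eq: "nx x = nx x'"
    then obtain k k' where k: "k \<in> {j..sp}" "x = st k" "k' \<in> {j..sp}" "x' = st k'" unfolding S by blast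
    then have "succ k = succ k'" using eq stpos stinj succ_in by (simp add: nx_def)
    then show "x = x'" using k succ_inj by blast
  qed
  have Sids: "S \<subseteq> xo ` ids" using ids unfolding S by blast
  show "rr_core G H' (\<lambda>x. if x \<in> S then Suc (px x) else px x) wy cy"
    by (rule rr_core_rotate[OF inv Sids nx nxinj]) (simp_all add: H' rotated_def)
  let ?\<rho> = "rotation_of px st j sp"
  have len: "length ?\<rho> = r" by (simp add: rotation_of_def r_def)
  have nth: "?\<rho> ! t = (y (pred t), st (j + t))" if "t < r" for t
    using that by (simp add: rotation_of_def r_def y_def pred_def)
  have rpos: "0 < r" using j by (simp add: r_def)
  have set\<rho>: "set ?\<rho> = (\<lambda>t. (y (pred t), st (j + t))) ` {..<r}"
    by (simp add: rotation_of_def r_def y_def pred_def atLeast0LessThan)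
  have yk: "y k \<in> ys" if "k \<in> {j..sp}" for k using y_mem[OF F(2)[OF that that]] F(4)[OF that that] by simp
  have xk: "st k \<in> xs" if "k \<in> {j..sp}" for k using x_mem[OF F(2)[OF that that]] F(5)[OF that that] by simp
  have "is_rotation X (inst_of G) (edge ` H) ?\<rho>"
    unfolding is_rotation_def inst_of_simps
  proof (intro conjI directed_cycle_interleaveI)
    show "\<forall>(u, x) \<in> set ?\<rho>. u \<in> ys \<and> x \<in> xs"
      unfolding set\<rho> using yk xk pred_in tin by auto
    show "?\<rho> \<noteq> []" using rpos len by auto
    have "map fst ?\<rho> = map (\<lambda>t. y (pred t)) [0..<r]" "map snd ?\<rho> = map (\<lambda>t. st (j + t)) [0..<r]"
      by (simp_all add: rotation_of_def r_def y_def pred_def)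
    moreover have "inj_on (\<lambda>t. y (pred t)) {..<r}"
      by (rule inj_onI, rule pred_inj) (use yinj[OF pred_in pred_in] in auto)
    moreover have "inj_on (\<lambda>t. st (j + t)) {..<r}"
    proof (rule inj_onI)
      fix t t' assume "t \<in> {..<r}" "t' \<in> {..<r}" "st (j + t) = st (j + t')"
      then have "j + t = j + t'" using stinj tin by blast
      then show "t = t'" by simp
    qed
    ultimately show "distinct (map fst ?\<rho>)" "distinct (map snd ?\<rho>)"
      by (simp_all add: distinct_map atLeast0LessThan)
    show "fst ` set ?\<rho> \<inter> snd ` set ?\<rho> = {}"
    proof -
      have "fst ` set ?\<rho> \<subseteq> ys" "snd ` set ?\<rho> \<subseteq> xs" unfolding set\<rho> using yk xk pred_in tin by auto
      then show ?thesis using disjoint by blast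
    qed
    fix t assume t: "t < length ?\<rho>"
    then have t: "t < r" using len by simp
    have m: "Suc t mod r < r" using rpos by simp
    show "(Some (fst (?\<rho> ! t)), Some (snd (?\<rho> ! t))) \<in> rotation_arcs X (inst_of G) (edge ` H)"
      using F(14)[OF pred_in[OF t] pred_in[OF t]] succ_pred[OF t] nth[OF t] by simp
    show "(Some (snd (?\<rho> ! t)), Some (fst (?\<rho> ! (Suc t mod length ?\<rho>)))) \<in> rotation_arcs X (inst_of G) (edge ` H)"
      using F(13)[OF tin[OF t] tin[OF t]] nth[OF t] nth[OF m] pred_Suc[OF t] len by simp
  qed
  moreover have "eliminate (edge ` H) ?\<rho> = edge ` H'"
  proof -
    let ?W = "(\<lambda>x. wy (xe (px x))) ` S" and ?Q = "(\<lambda>x. cr (px x)) ` S"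
    have ew: "edge (wy (y k)) = {st (succ k), y k}" if "k \<in> {j..sp}" for k
      using F(8,9)[OF that that] by (simp add: edge_def insert_commute)
    have eq: "edge (cr (px (st k))) = {st k, y k}" if "k \<in> {j..sp}" for k
      using F(4,5)[OF that that] by (simp add: edge_def insert_commute)
    have W: "?W = (\<lambda>t. wy (y (pred t))) ` {..<r}"
    proof -
      have "{j..sp} \<subseteq> pred ` {..<r}"
      proof
        fix k assume "k \<in> {j..sp}"
        then have "k = pred (if k = sp then 0 else Suc k - j)" "(if k = sp then 0 else Suc k - j) < r"
          using j by (auto simp: pred_def r_def)
        then show "k \<in> pred ` {..<r}" by blast
      qed
      then have *: "{j..sp} = pred ` {..<r}" using pred_in by auto
      show ?thesis unfolding S y_def * image_image ..
    qed
    have "{j..sp} = (+) j ` {..<r}"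
    proof
      show "{j..sp} \<subseteq> (+) j ` {..<r}"
      proof
        fix k assume k: "k \<in> {j..sp}"
        then have "k = j + (k - j)" "k - j < r" by (auto simp: r_def)
        then show "k \<in> (+) j ` {..<r}" by blast
      qed
    qed (use tin in auto)
    then have Q: "?Q = (\<lambda>t. cr (px (st (j + t)))) ` {..<r}" unfolding S by (simp add: image_image)
    have 1: "{{x, u} | x u. (u, x) \<in> set ?\<rho>} = edge ` ?W"
    proof -
      have "{{x, u} | x u. (u, x) \<in> set ?\<rho>} = (\<lambda>t. {st (j + t), y (pred t)}) ` {..<r}"
        unfolding set\<rho> by blast
      also have "\<dots> = (\<lambda>t. edge (wy (y (pred t)))) ` {..<r}"
        using ew pred_in succ_pred by (intro image_cong) simp_all
      finally show ?thesis by (simp only: W image_image)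
    qed
    have 2: "{{snd (?\<rho> ! t), fst (?\<rho> ! (Suc t mod length ?\<rho>))} | t. t < length ?\<rho>} = edge ` ?Q"
    proof -
      have "{{snd (?\<rho> ! t), fst (?\<rho> ! (Suc t mod length ?\<rho>))} | t. t < length ?\<rho>}
          = (\<lambda>t. {snd (?\<rho> ! t), fst (?\<rho> ! (Suc t mod r))}) ` {..<r}"
        unfolding len by blast
      also have "\<dots> = (\<lambda>t. edge (cr (px (st (j + t))))) ` {..<r}"
      proof (rule image_cong)
        fix t assume "t \<in> {..<r}"
        then have t: "t < r" by simp
        have "Suc t mod r < r" using rpos by simp
        from nth[OF this] show "{snd (?\<rho> ! t), fst (?\<rho> ! (Suc t mod r))} = edge (cr (px (st (j + t))))"
          using nth[OF t] pred_Suc[OF t] eq[OF tin[OF t]] by simp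
      qed simp
      finally show ?thesis by (simp only: Q image_image)
    qed
    have sub: "H \<subseteq> ids" "?W \<subseteq> ids" using D(1,2) F(7) unfolding S y_def by blast+
    have "edge ` H - edge ` ?W = edge ` (H - ?W)"
      using inj_on_image_set_diff[OF inj_edge, of H ?W] sub by auto
    then show ?thesis unfolding eliminate_def 1 2 H' rotated_def by (simp add: image_Un)
  qed
  ultimately show "reached M0 (ops @ [Eliminate ?\<rho>]) G H'" by (rule reached_eliminate[OF re])
  show "rr_stack H' (\<lambda>x. if x \<in> S then Suc (px x) else px x) wy cy st (\<lambda>x. if x \<in> S then 0 else pos x) (j - 1) i"
  proof (rule rr_stackI)
    have nin: "st k \<notin> S" if k: "1 \<le> k" "k \<le> j - 1" for k
    proof
      assume "st k \<in> S"
      then obtain k' where k': "k' \<in> {j..sp}" "st k = st k'" unfolding S by blast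
      have "k \<le> sp" using k(2) j by simp
      then have "k = k'" using K(2)[OF k(1)] stpos[OF k'(1)] k'(2) by metis
      then show False using k k' j by auto
    qed
    fix k :: nat assume k: "1 \<le> k"
    show "st k \<in> xo ` ids" if "k \<le> j - 1" using K(1)[of k] k that j by simp
    show "(if st k \<in> S then 0 else pos (st k)) = k" if "k \<le> j - 1" using K(2)[of k] nin k that j by simp
    assume lt: "k < j - 1"
    have s: "step H px wy cy (st k) (st (Suc k))" using K(5)[of k] k lt j by simp
    have n: "st k \<notin> S" "st (Suc k) \<notin> S" using nin k lt by simp_all
    have ki: "st k \<in> xo ` ids" using K(1)[of k] k lt j by simp
    note E = step_facts[OF inv ki s]
    have "cr (px (st k)) \<notin> (\<lambda>x. cr (px x)) ` S"
    proof
      assume "cr (px (st k)) \<in> (\<lambda>x. cr (px x)) ` S"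
      then obtain k' where k': "k' \<in> {j..sp}" "cr (px (st k)) = cr (px (st k'))" unfolding S by blast
      then have "st k = st k'" using E(5) F(5)[OF k'(1,1)] by metis
      then show False using n k' unfolding S by blast
    qed
    moreover have "wy (xe (px (st k))) \<notin> (\<lambda>x. wy (xe (px x))) ` S"
    proof
      assume "wy (xe (px (st k))) \<in> (\<lambda>x. wy (xe (px x))) ` S"
      then obtain k' where k': "k' \<in> {j..sp}" "wy (xe (px (st k))) = wy (y k')" unfolding S y_def by blast
      then have "st (Suc k) = st (succ k')" using E(9) F(9)[OF k'(1,1)] by metis
      then show False using n succ_in[OF k'(1)] unfolding S by blast
    qed
    ultimately show "step H' (\<lambda>x. if x \<in> S then Suc (px x) else px x) wy cy (st k) (st (Suc k))"
      using s n unfolding step_def H' rotated_def by simp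
  next
    fix x assume x: "(if x \<in> S then 0 else pos x) \<noteq> 0"
    then have nS: "x \<notin> S" "pos x \<noteq> 0" by (auto split: if_splits)
    have "pos x \<notin> {j..sp}" using K(4)[OF nS(2)] nS(1) unfolding S by force
    then show "(if x \<in> S then 0 else pos x) \<le> j - 1" using K(3)[OF nS(2)] nS j by auto
    show "st (if x \<in> S then 0 else pos x) = x" using K(4)[OF nS(2)] nS by simp
  next
    show "i \<le> m" "st 1 = xo i" using K(6,7) j by simp_all
    show "last_pos xo m (xo p) < (if xo p \<in> S then Suc (px (xo p)) else px (xo p))" if "1 \<le> p" "p < i" for p
      using K(10)[OF that] by simp
  qed (rule K)+
qed

end

section \<open>Reading the tables\<close>

text \<open>
  Array names: \<open>xo\<close>, \<open>xe\<close>, \<open>yo\<close>, \<open>ye\<close>, \<open>cr\<close>, \<open>rc\<close> as in the locale \<open>tables\<close>; \<open>xl\<close>, \<open>yl\<close> last position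
  of each owner; \<open>px\<close>, \<open>py\<close>, \<open>wx\<close>, \<open>wy\<close> pointers into the list of each owner, as in the invariants;
  \<open>mk\<close> positions \<open>q\<close> of the edges in the current assignment; \<open>cx\<close>, \<open>cy\<close> number of partners; \<open>qu\<close>
  queue of proposers; \<open>st\<close> stack of height \<open>sp\<close>, and \<open>ps\<close> the position on it of each agent, or 0.
\<close>

fun owner_array :: "side \<Rightarrow> string" where
  "owner_array Students = ''student_owner''"
| "owner_array Schools = ''school_owner''"

fun entry_array :: "side \<Rightarrow> string" where
  "entry_array Students = ''student_entry''"
| "entry_array Schools = ''school_entry''"

text \<open>The column of owners in \<open>Y\<close> doubles as the initial queue of proposers:
  repetitions are harmless, and agents without edges never enter.\<close>

definition copy_step :: "side \<Rightarrow> com" where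
  "copy_step X =
     (Store ''xo'' (Var ''i'') (Cell (owner_array X) (Var ''i'')) ;;
      Store ''xe'' (Var ''i'') (Cell (entry_array X) (Var ''i'')) ;;
      Store ''yo'' (Var ''i'') (Cell (owner_array (opposite X)) (Var ''i'')) ;;
      Store ''ye'' (Var ''i'') (Cell (entry_array (opposite X)) (Var ''i'')) ;;
      Store ''qu'' (Var ''i'') (Cell ''yo'' (Var ''i'')))"

text \<open>Only the value 0 is overwritten in \<open>px\<close> and \<open>py\<close>, so these
  keep the first position. \<open>hd\<close> and \<open>nx\<close> thread, for each entry, a
  decreasing list of its positions.\<close>

definition index_step :: com where
  "index_step =
     (Store ''xl'' (Cell ''xo'' (Var ''i'')) (Var ''i'') ;;
      Store ''wx'' (Cell ''xo'' (Var ''i'')) (Var ''i'') ;;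
      Cond (Equal (Cell ''px'' (Cell ''xo'' (Var ''i''))) (Const 0))
        (Store ''px'' (Cell ''xo'' (Var ''i'')) (Var ''i'')) Skip ;;
      Store ''yl'' (Cell ''yo'' (Var ''i'')) (Var ''i'') ;;
      Store ''wy'' (Cell ''yo'' (Var ''i'')) (Var ''i'') ;;
      Cond (Equal (Cell ''py'' (Cell ''yo'' (Var ''i''))) (Const 0))
        (Store ''py'' (Cell ''yo'' (Var ''i'')) (Var ''i'')) Skip ;;
      Store ''nx'' (Var ''i'') (Cell ''hd'' (Cell ''ye'' (Var ''i''))) ;;
      Store ''hd'' (Cell ''ye'' (Var ''i'')) (Var ''i''))"

lemma last_pos_upd: "(last_pos ow n)(ow (Suc n) := Suc n) = last_pos ow (Suc n)"
  by (rule ext) simp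

lemma first_pos_upd:
  "(if first_pos ow n (ow (Suc n)) = 0 then (first_pos ow n)(ow (Suc n) := Suc n) else first_pos ow n) = first_pos ow (Suc n)"
  by (rule ext) auto

lemma runs_copy:
  assumes "s ''m'' 0 = m"
  shows "runs (For (copy_step X)) s (2 + 7 * m) (\<lambda>s'. \<forall>p \<in> {1..m}.
     s' ''xo'' p = s (owner_array X) p \<and> s' ''xe'' p = s (entry_array X) p \<and>
     s' ''yo'' p = s (owner_array (opposite X)) p \<and> s' ''ye'' p = s (entry_array (opposite X)) p \<and>
     s' ''qu'' p = s' ''yo'' p)"
proof -
  define P where "P i s' \<longleftrightarrow> (\<forall>p. 1 \<le> p \<longrightarrow> p < i \<longrightarrow>
     s' ''xo'' p = s (owner_array X) p \<and> s' ''xe'' p = s (entry_array X) p \<and>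
     s' ''yo'' p = s (owner_array (opposite X)) p \<and> s' ''ye'' p = s (entry_array (opposite X)) p \<and>
     s' ''qu'' p = s' ''yo'' p)" for i and s' :: memory
  have w: "writes (copy_step X) = {''xo'', ''xe'', ''yo'', ''ye'', ''qu''}"
    by (auto simp: copy_step_def)
  have "runs (For (copy_step X)) s (2 + (weight (copy_step X) + 2) * m) (P (Suc m))"
  proof (rule runs_For[where P = P])
    show "loop_free (copy_step X)" by (simp add: copy_step_def)
    show "''i'' \<notin> writes (copy_step X)" "''m'' \<notin> writes (copy_step X)" by (simp_all add: w)
    show "P i (s(''i'' := f))" if "P i s" for i s f using that by (simp add: P_def)
    show "P 1 s" by (simp add: P_def)
    fix i s' assume i: "1 \<le> i" "i \<le> m" "s' ''i'' 0 = i" "P i s'"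
      and fr: "frame (insert ''i'' (writes (copy_step X))) s s'"
    have "s' (owner_array Z) = s (owner_array Z)" "s' (entry_array Z) = s (entry_array Z)" for Z
      using frameD[OF fr] by (cases Z; simp add: w)+
    moreover have "sem (copy_step X) s' = s'
        (''xo'' := (s' ''xo'')(i := s' (owner_array X) i), ''xe'' := (s' ''xe'')(i := s' (entry_array X) i),
         ''yo'' := (s' ''yo'')(i := s' (owner_array (opposite X)) i),
         ''ye'' := (s' ''ye'')(i := s' (entry_array (opposite X)) i),
         ''qu'' := (s' ''qu'')(i := s' (owner_array (opposite X)) i))"
      using i(3) by (cases X) (simp_all add: copy_step_def)
    ultimately show "P (Suc i) (sem (copy_step X) s')"
      using i(4) by (auto simp: P_def less_Suc_eq)
  qed fact
  then show ?thesis
    by (rule runs_mono) (auto simp: P_def copy_step_def)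
qed

lemma runs_index:
  assumes "s ''m'' 0 = m" and zero: "\<And>a. a \<in> {''xl'', ''wx'', ''px'', ''yl'', ''wy'', ''py'', ''hd''} \<Longrightarrow> s a = (\<lambda>_. 0)"
  shows "runs (For index_step) s (2 + 14 * m) (\<lambda>s'.
     s' ''xl'' = last_pos (s ''xo'') m \<and> s' ''wx'' = last_pos (s ''xo'') m \<and> s' ''px'' = first_pos (s ''xo'') m \<and>
     s' ''yl'' = last_pos (s ''yo'') m \<and> s' ''wy'' = last_pos (s ''yo'') m \<and> s' ''py'' = first_pos (s ''yo'') m \<and>
     s' ''hd'' = last_pos (s ''ye'') m \<and> (\<forall>q \<in> {1..m}. s' ''nx'' q = last_pos (s ''ye'') (q - 1) (s ''ye'' q)))"
proof -
  define P where "P i s' \<longleftrightarrow>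
     s' ''xl'' = last_pos (s ''xo'') (i - 1) \<and> s' ''wx'' = last_pos (s ''xo'') (i - 1) \<and> s' ''px'' = first_pos (s ''xo'') (i - 1) \<and>
     s' ''yl'' = last_pos (s ''yo'') (i - 1) \<and> s' ''wy'' = last_pos (s ''yo'') (i - 1) \<and> s' ''py'' = first_pos (s ''yo'') (i - 1) \<and>
     s' ''hd'' = last_pos (s ''ye'') (i - 1) \<and> (\<forall>q. 1 \<le> q \<longrightarrow> q < i \<longrightarrow> s' ''nx'' q = last_pos (s ''ye'') (q - 1) (s ''ye'' q))"
    for i and s' :: memory
  have w: "writes index_step = {''xl'', ''wx'', ''px'', ''yl'', ''wy'', ''py'', ''nx'', ''hd''}"
    by (auto simp: index_step_def)
  have "runs (For index_step) s (2 + (weight index_step + 2) * m) (P (Suc m))"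
  proof (rule runs_For[where P = P])
    show "loop_free index_step" by (simp add: index_step_def)
    show "''i'' \<notin> writes index_step" "''m'' \<notin> writes index_step" by (simp_all add: w)
    show "P i (s(''i'' := f))" if "P i s" for i s f using that by (simp add: P_def)
    show "P 1 s" using zero by (simp add: P_def fun_eq_iff)
    fix i s' assume i: "1 \<le> i" "i \<le> m" "s' ''i'' 0 = i" and P: "P i s'"
      and fr: "frame (insert ''i'' (writes index_step)) s s'"
    have [simp]: "s' ''xo'' = s ''xo''" "s' ''yo'' = s ''yo''" "s' ''ye'' = s ''ye''"
      using frameD[OF fr] by (simp_all add: w)
    obtain n where n: "i = Suc n" using i(1) by (cases i) auto
    have Pn: "s' ''xl'' = last_pos (s ''xo'') n" "s' ''wx'' = last_pos (s ''xo'') n" "s' ''px'' = first_pos (s ''xo'') n"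
      "s' ''yl'' = last_pos (s ''yo'') n" "s' ''wy'' = last_pos (s ''yo'') n" "s' ''py'' = first_pos (s ''yo'') n"
      "s' ''hd'' = last_pos (s ''ye'') n"
      "\<And>q. 1 \<le> q \<Longrightarrow> q < i \<Longrightarrow> s' ''nx'' q = last_pos (s ''ye'') (q - 1) (s ''ye'' q)"
      using P by (simp_all add: P_def n)
    let ?s = "sem index_step s'"
    have E: "?s ''xl'' = (s' ''xl'')(s ''xo'' i := i)" "?s ''wx'' = (s' ''wx'')(s ''xo'' i := i)"
      "?s ''yl'' = (s' ''yl'')(s ''yo'' i := i)" "?s ''wy'' = (s' ''wy'')(s ''yo'' i := i)"
      "?s ''hd'' = (s' ''hd'')(s ''ye'' i := i)" "?s ''nx'' = (s' ''nx'')(i := s' ''hd'' (s ''ye'' i))"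
      "?s ''px'' = (if s' ''px'' (s ''xo'' i) = 0 then (s' ''px'')(s ''xo'' i := i) else s' ''px'')"
      "?s ''py'' = (if s' ''py'' (s ''yo'' i) = 0 then (s' ''py'')(s ''yo'' i := i) else s' ''py'')"
      using i(3) by (simp_all add: index_step_def)
    have F: "?s ''px'' = first_pos (s ''xo'') (Suc n)" "?s ''py'' = first_pos (s ''yo'') (Suc n)"
      using E(7,8) unfolding Pn n first_pos_upd by blast+
    have L: "?s ''xl'' = last_pos (s ''xo'') (Suc n)" "?s ''wx'' = last_pos (s ''xo'') (Suc n)"
      "?s ''yl'' = last_pos (s ''yo'') (Suc n)" "?s ''wy'' = last_pos (s ''yo'') (Suc n)"
      "?s ''hd'' = last_pos (s ''ye'') (Suc n)"
      using E(1-5) unfolding Pn n last_pos_upd by blast+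
    have "?s ''nx'' q = last_pos (s ''ye'') (q - 1) (s ''ye'' q)" if "1 \<le> q" "q < Suc i" for q
      using E(6) Pn(7) Pn(8)[of q] that n by (cases "q = i") simp_all
    then show "P (Suc i) ?s"
      unfolding P_def diff_Suc_1 n using F L n by blast
  qed fact
  then show ?thesis
    by (rule runs_mono) (auto simp: P_def index_step_def)
qed


section \<open>Linking the two tables\<close>

lemma table_inj:
  assumes "table I Z m ow en" "p \<in> {1..m}" "p' \<in> {1..m}" "ow p = ow p'" "en p = en p'"
  shows "p = p'"
proof -
  have "inj_on (\<lambda>p. {ow p, en p}) {1..m}" using assms(1) by (simp add: table_def)
  from inj_onD[OF this _ assms(2,3)] show ?thesis using assms(4,5) by simp
qed

lemma table_cross:
  assumes inst: "stable_assignment_instance I" and xt: "table I X m xo xe"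
    and yt: "table I (opposite X) m yo ye" and p: "p \<in> {1..m}"
  obtains q where "q \<in> {1..m}" "yo q = xe p" "ye q = xo p"
proof -
  have "edges I = (\<lambda>p. {xo p, xe p}) ` {1..m}" using xt by (simp_all only: table_def)
  moreover have "edges I = (\<lambda>q. {yo q, ye q}) ` {1..m}" using yt by (simp_all only: table_def)
  ultimately have "{xo p, xe p} \<in> (\<lambda>q. {yo q, ye q}) ` {1..m}" using p by blast
  then obtain q where q: "q \<in> {1..m}" "{xo p, xe p} = {yo q, ye q}" by blast
  have "\<forall>p \<in> {1..m}. xo p \<in> members I X \<and> xe p \<in> members I (opposite X)"
    by (rule conjunct1[OF xt[unfolded table_def]])
  moreover have "\<forall>q \<in> {1..m}. yo q \<in> members I (opposite X) \<and> ye q \<in> members I (opposite (opposite X))"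
    by (rule conjunct1[OF yt[unfolded table_def]])
  ultimately have "xo p \<in> members I X" "yo q \<in> members I (opposite X)" using p q(1) by blast+
  then have "xo p \<noteq> yo q" using members_disjoint[OF inst, of X] by (metis disjoint_iff)
  then have "yo q = xe p" "ye q = xo p" using q(2) by (auto simp: doubleton_eq_iff)
  then show ?thesis using that q(1) by blast
qed

text \<open>
  The positions with entry \<open>x\<close> in the table of \<open>Y\<close> form a linked list from \<open>hp x\<close> along \<open>nx\<close>; it
  is consumed when the list of \<open>x\<close> is reached, and then \<open>tp\<close> maps each neighbour of \<open>x\<close> to the
  position of its edge. Since \<open>nx\<close> is decreasing, \<open>q\<close> has been consumed iff \<open>hp (ye q) < q\<close>.
\<close>

locale cross_inv =
  fixes m :: nat and xo xe yo ye :: "nat \<Rightarrow> nat" and i :: nat and hp tp cr rc :: "nat \<Rightarrow> nat"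
  assumes i_ge: "1 \<le> i" and i_le: "i \<le> Suc m"
    and head_le: "\<And>x. hp x \<le> m" and head_entry: "\<And>x. hp x \<noteq> 0 \<Longrightarrow> ye (hp x) = x"
    and consumed: "\<And>q. q \<in> {1..m} \<Longrightarrow> hp (ye q) < q \<Longrightarrow> \<exists>p \<in> {1..m}. p \<le> i \<and> xo p = ye q"
    and tp_eq: "\<And>q. q \<in> {1..m} \<Longrightarrow> hp (ye q) < q \<Longrightarrow> i \<le> m \<Longrightarrow> xo i = ye q \<Longrightarrow> tp (yo q) = q"
    and linked: "\<And>p. p \<in> {1..m} \<Longrightarrow> p < i \<Longrightarrow>
      cr p \<in> {1..m} \<and> yo (cr p) = xe p \<and> ye (cr p) = xo p \<and> rc (cr p) = p"

lemmas cross_invD = cross_inv.i_ge cross_inv.i_le cross_inv.head_le cross_inv.head_entry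
  cross_inv.consumed cross_inv.tp_eq cross_inv.linked
lemmas cross_invI = cross_inv.intro

text \<open>\<open>n\<close> is the next smaller position with the same entry, so \<open>r\<close>
  is the only position that becomes consumed.\<close>

lemma cross_consume:
  assumes inv: "cross_inv m xo xe yo ye i hp tp cr rc" and i: "i \<le> m"
    and yt: "table I Z m yo ye" and r: "r = hp (xo i)" "r \<noteq> 0" and n: "n = last_pos ye (r - 1) (ye r)"
  shows "cross_inv m xo xe yo ye i (hp(xo i := n)) (tp(yo r := r)) cr rc"
    and "card {q \<in> {1..m}. q \<le> (hp(xo i := n)) (ye q)} < card {q \<in> {1..m}. q \<le> hp (ye q)}"
proof -
  note D = cross_invD[OF inv]
  have yr: "ye r = xo i" using D(4)[of "xo i"] r by simp
  have rm: "r \<in> {1..m}" using D(3)[of "xo i"] r by simp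
  have nr: "n \<le> r - 1" unfolding n by (rule last_pos_le)
  have between: "q = r" if "q \<in> {1..m}" "ye q = xo i" "n < q" "q \<le> r" for q
  proof (rule ccontr)
    assume "q \<noteq> r"
    then have "1 \<le> q" "q \<le> r - 1" using that by auto
    from last_pos_ge[OF this, of ye] show False using that yr n by simp
  qed
  show "cross_inv m xo xe yo ye i (hp(xo i := n)) (tp(yo r := r)) cr rc"
  proof (rule cross_invI)
    show "(hp(xo i := n)) x \<le> m" for x using D(3)[of x] nr rm by auto
    show "ye ((hp(xo i := n)) x) = x" if "(hp(xo i := n)) x \<noteq> 0" for x
      using D(4)[of x] last_pos_owner[of ye "r - 1" "ye r"] that n yr by (cases "x = xo i") simp_all
    fix q assume q: "q \<in> {1..m}" "(hp(xo i := n)) (ye q) < q"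
    show "\<exists>p \<in> {1..m}. p \<le> i \<and> xo p = ye q"
    proof (cases "ye q = xo i")
      case True
      then show ?thesis using D(1) i by (intro bexI[of _ i]) auto
    next
      case False
      then show ?thesis using D(5)[OF q(1)] q(2) by simp
    qed
    assume x: "xo i = ye q"
    show "(tp(yo r := r)) (yo q) = q"
    proof (cases "q \<le> r")
      case True
      then have "q = r" using between[OF q(1)] q(2) x by simp
      then show ?thesis by simp
    next
      case False
      then have "tp (yo q) = q" using D(6)[OF q(1) _ i x] r(1) x by simp
      moreover have "yo q \<noteq> yo r" using table_inj[OF yt q(1) rm] x yr False by auto
      ultimately show ?thesis by simp
    qed
  qed (fact D)+
  show "card {q \<in> {1..m}. q \<le> (hp(xo i := n)) (ye q)} < card {q \<in> {1..m}. q \<le> hp (ye q)}"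
  proof (rule psubset_card_mono)
    have "q \<le> hp (ye q)" if "q \<le> (hp(xo i := n)) (ye q)" for q
      using that nr r by (cases "ye q = xo i") auto
    moreover have "r \<le> hp (ye r)" using yr r by simp
    moreover have "\<not> r \<le> (hp(xo i := n)) (ye r)" using yr nr r(2) by simp
    ultimately show "{q \<in> {1..m}. q \<le> (hp(xo i := n)) (ye q)} \<subset> {q \<in> {1..m}. q \<le> hp (ye q)}"
      using rm by blast
  qed simp
qed

text \<open>Once the linked list of \<open>xo i\<close> is empty, \<open>tp\<close> is correct on
  all its neighbours. Values left over in \<open>tp\<close> do no harm at \<open>Suc i\<close>: a
  consumed edge of that owner shows that the owner occurred earlier, and by grouping it is then
  \<open>xo i\<close> itself.\<close>

lemma cross_advance:
  assumes inv: "cross_inv m xo xe yo ye i hp tp cr rc" and i: "i \<le> m" and h: "hp (xo i) = 0"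
    and inst: "stable_assignment_instance I" and xt: "table I X m xo xe" and yt: "table I (opposite X) m yo ye"
  shows "cross_inv m xo xe yo ye (Suc i) hp tp (cr(i := tp (xe i))) (rc(tp (xe i) := i))"
proof -
  note D = cross_invD[OF inv]
  have im: "i \<in> {1..m}" using D(1) i by simp
  obtain q where q: "q \<in> {1..m}" "yo q = xe i" "ye q = xo i" using table_cross[OF inst xt yt im] .
  have "hp (ye q) < q" using q(1) h by (simp add: q(3))
  from D(6)[OF q(1) this i q(3)[symmetric]] have tq: "tp (xe i) = q" by (simp add: q(2))
  show ?thesis unfolding tq
  proof (rule cross_invI)
    show "1 \<le> Suc i" "Suc i \<le> Suc m" using i by simp_all
    fix q' assume q': "q' \<in> {1..m}" "hp (ye q') < q'"
    then obtain p where p: "p \<in> {1..m}" "p \<le> i" "xo p = ye q'" using D(5) by blast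
    then show "\<exists>p \<in> {1..m}. p \<le> Suc i \<and> xo p = ye q'" by (intro bexI[of _ p]) auto
    assume si: "Suc i \<le> m" "xo (Suc i) = ye q'"
    have "grouped m xo" using xt by (simp add: table_def)
    from groupedD[OF this, of p i "Suc i"] have "xo i = ye q'" using p si by simp
    then show "tp (yo q') = q'" using D(6)[OF q' i] by simp
  next
    fix p assume p: "p \<in> {1..m}" "p < Suc i"
    show "(cr(i := q)) p \<in> {1..m} \<and> yo ((cr(i := q)) p) = xe p \<and> ye ((cr(i := q)) p) = xo p \<and>
        (rc(q := i)) ((cr(i := q)) p) = p"
    proof (cases "p = i")
      case True
      then show ?thesis using q by simp
    next
      case False
      then have c: "cr p \<in> {1..m} \<and> yo (cr p) = xe p \<and> ye (cr p) = xo p \<and> rc (cr p) = p" using D(7)[OF p(1)] p(2) by simp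
      then have "cr p \<noteq> q" using table_inj[OF xt p(1) im] q False by metis
      then show ?thesis using c False by simp
    qed
  qed (rule D; assumption)+
qed

text \<open>Filling \<open>tp\<close> for an owner and linking position \<open>i\<close> are
  alternatives of one loop-free body, so a single measure bounds both.\<close>

definition cross_step :: com where
  "cross_step =
     Cond (Equal (Cell ''hd'' (Cell ''xo'' (Var ''i''))) (Const 0))
       (Store ''cr'' (Var ''i'') (Cell ''tp'' (Cell ''xe'' (Var ''i''))) ;;
        Store ''rc'' (Cell ''tp'' (Cell ''xe'' (Var ''i''))) (Var ''i'') ;;
        Assign ''i'' (Inc (Var ''i'')))
       (Assign ''r'' (Cell ''hd'' (Cell ''xo'' (Var ''i''))) ;;
        Store ''tp'' (Cell ''yo'' (Var ''r'')) (Var ''r'') ;;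
        Store ''hd'' (Cell ''xo'' (Var ''i'')) (Cell ''nx'' (Var ''r'')))"

definition cross :: com where
  "cross = (Assign ''i'' (Const 1) ;; While (Neg (Less (Var ''m'') (Var ''i''))) cross_step)"

lemma runs_cross:
  assumes m: "s ''m'' 0 = m" and inst: "stable_assignment_instance I"
    and xt: "table I X m (s ''xo'') (s ''xe'')" and yt: "table I (opposite X) m (s ''yo'') (s ''ye'')"
    and hd: "s ''hd'' = last_pos (s ''ye'') m"
    and nx: "\<forall>q \<in> {1..m}. s ''nx'' q = last_pos (s ''ye'') (q - 1) (s ''ye'' q)"
  shows "runs cross s (2 + 16 * m) (\<lambda>s'. \<forall>p \<in> {1..m}. s' ''cr'' p \<in> {1..m} \<and>
    s ''yo'' (s' ''cr'' p) = s ''xe'' p \<and> s ''ye'' (s' ''cr'' p) = s ''xo'' p \<and> s' ''rc'' (s' ''cr'' p) = p)"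
proof -
  define s1 where "s1 = s(''i'' := (s ''i'')(0 := 1))"
  define P where "P s' \<longleftrightarrow> cross_inv m (s ''xo'') (s ''xe'') (s ''yo'') (s ''ye'') (s' ''i'' 0) (s' ''hd'') (s' ''tp'') (s' ''cr'') (s' ''rc'')"
    for s' :: memory
  \<comment> \<open>Positions still to be linked plus positions still to be consumed: at most
    \<open>2 * m\<close>, at 8 units each.\<close>
  define \<Phi> where "\<Phi> s' = (Suc m - s' ''i'' 0) + card {q \<in> {1..m}. q \<le> s' ''hd'' (s ''ye'' q)}" for s' :: memory
  have w: "writes cross_step = {''cr'', ''rc'', ''i'', ''r'', ''tp'', ''hd''}"
    by (auto simp: cross_step_def)
  have loop: "runs (While (Neg (Less (Var ''m'') (Var ''i''))) cross_step) s1 (Suc (Suc (weight cross_step) * \<Phi> s1))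
      (\<lambda>s'. P s' \<and> \<not> bval (Neg (Less (Var ''m'') (Var ''i''))) s')"
  proof (rule runs_While_loop_free)
    show "loop_free cross_step" by (simp add: cross_step_def)
    show "P s1"
      unfolding P_def
    proof (rule cross_invI)
      have no: "\<not> last_pos (s ''ye'') m (s ''ye'' q) < q" if "q \<in> {1..m}" for q
        using last_pos_ge[of q m "s ''ye''"] that by simp
      have [simp]: "s1 ''hd'' = last_pos (s ''ye'') m" "s1 ''i'' 0 = 1" by (simp_all add: s1_def hd)
      show "1 \<le> s1 ''i'' 0" "s1 ''i'' 0 \<le> Suc m" by simp_all
      show "s1 ''hd'' x \<le> m" for x by (simp add: last_pos_le)
      show "s ''ye'' (s1 ''hd'' x) = x" if "s1 ''hd'' x \<noteq> 0" for x using that by (simp add: last_pos_owner)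
      fix q assume q: "q \<in> {1..m}" "s1 ''hd'' (s ''ye'' q) < q"
      then have False using no[OF q(1)] by simp
      then show "\<exists>p \<in> {1..m}. p \<le> s1 ''i'' 0 \<and> s ''xo'' p = s ''ye'' q" "s1 ''tp'' (s ''yo'' q) = q" by blast+
    qed (simp_all add: s1_def)
  next
    fix s' assume P: "P s'" and b: "bval (Neg (Less (Var ''m'') (Var ''i''))) s'" and fr: "frame (writes cross_step) s1 s'"
    have [simp]: "s' ''xo'' = s ''xo''" "s' ''xe'' = s ''xe''" "s' ''yo'' = s ''yo''" "s' ''ye'' = s ''ye''"
      "s' ''nx'' = s ''nx''" "s' ''m'' = s ''m''"
      using frameD[OF fr] by (simp_all add: w s1_def)
    define i where "i = s' ''i'' 0"
    have i: "i \<le> m" using b m by (simp add: i_def)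
    note inv = P[unfolded P_def, folded i_def]
    show "P (sem cross_step s') \<and> \<Phi> (sem cross_step s') < \<Phi> s'"
    proof (cases "s' ''hd'' (s ''xo'' i) = 0")
      case True
      have E: "sem cross_step s' ''i'' 0 = Suc i" "sem cross_step s' ''hd'' = s' ''hd''" "sem cross_step s' ''tp'' = s' ''tp''"
        "sem cross_step s' ''cr'' = (s' ''cr'')(i := s' ''tp'' (s ''xe'' i))"
        "sem cross_step s' ''rc'' = (s' ''rc'')(s' ''tp'' (s ''xe'' i) := i)"
        using True by (simp_all add: cross_step_def i_def)
      have "P (sem cross_step s')" unfolding P_def E using cross_advance[OF inv i True inst xt yt] .
      moreover have "\<Phi> (sem cross_step s') < \<Phi> s'" unfolding \<Phi>_def E using i by (simp add: i_def)
      ultimately show ?thesis ..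
    next
      case False
      define r where "r = s' ''hd'' (s ''xo'' i)"
      have "r \<in> {1..m}" using cross_invD(3)[OF inv, of "s ''xo'' i"] False by (simp add: r_def)
      then have n: "s ''nx'' r = last_pos (s ''ye'') (r - 1) (s ''ye'' r)" using nx by blast
      have E: "sem cross_step s' ''i'' 0 = i" "sem cross_step s' ''hd'' = (s' ''hd'')(s ''xo'' i := s ''nx'' r)"
        "sem cross_step s' ''tp'' = (s' ''tp'')(s ''yo'' r := r)"
        "sem cross_step s' ''cr'' = s' ''cr''" "sem cross_step s' ''rc'' = s' ''rc''"
        using False by (simp_all add: cross_step_def i_def r_def)
      have r0: "r \<noteq> 0" using False by (simp add: r_def)
      note C = cross_consume[OF inv i yt r_def r0 n]
      have "P (sem cross_step s')" unfolding P_def E using C(1) .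
      moreover have "\<Phi> (sem cross_step s') < \<Phi> s'" unfolding \<Phi>_def E using C(2) by (simp add: i_def)
      ultimately show ?thesis ..
    qed
  qed
  have "card {q \<in> {1..m}. q \<le> s1 ''hd'' (s ''ye'' q)} \<le> card {1..m}" by (rule card_mono) auto
  then have \<Phi>: "\<Phi> s1 \<le> 2 * m" by (simp add: \<Phi>_def s1_def)
  have "runs (Assign ''i'' (Const 1)) s 1 (\<lambda>s'. s' = s1)"
    by (rule runs_loop_free) (simp_all add: s1_def)
  then have "runs cross s (1 + Suc (Suc (weight cross_step) * \<Phi> s1)) (\<lambda>s'. P s' \<and> \<not> s' ''i'' 0 \<le> m)"
    unfolding cross_def
  proof (rule runs_Seq)
    fix s' assume "s' = s1"
    show "runs (While (Neg (Less (Var ''m'') (Var ''i''))) cross_step) s' (Suc (Suc (weight cross_step) * \<Phi> s1)) (\<lambda>s'. P s' \<and> \<not> s' ''i'' 0 \<le> m)"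
      unfolding \<open>s' = s1\<close>
    proof (rule runs_mono[OF loop])
      fix r assume r: "P r \<and> \<not> bval (Neg (Less (Var ''m'') (Var ''i''))) r"
        and fr: "frame (writes (While (Neg (Less (Var ''m'') (Var ''i''))) cross_step)) s1 r"
      have "r ''m'' = s ''m''" using frameD[OF fr] by (simp add: w s1_def)
      then show "P r \<and> \<not> r ''i'' 0 \<le> m" using r m by simp
    qed simp
  qed
  then show ?thesis
  proof (rule runs_mono)
    have "Suc (weight cross_step) = 8" by (simp add: cross_step_def)
    then show "1 + Suc (Suc (weight cross_step) * \<Phi> s1) \<le> 2 + 16 * m" using \<Phi> by simp
    fix s' assume s': "P s' \<and> \<not> s' ''i'' 0 \<le> m"
    then have inv: "cross_inv m (s ''xo'') (s ''xe'') (s ''yo'') (s ''ye'') (s' ''i'' 0) (s' ''hd'') (s' ''tp'') (s' ''cr'') (s' ''rc'')"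
      by (simp add: P_def)
    show "\<forall>p \<in> {1..m}. s' ''cr'' p \<in> {1..m} \<and>
        s ''yo'' (s' ''cr'' p) = s ''xe'' p \<and> s ''ye'' (s' ''cr'' p) = s ''xo'' p \<and> s' ''rc'' (s' ''cr'' p) = p"
    proof
      fix p assume p: "p \<in> {1..m}"
      then have "p < s' ''i'' 0" using s' by simp
      from cross_invD(7)[OF inv p this] show "s' ''cr'' p \<in> {1..m} \<and>
        s ''yo'' (s' ''cr'' p) = s ''xe'' p \<and> s ''ye'' (s' ''cr'' p) = s ''xo'' p \<and> s' ''rc'' (s' ''cr'' p) = p" .
    qed
  qed
qed

section \<open>The program for deferred acceptance\<close>

inductive_cases exec_SeqE: "exec (c ;; d) s t s'"

lemma runs_assoc: "runs ((c ;; d) ;; e) s n Q \<Longrightarrow> runs (c ;; d ;; e) s n Q"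
  unfolding runs_def by (elim exE conjE exec_SeqE) (metis add.assoc exec.Seq)

text \<open>\<open>s\<close> is a snapshot of the memory at the time when the tables are complete.
  Later states are related to it by agreement on the arrays in \<open>static\<close>.\<close>

locale loaded = tables X I m "s ''xo''" "s ''xe''" "s ''yo''" "s ''ye''" "s ''cr''" "s ''rc''"
  for X :: side and I :: "nat inst" and m :: nat and s :: memory +
  assumes size: "s ''m'' 0 = m"
    and xl: "s ''xl'' = last_pos (s ''xo'') m" and yl: "s ''yl'' = last_pos (s ''yo'') m"
    and quota_array: "\<And>v. v \<in> members I X \<union> members I (opposite X) \<Longrightarrow> s ''quota'' v = quota I v"

definition static :: "string set" where
  "static = {''xo'', ''xe'', ''yo'', ''ye'', ''cr'', ''rc'', ''m'', ''xl'', ''yl'', ''quota''}"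

text \<open>A pointer that moves by one abandons at least the position on which it stood. So the
  number of positions not yet passed bounds the moves of all pointers together.\<close>

lemma card_lower:
  fixes f :: "'v \<Rightarrow> nat"
  assumes "finite A" "f v \<in> A" "ow (f v) = v" "0 < f v"
  shows "card {p \<in> A. p \<le> (f(v := f v - 1)) (ow p)} < card {p \<in> A. p \<le> f (ow p)}"
proof (rule psubset_card_mono)
  have "\<not> f v \<le> (f(v := f v - 1)) (ow (f v))" using assms(3,4) by simp
  moreover have "p \<le> f (ow p)" if "p \<le> (f(v := f v - 1)) (ow p)" for p
    using that by (cases "ow p = v") simp_all
  moreover have "f v \<le> f (ow (f v))" using assms(3) by simp
  ultimately show "{p \<in> A. p \<le> (f(v := f v - 1)) (ow p)} \<subset> {p \<in> A. p \<le> f (ow p)}" using assms(2) by blast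
qed (use assms(1) in simp)

lemma card_raise:
  fixes f :: "'v \<Rightarrow> nat"
  assumes "finite A" "f v \<in> A" "ow (f v) = v"
  shows "card {p \<in> A. (f(v := Suc (f v))) (ow p) \<le> p} < card {p \<in> A. f (ow p) \<le> p}"
proof (rule psubset_card_mono)
  have "\<not> (f(v := Suc (f v))) (ow (f v)) \<le> f v" using assms(3) by simp
  moreover have "f (ow p) \<le> p" if "(f(v := Suc (f v))) (ow p) \<le> p" for p
    using that by (cases "ow p = v") simp_all
  moreover have "f (ow (f v)) \<le> f v" using assms(3) by simp
  ultimately show "{p \<in> A. (f(v := Suc (f v))) (ow p) \<le> p} \<subset> {p \<in> A. f (ow p) \<le> p}" using assms(2) by blast
qed (use assms(1) in simp)

text \<open>Moves \<open>wx\<close> by a single position; the flag \<open>ov\<close> stays set until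
  a held edge is met, which replaces an inner loop.\<close>

definition bump_step :: com where
  "bump_step =
     (Assign ''w'' (Cell ''wx'' (Var ''x'')) ;;
      Store ''wx'' (Var ''x'') (Dec (Var ''w'')) ;;
      Cond (Equal (Cell ''mk'' (Cell ''cr'' (Var ''w''))) (Const 0)) Skip
        (Store ''mk'' (Cell ''cr'' (Var ''w'')) (Const 0) ;;
         Assign ''y'' (Cell ''xe'' (Var ''w'')) ;;
         Store ''cy'' (Var ''y'') (Dec (Cell ''cy'' (Var ''y''))) ;;
         Store ''cx'' (Var ''x'') (Dec (Cell ''cx'' (Var ''x''))) ;;
         Assign ''t'' (Inc (Var ''t'')) ;;
         Store ''qu'' (Var ''t'') (Var ''y'') ;;
         Assign ''ov'' (Const 0)))"

text \<open>An accepted proposal is recorded before the quota is tested; the excess of one is left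
  to \<open>bump_step\<close>.\<close>

definition propose_step :: com where
  "propose_step =
     (Assign ''q'' (Cell ''py'' (Var ''y'')) ;;
      Store ''py'' (Var ''y'') (Inc (Var ''q'')) ;;
      Cond (Less (Cell ''wx'' (Cell ''ye'' (Var ''q''))) (Cell ''rc'' (Var ''q''))) Skip
        (Store ''mk'' (Var ''q'') (Const 1) ;;
         Store ''cy'' (Var ''y'') (Inc (Cell ''cy'' (Var ''y''))) ;;
         Assign ''x'' (Cell ''ye'' (Var ''q'')) ;;
         Store ''cx'' (Var ''x'') (Inc (Cell ''cx'' (Var ''x''))) ;;
         Cond (Less (Cell ''quota'' (Var ''x'')) (Cell ''cx'' (Var ''x''))) (Assign ''ov'' (Const 1)) Skip))"

definition da_step :: com where
  "da_step =
     Cond (Equal (Var ''ov'') (Const 0))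
       (Assign ''y'' (Cell ''qu'' (Var ''h'')) ;;
        Cond (Conj (Neg (Less (Cell ''yl'' (Var ''y'')) (Cell ''py'' (Var ''y''))))
            (Less (Cell ''cy'' (Var ''y'')) (Cell ''quota'' (Var ''y''))))
          propose_step
          (Assign ''h'' (Inc (Var ''h''))))
       bump_step"

definition da :: com where
  "da = (Assign ''h'' (Const 1) ;; Assign ''t'' (Var ''m'') ;;
     While (Neg (Less (Var ''t'') (Var ''h''))) da_step)"

lemma da_step_simps:
  "loop_free da_step" "weight da_step = 26"
  "writes da_step = {''w'', ''wx'', ''mk'', ''y'', ''cy'', ''cx'', ''t'', ''qu'', ''ov'', ''q'', ''py'', ''x'', ''h''}"
  by (auto simp: da_step_def propose_step_def bump_step_def)

context loaded
begin

abbreviation "xo \<equiv> s ''xo''"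
abbreviation "xe \<equiv> s ''xe''"
abbreviation "yo \<equiv> s ''yo''"
abbreviation "ye \<equiv> s ''ye''"
abbreviation "cr \<equiv> s ''cr''"
abbreviation "rc \<equiv> s ''rc''"

definition held :: "(nat \<Rightarrow> nat) \<Rightarrow> nat set" where
  "held mk = {q \<in> ids. mk q \<noteq> 0}"

lemma held_subset: "held mk \<subseteq> ids"
  by (auto simp: held_def)

lemma held_remove: "held (mk(q := 0)) = held mk - {q}"
  by (auto simp: held_def)

lemma held_insert: "q \<in> ids \<Longrightarrow> held (mk(q := Suc 0)) = insert q (held mk)"
  by (auto simp: held_def)

text \<open>Repeated entries are allowed, so no membership test is needed before enqueuing; an entry
  that has become inactive costs one iteration at the head.\<close>

definition queue :: "(nat \<Rightarrow> nat) \<Rightarrow> (nat \<Rightarrow> nat) \<Rightarrow> (nat \<Rightarrow> nat) \<Rightarrow> nat \<Rightarrow> nat \<Rightarrow> bool" where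
  "queue py cy qu h t \<longleftrightarrow> 1 \<le> h \<and> (\<forall>k. 1 \<le> k \<and> k \<le> t \<longrightarrow> qu k \<in> yo ` ids) \<and>
     (\<forall>y \<in> yo ` ids. py y \<le> last_pos yo m y \<and> cy y < quota I y \<longrightarrow> (\<exists>k. h \<le> k \<and> k \<le> t \<and> qu k = y))"

lemma queueD:
  assumes "queue py cy qu h t"
  shows "1 \<le> h" "\<And>k. 1 \<le> k \<Longrightarrow> k \<le> t \<Longrightarrow> qu k \<in> yo ` ids"
    and "\<And>y. y \<in> yo ` ids \<Longrightarrow> py y \<le> last_pos yo m y \<Longrightarrow> cy y < quota I y \<Longrightarrow> \<exists>k. h \<le> k \<and> k \<le> t \<and> qu k = y"
  using assms unfolding queue_def by blast+

lemma queueI: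
  assumes "1 \<le> h" "\<And>k. 1 \<le> k \<Longrightarrow> k \<le> t \<Longrightarrow> qu k \<in> yo ` ids"
    and "\<And>y. y \<in> yo ` ids \<Longrightarrow> py y \<le> last_pos yo m y \<Longrightarrow> cy y < quota I y \<Longrightarrow> \<exists>k. h \<le> k \<and> k \<le> t \<and> qu k = y"
  shows "queue py cy qu h t"
  unfolding queue_def using assms by blast

lemma queue_dequeue:
  assumes "queue py cy qu h t" "\<not> (py (qu h) \<le> last_pos yo m (qu h) \<and> cy (qu h) < quota I (qu h))"
  shows "queue py cy qu (Suc h) t"
proof (rule queueI)
  note D = queueD[OF assms(1)]
  show "1 \<le> Suc h" by simp
  fix y assume y: "y \<in> yo ` ids" "py y \<le> last_pos yo m y" "cy y < quota I y"
  then obtain k where k: "h \<le> k" "k \<le> t" "qu k = y" using D(3) by blast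
  then have "k \<noteq> h" using assms(2) y by auto
  then show "\<exists>k. Suc h \<le> k \<and> k \<le> t \<and> qu k = y" using k by (intro exI[of _ k]) simp
qed (rule queueD(2)[OF assms(1)])

text \<open>The proposer stays at the head, so no change of \<open>py\<close> and \<open>cy\<close>
  at \<open>y\<close> can lose it.\<close>

lemma queue_propose:
  assumes "queue py cy qu h t" "h \<le> t" "y = qu h"
  shows "queue (py(y := a)) (cy(y := b)) qu h t"
proof (rule queueI)
  note D = queueD[OF assms(1)]
  fix z assume z: "z \<in> yo ` ids" "(py(y := a)) z \<le> last_pos yo m z" "(cy(y := b)) z < quota I z"
  show "\<exists>k. h \<le> k \<and> k \<le> t \<and> qu k = z"
  proof (cases "z = y")
    case True
    then show ?thesis using assms(2,3) by blast
  next
    case False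
    then show ?thesis using D(3)[OF z(1)] z(2,3) by simp
  qed
qed (fact queueD[OF assms(1)])+

lemma queue_bump:
  assumes "queue py cy qu h t" "h \<le> t" "y \<in> yo ` ids"
  shows "queue py (cy(y := a)) (qu(Suc t := y)) h (Suc t)"
proof -
  note D = queueD[OF assms(1)]
  show ?thesis
  proof (rule queueI)
    show "(qu(Suc t := y)) k \<in> yo ` ids" if "1 \<le> k" "k \<le> Suc t" for k
      using D(2)[of k] that assms(3) by (cases "k = Suc t") simp_all
    fix z assume z: "z \<in> yo ` ids" "py z \<le> last_pos yo m z" "(cy(y := a)) z < quota I z"
    show "\<exists>k. h \<le> k \<and> k \<le> Suc t \<and> (qu(Suc t := y)) k = z"
    proof (cases "z = y")
      case True
      then show ?thesis using assms(2) by (intro exI[of _ "Suc t"]) simp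
    next
      case False
      then obtain k where "h \<le> k" "k \<le> t" "qu k = z" using D(3)[OF z(1)] z(2,3) by auto
      then show ?thesis by (intro exI[of _ k]) simp
    qed
  qed (fact D)
qed

text \<open>The test of the loop looks at the queue only; the last conjunct keeps the loop from
  ending while an agent is above its quota.\<close>

definition da_state :: "memory \<Rightarrow> bool" where
  "da_state r \<longleftrightarrow>
     da_inv (held (r ''mk'')) (r ''py'') (r ''wx'') (r ''cx'') (r ''cy'') (r ''ov'' 0 \<noteq> 0) (r ''x'' 0) \<and>
     queue (r ''py'') (r ''cy'') (r ''qu'') (r ''h'' 0) (r ''t'' 0) \<and> (r ''ov'' 0 \<noteq> 0 \<longrightarrow> r ''h'' 0 \<le> r ''t'' 0)"

text \<open>A bump lengthens the queue by one, which is paid for by the move of \<open>wx\<close>; hence the factor 2.\<close>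

definition da_potential :: "memory \<Rightarrow> nat" where
  "da_potential r = card {q \<in> ids. r ''py'' (yo q) \<le> q} + 2 * card {p \<in> ids. p \<le> r ''wx'' (xo p)} +
     (Suc (r ''t'' 0) - r ''h'' 0)"

lemma da_step_correct:
  assumes st: "da_state r" and ht: "r ''h'' 0 \<le> r ''t'' 0" and fr: "\<And>a. a \<in> static \<Longrightarrow> r a = s a"
  shows "da_state (sem da_step r) \<and> da_potential (sem da_step r) < da_potential r"
proof -
  have S [simp]: "r ''xo'' = xo" "r ''xe'' = xe" "r ''yo'' = yo" "r ''ye'' = ye" "r ''cr'' = cr" "r ''rc'' = rc"
    "r ''yl'' = last_pos yo m" "r ''quota'' = s ''quota''"
    using fr yl by (simp_all add: static_def)
  define x where "x = r ''x'' 0"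
  define h where "h = r ''h'' 0"
  define t where "t = r ''t'' 0"
  have ht: "h \<le> t" using ht by (simp add: h_def t_def)
  have inv: "da_inv (held (r ''mk'')) (r ''py'') (r ''wx'') (r ''cx'') (r ''cy'') (r ''ov'' 0 \<noteq> 0) x"
    and qu: "queue (r ''py'') (r ''cy'') (r ''qu'') h t"
    using st by (simp_all add: da_state_def x_def h_def t_def)
  let ?r = "sem da_step r"
  show ?thesis
  proof (cases "r ''ov'' 0 = 0")
    case False
    then have inv: "da_inv (held (r ''mk'')) (r ''py'') (r ''wx'') (r ''cx'') (r ''cy'') True x" using inv by simp
    define w where "w = r ''wx'' x"
    note ov = da_over[OF inv, folded w_def]
    have w0: "0 < w" using ov(2) by (simp add: ids_def)
    note dec = card_lower[of ids "r ''wx''" x xo, folded w_def, OF finite_ids ov(2,3) w0]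
    show ?thesis
    proof (cases "r ''mk'' (cr w) = 0")
      case True
      have E: "?r ''mk'' = r ''mk''" "?r ''py'' = r ''py''" "?r ''wx'' = (r ''wx'')(x := w - 1)" "?r ''cx'' = r ''cx''"
        "?r ''cy'' = r ''cy''" "?r ''ov'' 0 = r ''ov'' 0" "?r ''x'' 0 = x" "?r ''qu'' = r ''qu''" "?r ''h'' 0 = h" "?r ''t'' 0 = t"
        using False True by (simp_all add: da_step_def bump_step_def x_def w_def h_def t_def)
      have "cr (r ''wx'' x) \<notin> held (r ''mk'')" using True by (simp add: held_def w_def)
      from da_lower[OF inv this, folded w_def] have "da_state ?r"
        unfolding da_state_def E using False qu ht by simp
      moreover have "da_potential ?r < da_potential r"
        unfolding da_potential_def E using dec by (simp add: h_def t_def)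
      ultimately show ?thesis ..
    next
      case F2: False
      define y where "y = xe w"
      have E: "?r ''mk'' = (r ''mk'')(cr w := 0)" "?r ''py'' = r ''py''" "?r ''wx'' = (r ''wx'')(x := w - 1)"
        "?r ''cx'' = (r ''cx'')(x := r ''cx'' x - 1)" "?r ''cy'' = (r ''cy'')(y := r ''cy'' y - 1)" "?r ''ov'' 0 = 0"
        "?r ''x'' 0 = x" "?r ''qu'' = (r ''qu'')(Suc t := y)" "?r ''h'' 0 = h" "?r ''t'' 0 = Suc t"
        using False F2 by (simp_all add: da_step_def bump_step_def x_def w_def h_def t_def y_def)
      have "cr (r ''wx'' x) \<in> held (r ''mk'')" using F2 cr(1)[OF ov(2)] by (simp add: held_def w_def)
      note B = da_bump[OF inv this, folded w_def, folded y_def]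
      have "y \<in> yo ` ids" using cr[OF ov(2)] by (metis image_eqI y_def)
      from queue_bump[OF qu ht this] have "da_state ?r"
        unfolding da_state_def E held_remove using B by simp
      moreover have "da_potential ?r < da_potential r"
        unfolding da_potential_def E using dec ht by (simp add: h_def t_def)
      ultimately show ?thesis ..
    qed
  next
    case True
    then have inv: "da_inv (held (r ''mk'')) (r ''py'') (r ''wx'') (r ''cx'') (r ''cy'') False x" using inv by simp
    define y where "y = r ''qu'' h"
    have "1 \<le> h" using qu by (simp add: queue_def)
    then have y: "y \<in> yo ` ids" using qu ht unfolding y_def queue_def by blast
    then have "y \<in> ys" using y_mem by blast
    then have qy: "s ''quota'' y = quota I y" using quota_array by blast
    show ?thesis
    proof (cases "r ''py'' y \<le> last_pos yo m y \<and> r ''cy'' y < quota I y")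
      case False
      have E: "?r ''mk'' = r ''mk''" "?r ''py'' = r ''py''" "?r ''wx'' = r ''wx''" "?r ''cx'' = r ''cx''"
        "?r ''cy'' = r ''cy''" "?r ''ov'' 0 = 0" "?r ''x'' 0 = x" "?r ''qu'' = r ''qu''" "?r ''h'' 0 = Suc h" "?r ''t'' 0 = t"
        using True False qy by (auto simp add: da_step_def x_def h_def t_def y_def)
      have "da_state ?r"
        unfolding da_state_def E using inv queue_dequeue[OF qu False[unfolded y_def]] by simp
      moreover have "da_potential ?r < da_potential r"
        unfolding da_potential_def E using ht by (simp add: h_def t_def)
      ultimately show ?thesis ..
    next
      case act: True
      define q where "q = r ''py'' y"
      note pr = da_proposal[OF inv y conjunct1[OF act], folded q_def]
      define z where "z = ye q"
      have "z \<in> xs" using x_mem[OF pr(1)] by (simp add: z_def)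
      then have qz: "s ''quota'' z = quota I z" using quota_array by blast
      note inc = card_raise[of ids "r ''py''" y yo, folded q_def, OF finite_ids pr(1,2)]
      show ?thesis
      proof (cases "r ''wx'' z < rc q")
        case rej: True
        have E: "?r ''mk'' = r ''mk''" "?r ''py'' = (r ''py'')(y := Suc q)" "?r ''wx'' = r ''wx''" "?r ''cx'' = r ''cx''"
          "?r ''cy'' = r ''cy''" "?r ''ov'' 0 = 0" "?r ''x'' 0 = x" "?r ''qu'' = r ''qu''" "?r ''h'' 0 = h" "?r ''t'' 0 = t"
          using True act rej qy by (simp_all add: da_step_def propose_step_def x_def h_def t_def y_def[symmetric] q_def[symmetric] z_def[symmetric] y_def[unfolded h_def, symmetric])
        from da_reject[OF inv y conjunct1[OF act], folded q_def, folded z_def, OF rej] have "da_state ?r"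
          unfolding da_state_def E using queue_propose[OF qu ht y_def, of _ "r ''cy'' y"] by simp
        moreover have "da_potential ?r < da_potential r"
          unfolding da_potential_def E using inc by (simp add: h_def t_def)
        ultimately show ?thesis ..
      next
        case acc: False
        have E: "?r ''mk'' = (r ''mk'')(q := Suc 0)" "?r ''py'' = (r ''py'')(y := Suc q)" "?r ''wx'' = r ''wx''"
          "?r ''cx'' = (r ''cx'')(z := Suc (r ''cx'' z))"
          "?r ''cy'' = (r ''cy'')(y := Suc (r ''cy'' y))" "?r ''ov'' 0 = (if quota I z < Suc (r ''cx'' z) then 1 else 0)"
          "?r ''x'' 0 = z" "?r ''qu'' = r ''qu''" "?r ''h'' 0 = h" "?r ''t'' 0 = t"
          using True act acc qy qz by (simp_all add: da_step_def propose_step_def h_def t_def q_def[symmetric] z_def[symmetric] y_def[unfolded h_def, symmetric])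
        have "rc q \<le> r ''wx'' z" using acc by simp
        from da_accept[OF inv y conjunct1[OF act], folded q_def, folded z_def, OF this conjunct2[OF act] refl] have "da_state ?r"
          unfolding da_state_def E held_insert[OF pr(1)] using queue_propose[OF qu ht y_def] ht
          by (cases "quota I z < Suc (r ''cx'' z)") simp_all
        moreover have "da_potential ?r < da_potential r"
          unfolding da_potential_def E using inc by (simp add: h_def t_def)
        ultimately show ?thesis ..
      qed
    qed
  qed
qed

lemma runs_da:
  assumes "s ''wx'' = last_pos xo m" "s ''py'' = first_pos yo m" and qu: "\<forall>k \<in> {1..m}. s ''qu'' k = yo k"
    and zero: "\<And>a. a \<in> {''mk'', ''cx'', ''cy'', ''ov''} \<Longrightarrow> s a = (\<lambda>_. 0)"
  shows "runs da s (3 + 108 * m) (\<lambda>r. side_optimal (opposite X) I (edge ` held (r ''mk'')) \<and>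
     (\<forall>y \<in> ys. card (at_y (held (r ''mk'')) y) = r ''cy'' y))"
proof -
  define s1 where "s1 = s(''h'' := (s ''h'')(0 := 1), ''t'' := (s ''t'')(0 := m))"
  have loop: "runs (While (Neg (Less (Var ''t'') (Var ''h''))) da_step) s1 (Suc (Suc (weight da_step) * da_potential s1))
      (\<lambda>r. da_state r \<and> \<not> bval (Neg (Less (Var ''t'') (Var ''h''))) r)"
  proof (rule runs_While_loop_free)
    show "loop_free da_step" by (simp add: da_step_simps)
    have "held (\<lambda>_. 0) = {}" by (simp add: held_def)
    moreover have "queue (s ''py'') (\<lambda>_. 0) (s ''qu'') 1 m"
      unfolding queue_def using qu by (auto simp: ids_def)
    ultimately show "da_state s1"
      using da_init zero by (simp add: da_state_def s1_def assms(1,2))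
    fix r assume st: "da_state r" and b: "bval (Neg (Less (Var ''t'') (Var ''h''))) r" and fr: "frame (writes da_step) s1 r"
    have "r a = s a" if "a \<in> static" for a
      using that frameD[OF fr, of a] by (auto simp: static_def da_step_simps s1_def)
    then show "da_state (sem da_step r) \<and> da_potential (sem da_step r) < da_potential r"
      using da_step_correct[OF st] b by simp
  qed
  have "card {q \<in> ids. s1 ''py'' (yo q) \<le> q} \<le> card ids" "card {p \<in> ids. p \<le> s1 ''wx'' (xo p)} \<le> card ids"
    by (rule card_mono; auto)+
  \<comment> \<open>\<open>m\<close> from \<open>py\<close>, \<open>2 * m\<close> from
    \<open>wx\<close> and \<open>m\<close> from the initial queue; at 27 units per iteration this
    makes \<open>108 * m\<close>.\<close>
  then have pot: "da_potential s1 \<le> 4 * m" by (simp add: da_potential_def s1_def ids_def)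
  have "runs (Assign ''h'' (Const 1) ;; Assign ''t'' (Var ''m'')) s 2 (\<lambda>r. r = s1)"
    by (rule runs_loop_free) (simp_all add: s1_def size)
  then have "runs ((Assign ''h'' (Const 1) ;; Assign ''t'' (Var ''m'')) ;; While (Neg (Less (Var ''t'') (Var ''h''))) da_step) s
      (2 + Suc (Suc (weight da_step) * da_potential s1)) (\<lambda>r. da_state r \<and> r ''t'' 0 < r ''h'' 0)"
  proof (rule runs_Seq)
    fix r assume "r = s1"
    then show "runs (While (Neg (Less (Var ''t'') (Var ''h''))) da_step) r (Suc (Suc (weight da_step) * da_potential s1))
        (\<lambda>r. da_state r \<and> r ''t'' 0 < r ''h'' 0)"
      using runs_mono[OF loop] by simp
  qed
  then have "runs da s (2 + Suc (Suc (weight da_step) * da_potential s1)) (\<lambda>r. da_state r \<and> r ''t'' 0 < r ''h'' 0)"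
    unfolding da_def by (rule runs_assoc)
  then show ?thesis
  proof (rule runs_mono)
    show "2 + Suc (Suc (weight da_step) * da_potential s1) \<le> 3 + 108 * m"
      using pot by (simp add: da_step_simps)
    fix r assume r: "da_state r \<and> r ''t'' 0 < r ''h'' 0"
    then have inv: "da_inv (held (r ''mk'')) (r ''py'') (r ''wx'') (r ''cx'') (r ''cy'') False (r ''x'' 0)"
      and qu: "queue (r ''py'') (r ''cy'') (r ''qu'') (r ''h'' 0) (r ''t'' 0)"
      by (auto simp: da_state_def)
    have "last_pos yo m (yo q) < r ''py'' (yo q) \<or> quota I (yo q) \<le> r ''cy'' (yo q)" if "q \<in> ids" for q
    proof (rule ccontr)
      assume "\<not> ?thesis"
      then obtain k where "r ''h'' 0 \<le> k" "k \<le> r ''t'' 0" using qu \<open>q \<in> ids\<close> unfolding queue_def by fastforce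
      then show False using r by simp
    qed
    from da_final[OF inv this] da_invD(3)[OF inv]
    show "side_optimal (opposite X) I (edge ` held (r ''mk'')) \<and> (\<forall>y \<in> ys. card (at_y (held (r ''mk'')) y) = r ''cy'' y)"
      by simp
  qed
qed

end

section \<open>The program for the main loop\<close>

text \<open>The popped agent is a sink. The edge to be removed joins the new top to its
  \<open>s\<close>, and stands under the pointer of the new top.\<close>

definition pop_step :: com where
  "pop_step =
     (Store ''ps'' (Var ''x'') (Const 0) ;;
      Assign ''sp'' (Dec (Var ''sp'')) ;;
      Cond (Equal (Var ''sp'') (Const 0))
        (Assign ''i'' (Inc (Var ''i'')))
        (Assign ''z'' (Cell ''st'' (Var ''sp'')) ;;
         Append ''operations'' (Const 0) ;;
         Append ''operations'' (Var ''z'') ;;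
         Append ''operations'' (Cell ''xe'' (Cell ''px'' (Var ''z''))) ;;
         Store ''px'' (Var ''z'') (Inc (Cell ''px'' (Var ''z'')))))"

definition push_step :: com where
  "push_step =
     (Assign ''z'' (Cell ''ye'' (Var ''w'')) ;;
      Cond (Equal (Cell ''ps'' (Var ''z'')) (Const 0))
        (Assign ''sp'' (Inc (Var ''sp'')) ;;
         Store ''st'' (Var ''sp'') (Var ''z'') ;;
         Store ''ps'' (Var ''z'') (Var ''sp''))
        (Assign ''k'' (Cell ''ps'' (Var ''z''))))"

definition examine_step :: com where
  "examine_step =
     (Assign ''p'' (Cell ''px'' (Var ''x'')) ;;
      Assign ''q'' (Cell ''cr'' (Var ''p'')) ;;
      Assign ''y'' (Cell ''xe'' (Var ''p'')) ;;
      Assign ''w'' (Cell ''wy'' (Var ''y'')) ;;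
      Cond (Conj (Equal (Cell ''mk'' (Var ''q'')) (Const 0)) (Neg (Less (Var ''w'') (Var ''q''))))
        (Cond (Equal (Cell ''mk'' (Var ''w'')) (Const 0))
           (Store ''wy'' (Var ''y'') (Dec (Var ''w'')))
           (Cond (Less (Cell ''cy'' (Var ''y'')) (Cell ''quota'' (Var ''y'')))
              (Append ''operations'' (Const 0) ;;
               Append ''operations'' (Var ''x'') ;;
               Append ''operations'' (Var ''y'') ;;
               Store ''px'' (Var ''x'') (Inc (Var ''p'')))
              push_step))
        (Store ''px'' (Var ''x'') (Inc (Var ''p''))))"

text \<open>\<open>k\<close> reports the stack index at which a cycle begins; 0 is free to mean that
  none was found, as indices start at 1.\<close>

definition search_step :: com where
  "search_step =
     (Assign ''k'' (Const 0) ;;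
      Cond (Equal (Var ''sp'') (Const 0))
        (Assign ''sp'' (Const 1) ;;
         Store ''st'' (Const 1) (Cell ''xo'' (Var ''i'')) ;;
         Store ''ps'' (Cell ''xo'' (Var ''i'')) (Const 1))
        (Assign ''x'' (Cell ''st'' (Var ''sp'')) ;;
         Cond (Less (Cell ''xl'' (Var ''x'')) (Cell ''px'' (Var ''x''))) pop_step examine_step))"

definition count_step :: com where
  "count_step = (Assign ''n'' (Inc (Var ''n'')) ;; Assign ''j'' (Inc (Var ''j'')))"

text \<open>On entry, \<open>y\<close> is the agent before \<open>st j\<close> on the cycle: for the
  first pair it is left over from the search, and each round provides it for the next.\<close>

definition rotate_step :: com where
  "rotate_step =
     (Assign ''x'' (Cell ''st'' (Var ''j'')) ;;
      Append ''operations'' (Var ''y'') ;;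
      Append ''operations'' (Var ''x'') ;;
      Assign ''p'' (Cell ''px'' (Var ''x'')) ;;
      Assign ''y'' (Cell ''xe'' (Var ''p'')) ;;
      Store ''mk'' (Cell ''wy'' (Var ''y'')) (Const 0) ;;
      Store ''mk'' (Cell ''cr'' (Var ''p'')) (Const 1) ;;
      Store ''px'' (Var ''x'') (Inc (Var ''p'')) ;;
      Store ''ps'' (Var ''x'') (Const 0) ;;
      Assign ''j'' (Inc (Var ''j'')))"

text \<open>The cycle is traversed twice because the log contains the length of a rotation before
  its pairs.\<close>

definition rotate :: com where
  "rotate =
     (Assign ''n'' (Const 0) ;; Assign ''j'' (Var ''k'')) ;;
     While (Neg (Less (Var ''sp'') (Var ''j''))) count_step ;;
     (Append ''operations'' (Const 1) ;; Append ''operations'' (Var ''n'') ;; Assign ''j'' (Var ''k'')) ;;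
     While (Neg (Less (Var ''sp'') (Var ''j''))) rotate_step ;;
     Assign ''sp'' (Dec (Var ''k''))"

definition rr_step :: com where
  "rr_step = (search_step ;; Cond (Equal (Var ''k'') (Const 0)) Skip rotate)"

definition rr :: com where
  "rr = (Assign ''i'' (Const 1) ;; While (Neg (Less (Var ''m'') (Var ''i''))) rr_step)"

lemmas search_defs = search_step_def pop_step_def examine_step_def push_step_def

lemma search_step_simps:
  "loop_free search_step" "weight search_step = 41"
  "writes search_step = {''k'', ''sp'', ''st'', ''ps'', ''x'', ''i'', ''z'', ''operations'', ''px'', ''p'', ''q'', ''y'', ''w'', ''wy''}"
  by (auto simp: search_defs)

lemma rotate_step_simps:
  "loop_free rotate_step" "weight rotate_step = 12"
  "writes rotate_step = {''x'', ''operations'', ''p'', ''y'', ''mk'', ''px'', ''ps'', ''j''}"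
  by (auto simp: rotate_step_def)

lemma count_step_simps:
  "loop_free count_step" "weight count_step = 2" "writes count_step = {''n'', ''j''}"
  by (auto simp: count_step_def)

lemma writes_rr_step: "writes rr_step = writes search_step \<union> writes rotate_step \<union> {''n'', ''j'', ''sp''}"
  by (auto simp: rr_step_def rotate_def search_step_simps rotate_step_simps count_step_simps)

lemma runs_count:
  assumes "r ''n'' 0 = 0" "r ''j'' 0 \<le> Suc (r ''sp'' 0)"
  shows "runs (While (Neg (Less (Var ''sp'') (Var ''j''))) count_step) r (Suc (3 * (Suc (r ''sp'' 0) - r ''j'' 0)))
    (\<lambda>r'. r' ''n'' 0 = Suc (r ''sp'' 0) - r ''j'' 0)"
proof -
  let ?b = "Neg (Less (Var ''sp'') (Var ''j''))"
  have "runs (While ?b count_step) r (Suc (Suc (weight count_step) * (Suc (r ''sp'' 0) - r ''j'' 0)))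
      (\<lambda>r'. (r' ''j'' 0 \<le> Suc (r ''sp'' 0) \<and> r' ''n'' 0 + (Suc (r ''sp'' 0) - r' ''j'' 0) = Suc (r ''sp'' 0) - r ''j'' 0) \<and> \<not> bval ?b r')"
  proof (rule runs_While_loop_free[where \<Phi> = "\<lambda>r'. Suc (r ''sp'' 0) - r' ''j'' 0"])
    show "loop_free count_step" by (rule count_step_simps)
    show "r ''j'' 0 \<le> Suc (r ''sp'' 0) \<and> r ''n'' 0 + (Suc (r ''sp'' 0) - r ''j'' 0) = Suc (r ''sp'' 0) - r ''j'' 0"
      using assms by simp
    fix r' assume inv: "r' ''j'' 0 \<le> Suc (r ''sp'' 0) \<and> r' ''n'' 0 + (Suc (r ''sp'' 0) - r' ''j'' 0) = Suc (r ''sp'' 0) - r ''j'' 0"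
      and b: "bval ?b r'" and fr: "frame (writes count_step) r r'"
    have sp: "r' ''sp'' = r ''sp''" using frameD[OF fr] by (simp add: count_step_simps)
    have E: "sem count_step r' ''j'' 0 = Suc (r' ''j'' 0)" "sem count_step r' ''n'' 0 = Suc (r' ''n'' 0)"
      by (simp_all add: count_step_def)
    show "(sem count_step r' ''j'' 0 \<le> Suc (r ''sp'' 0) \<and> sem count_step r' ''n'' 0 + (Suc (r ''sp'' 0) - sem count_step r' ''j'' 0) = Suc (r ''sp'' 0) - r ''j'' 0) \<and>
        Suc (r ''sp'' 0) - sem count_step r' ''j'' 0 < Suc (r ''sp'' 0) - r' ''j'' 0"
      unfolding E using inv b sp by auto
  qed
  then show ?thesis
  proof (rule runs_mono)
    fix r' assume r': "(r' ''j'' 0 \<le> Suc (r ''sp'' 0) \<and> r' ''n'' 0 + (Suc (r ''sp'' 0) - r' ''j'' 0) = Suc (r ''sp'' 0) - r ''j'' 0) \<and> \<not> bval ?b r'"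
      and fr: "frame (writes (While ?b count_step)) r r'"
    have "r' ''sp'' = r ''sp''" using frameD[OF fr] by (simp add: count_step_simps)
    then show "r' ''n'' 0 = Suc (r ''sp'' 0) - r ''j'' 0" using r' by auto
  qed (simp add: count_step_simps)
qed

lemma holds_list_snoc2:
  "holds_list f xs \<Longrightarrow> holds_list (snoc (snoc f a) b) (xs @ [a, b])"
  using holds_list_snoc[OF holds_list_snoc[of f xs a], of b] by simp

lemma holds_list_snoc3:
  "holds_list f xs \<Longrightarrow> holds_list (snoc (snoc (snoc f a) b) c) (xs @ [a, b, c])"
  using holds_list_snoc[OF holds_list_snoc2[of f xs a b], of c] by simp

text \<open>\<open>f\<close> is injective on \<open>S\<close>, being inverted by \<open>ow\<close>;
  so the pointers of \<open>S\<close> abandon \<open>card S\<close> different positions.\<close>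

lemma card_raise_set:
  fixes f :: "'v \<Rightarrow> nat"
  assumes "finite A" "\<And>v. v \<in> S \<Longrightarrow> f v \<in> A \<and> ow (f v) = v"
  shows "card {p \<in> A. (if ow p \<in> S then Suc (f (ow p)) else f (ow p)) \<le> p} + card S \<le> card {p \<in> A. f (ow p) \<le> p}"
proof -
  have inj: "inj_on f S" using assms(2) by (metis inj_onI)
  let ?L = "{p \<in> A. (if ow p \<in> S then Suc (f (ow p)) else f (ow p)) \<le> p}"
  have d: "?L \<inter> f ` S = {}" using assms(2) by auto
  have fin: "finite (f ` S)" using assms by (meson finite_subset image_subsetI)
  have "?L \<union> f ` S \<subseteq> {p \<in> A. f (ow p) \<le> p}" using assms(2) by (auto split: if_splits)
  then have "card (?L \<union> f ` S) \<le> card {p \<in> A. f (ow p) \<le> p}" using assms(1) by (intro card_mono) simp_all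
  moreover have "card (?L \<union> f ` S) = card ?L + card (f ` S)" using assms(1) fin d by (intro card_Un_disjoint) simp_all
  ultimately show ?thesis using card_image[OF inj] by simp
qed

section \<open>Correctness and amortised cost of the iterations\<close>

context loaded
begin

definition rr_at :: "nat set set \<Rightarrow> nat set \<Rightarrow> nat operation list \<Rightarrow> memory \<Rightarrow> bool" where
  "rr_at M0 G ops r \<longleftrightarrow>
     reached M0 ops G (held (r ''mk'')) \<and>
     rr_core G (held (r ''mk'')) (r ''px'') (r ''wy'') (r ''cy'') \<and>
     rr_stack (held (r ''mk'')) (r ''px'') (r ''wy'') (r ''cy'') (r ''st'') (r ''ps'') (r ''sp'' 0) (r ''i'' 0) \<and>
     holds_list (r ''operations'') (concat (map operation_code ops))"

text \<open>
  Lengthening the stack pays for itself; shortening it is paid for by \<open>px\<close>, or by \<open>i\<close> when the last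
  agent is removed.
\<close>

definition rr_potential :: "memory \<Rightarrow> nat" where
  "rr_potential r = 4 * card {p \<in> ids. r ''px'' (xo p) \<le> p} + card {q \<in> ids. q \<le> r ''wy'' (yo q)} +
     (m - r ''sp'' 0) + 2 * (Suc m - r ''i'' 0)"

text \<open>The condition on the cell \<open>y\<close> is there for the log: the rotation starts
  with the \<open>s\<close> of the top of the stack, which the search has just computed.\<close>

definition rotation_found :: "memory \<Rightarrow> bool" where
  "rotation_found r \<longleftrightarrow> 1 \<le> r ''k'' 0 \<and> r ''k'' 0 \<le> r ''sp'' 0 \<and>
     r ''y'' 0 = xe (r ''px'' (r ''st'' (r ''sp'' 0))) \<and>
     step (held (r ''mk'')) (r ''px'') (r ''wy'') (r ''cy'') (r ''st'' (r ''sp'' 0)) (r ''st'' (r ''k'' 0))"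

lemma runs_rotate_loop:
  fixes r :: memory and base :: "nat list"
  defines "k \<equiv> r ''k'' 0" and "e \<equiv> r ''sp'' 0" and "H \<equiv> held (r ''mk'')"
  assumes at: "rr_core G H (r ''px'') (r ''wy'') (r ''cy'')"
      "rr_stack H (r ''px'') (r ''wy'') (r ''cy'') (r ''st'') (r ''ps'') e (r ''i'' 0)"
    and found: "rotation_found r" and j: "r ''j'' 0 = k" and base: "holds_list (r ''operations'') base"
    and fr: "\<And>a. a \<in> static \<Longrightarrow> r a = s a"
  shows "runs (While (Neg (Less (Var ''sp'') (Var ''j''))) rotate_step) r (Suc (13 * (Suc e - k)))
    (\<lambda>r'. r' ''px'' = (\<lambda>x. if x \<in> r ''st'' ` {k..e} then Suc (r ''px'' x) else r ''px'' x) \<and>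
       r' ''ps'' = (\<lambda>x. if x \<in> r ''st'' ` {k..e} then 0 else r ''ps'' x) \<and>
       held (r' ''mk'') = rotated H (r ''px'') (r ''wy'') (r ''st'' ` {k..e}) \<and>
       holds_list (r' ''operations'') (base @ concat (map (\<lambda>(y, x). [y, x]) (rotation_of (r ''px'') (r ''st'') k e))))"
proof -
  let ?b = "Neg (Less (Var ''sp'') (Var ''j''))"
  let ?st = "r ''st''" and ?px = "r ''px''" and ?wy = "r ''wy''" and ?\<rho> = "rotation_of (r ''px'') (r ''st'') k e"
  have S: "r ''xe'' = xe" "r ''cr'' = cr" using fr by (simp_all add: static_def)
  have k: "1 \<le> k" "k \<le> e" using found by (simp_all add: rotation_found_def k_def e_def)
  note K = rr_stackD[OF at(2)]
  have stp: "step H ?px ?wy (r ''cy'') (?st l) (if l = e then ?st k else ?st (Suc l))" if "k \<le> l" "l \<le> e" for l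
    using K(5)[of l] found that k by (simp add: rotation_found_def k_def e_def H_def)
  have stx: "?st l \<in> xo ` ids" if "k \<le> l" "l \<le> e" for l using K(1)[of l] that k by simp
  note F = step_facts[OF at(1) stx stp]
  have len: "length ?\<rho> = Suc e - k" by (simp add: rotation_of_def)
  have nth: "?\<rho> ! (l - k) = (xe (?px (?st (if l = k then e else l - 1))), ?st l)" if "k \<le> l" "l \<le> e" for l
    using that by (auto simp: rotation_of_def)
  \<comment> \<open>The memory looks as if exactly the agents at stack indices \<open>k\<close> to
    \<open>j - 1\<close> had been rotated. The cell \<open>y\<close> precedes \<open>st j\<close> on
    the cycle, where the index before \<open>k\<close> is \<open>e\<close>.\<close>
  define P where "P r' \<longleftrightarrow> k \<le> r' ''j'' 0 \<and> r' ''j'' 0 \<le> Suc e \<and>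
      r' ''y'' 0 = xe (?px (?st (if r' ''j'' 0 = k then e else r' ''j'' 0 - 1))) \<and>
      r' ''px'' = (\<lambda>x. if x \<in> ?st ` {k..<r' ''j'' 0} then Suc (?px x) else ?px x) \<and>
      r' ''ps'' = (\<lambda>x. if x \<in> ?st ` {k..<r' ''j'' 0} then 0 else r ''ps'' x) \<and>
      held (r' ''mk'') = rotated H ?px ?wy (?st ` {k..<r' ''j'' 0}) \<and>
      holds_list (r' ''operations'') (base @ concat (map (\<lambda>(y, x). [y, x]) (take (r' ''j'' 0 - k) ?\<rho>)))"
    for r' :: memory
  have "runs (While ?b rotate_step) r (Suc (Suc (weight rotate_step) * (Suc e - r ''j'' 0))) (\<lambda>r'. P r' \<and> \<not> bval ?b r')"
  proof (rule runs_While_loop_free)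
    show "loop_free rotate_step" by (rule rotate_step_simps)
    show "P r" unfolding P_def
      using j k base found by (simp add: rotated_def rotation_found_def e_def H_def)
    fix r' assume P: "P r'" and b: "bval ?b r'" and fr': "frame (writes rotate_step) r r'"
    have R: "r' ''st'' = ?st" "r' ''wy'' = ?wy" "r' ''sp'' = r ''sp''" "r' ''xe'' = xe" "r' ''cr'' = cr"
      using frameD[OF fr'] S by (simp_all add: rotate_step_simps)
    define l where "l = r' ''j'' 0"
    have l: "k \<le> l" "l \<le> e" using P b R by (simp_all add: P_def l_def e_def)
    define x where "x = ?st l"
    define p where "p = ?px x"
    define y where "y = xe p"
    have nin: "x \<notin> ?st ` {k..<l}"
    proof
      assume "x \<in> ?st ` {k..<l}"
      then obtain l' where l': "l' \<in> {k..<l}" "?st l = ?st l'" by (auto simp: x_def)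
      then have "l = l'" using K(2)[of l] K(2)[of l'] l k by auto
      then show False using l' by simp
    qed
    have Pp: "r' ''px'' x = p" using P nin by (simp add: P_def l_def p_def)
    let ?r = "sem rotate_step r'"
    have E: "?r ''j'' 0 = Suc l" "?r ''y'' 0 = y" "?r ''px'' = (r' ''px'')(x := Suc p)" "?r ''ps'' = (r' ''ps'')(x := 0)"
      "?r ''mk'' = (r' ''mk'')(?wy y := 0, cr p := Suc 0)"
      "?r ''operations'' = snoc (snoc (r' ''operations'') (r' ''y'' 0)) x"
      using R Pp by (simp_all add: rotate_step_def l_def x_def y_def)
    note Fl = F[OF l l, folded x_def, folded p_def, folded y_def]
    have set: "{k..<Suc l} = insert l {k..<l}" using l by auto
    have 1: "held (?r ''mk'') = rotated H ?px ?wy (?st ` {k..<Suc l})"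
    proof -
      have "held (?r ''mk'') = insert (cr p) (held (r' ''mk'') - {?wy y})"
        unfolding E held_insert[OF Fl(2)] held_remove ..
      also have "held (r' ''mk'') = rotated H ?px ?wy (?st ` {k..<l})" using P by (simp add: P_def l_def)
      finally have h: "held (?r ''mk'') = insert (cr p) (rotated H ?px ?wy (?st ` {k..<l}) - {?wy y})" .
      \<comment> \<open>The edges inserted so far were not in \<open>H\<close>, whereas the one
        under \<open>wy\<close> was; so clearing its mark cannot undo an earlier round.\<close>
      have "?wy y \<notin> (\<lambda>x. cr (?px x)) ` ?st ` {k..<l}"
      proof
        assume "?wy y \<in> (\<lambda>x. cr (?px x)) ` ?st ` {k..<l}"
        then obtain l' where l': "k \<le> l'" "l' \<le> e" "?wy y = cr (?px (?st l'))" using l by auto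
        then show False using F(3)[OF l'(1,2) l'(1,2)] Fl(6) by simp
      qed
      then show ?thesis
        unfolding h rotated_def set by (auto simp: x_def p_def y_def)
    qed
    have 2: "take (Suc l - k) ?\<rho> = take (l - k) ?\<rho> @ [(r' ''y'' 0, x)]"
    proof -
      have "Suc l - k = Suc (l - k)" "l - k < length ?\<rho>" using l len by auto
      moreover have "?\<rho> ! (l - k) = (r' ''y'' 0, x)" using nth[OF l] P by (simp add: P_def l_def x_def)
      ultimately show ?thesis by (simp add: take_Suc_conv_app_nth)
    qed
    have "holds_list (r' ''operations'') (base @ concat (map (\<lambda>(y, x). [y, x]) (take (l - k) ?\<rho>)))"
      using P by (simp add: P_def l_def)
    from holds_list_snoc2[OF this, of "r' ''y'' 0" x]
    have 3: "holds_list (?r ''operations'') (base @ concat (map (\<lambda>(y, x). [y, x]) (take (Suc l - k) ?\<rho>)))"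
      unfolding E 2 by simp
    have 4: "?r ''px'' = (\<lambda>x. if x \<in> ?st ` {k..<Suc l} then Suc (?px x) else ?px x)"
      using P unfolding E set by (auto simp: P_def l_def fun_eq_iff x_def p_def)
    have 5: "?r ''ps'' = (\<lambda>x. if x \<in> ?st ` {k..<Suc l} then 0 else r ''ps'' x)"
      using P unfolding E set by (auto simp: P_def l_def fun_eq_iff x_def)
    have "P ?r" unfolding P_def E(1)
      using l 1 3 4 5 E(2) by (simp add: y_def p_def x_def)
    moreover have "Suc e - ?r ''j'' 0 < Suc e - r' ''j'' 0" using E(1) l by (simp add: l_def)
    ultimately show "P ?r \<and> Suc e - ?r ''j'' 0 < Suc e - r' ''j'' 0" ..
  qed
  then show ?thesis
  proof (rule runs_mono)
    show "Suc (Suc (weight rotate_step) * (Suc e - r ''j'' 0)) \<le> Suc (13 * (Suc e - k))"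
      by (simp add: rotate_step_simps j)
    fix r' assume r': "P r' \<and> \<not> bval ?b r'" and fr': "frame (writes (While ?b rotate_step)) r r'"
    have "r' ''sp'' = r ''sp''" using frameD[OF fr'] by (simp add: rotate_step_simps)
    then have "r' ''j'' 0 = Suc e" using r' by (simp add: P_def e_def)
    then show "r' ''px'' = (\<lambda>x. if x \<in> ?st ` {k..e} then Suc (?px x) else ?px x) \<and>
       r' ''ps'' = (\<lambda>x. if x \<in> ?st ` {k..e} then 0 else r ''ps'' x) \<and>
       held (r' ''mk'') = rotated H ?px ?wy (?st ` {k..e}) \<and>
       holds_list (r' ''operations'') (base @ concat (map (\<lambda>(y, x). [y, x]) ?\<rho>))"
      using r' len by (simp add: P_def atLeastLessThanSuc_atLeastAtMost)
  qed
qed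

lemma runs_rotate:
  assumes at: "rr_at M0 G ops r" and found: "rotation_found r" and fr: "\<And>a. a \<in> static \<Longrightarrow> r a = s a"
  shows "runs rotate r (16 * (Suc (r ''sp'' 0) - r ''k'' 0) + 10) (\<lambda>r'.
    (\<exists>G ops. rr_at M0 G ops r') \<and> rr_potential r' + Suc (Suc (Suc (r ''sp'' 0) - r ''k'' 0)) \<le> rr_potential r)"
proof -
  define k where "k = r ''k'' 0"
  define e where "e = r ''sp'' 0"
  define H where "H = held (r ''mk'')"
  define \<rho> where "\<rho> = rotation_of (r ''px'') (r ''st'') k e"
  define S where "S = r ''st'' ` {k..e}"
  define base where "base = concat (map operation_code ops) @ [1, Suc e - k]"
  have core: "rr_core G H (r ''px'') (r ''wy'') (r ''cy'')"
    and stk: "rr_stack H (r ''px'') (r ''wy'') (r ''cy'') (r ''st'') (r ''ps'') e (r ''i'' 0)"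
    and re: "reached M0 ops G H" and ho: "holds_list (r ''operations'') (concat (map operation_code ops))"
    using at by (simp_all add: rr_at_def H_def e_def)
  have k: "1 \<le> k" "k \<le> e" and close: "step H (r ''px'') (r ''wy'') (r ''cy'') (r ''st'' e) (r ''st'' k)"
    using found by (simp_all add: rotation_found_def k_def e_def H_def)
  let ?loop = "While (Neg (Less (Var ''sp'') (Var ''j''))) rotate_step"
  define keep where "keep r1 \<longleftrightarrow> (\<forall>a. a \<notin> {''n'', ''j'', ''operations''} \<longrightarrow> r1 a = r a)" for r1 :: memory
  define Q where "Q r' \<longleftrightarrow>
      (\<exists>G ops. rr_at M0 G ops r') \<and> rr_potential r' + Suc (Suc (Suc e - k)) \<le> rr_potential r" for r'
  have L: "runs (?loop ;; Assign ''sp'' (Dec (Var ''k''))) r1 (Suc (13 * (Suc e - k)) + 1) Q"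
    if keep: "keep r1" and j: "r1 ''j'' 0 = k" and b: "holds_list (r1 ''operations'') base" for r1
  proof -
    have R: "r1 ''mk'' = r ''mk''" "r1 ''px'' = r ''px''" "r1 ''wy'' = r ''wy''" "r1 ''cy'' = r ''cy''" "r1 ''st'' = r ''st''"
      "r1 ''ps'' = r ''ps''" "r1 ''sp'' = r ''sp''" "r1 ''i'' = r ''i''" "r1 ''k'' = r ''k''" "r1 ''y'' = r ''y''"
      using keep by (simp_all add: keep_def)
    have f1: "r1 a = s a" if "a \<in> static" for a
    proof -
      have "a \<notin> {''n'', ''j'', ''operations''}" using that by (auto simp: static_def)
      then have "r1 a = r a" using keep unfolding keep_def by blast
      then show ?thesis using fr[OF that] by (rule trans)
    qed
    have found1: "rotation_found r1" using found by (simp add: rotation_found_def R)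
    have loop: "runs ?loop r1 (Suc (13 * (Suc e - k)))
      (\<lambda>r'. r' ''px'' = (\<lambda>x. if x \<in> S then Suc (r ''px'' x) else r ''px'' x) \<and>
         r' ''ps'' = (\<lambda>x. if x \<in> S then 0 else r ''ps'' x) \<and>
         held (r' ''mk'') = rotated H (r ''px'') (r ''wy'') S \<and>
         holds_list (r' ''operations'') (base @ concat (map (\<lambda>(y, x). [y, x]) \<rho>)))"
      using runs_rotate_loop[of G r1 base, unfolded R, folded k_def e_def H_def, OF core stk found1 j b f1]
      unfolding S_def \<rho>_def .
    show ?thesis
    proof (rule runs_Seq[OF loop])
      fix r' assume r': "r' ''px'' = (\<lambda>x. if x \<in> S then Suc (r ''px'' x) else r ''px'' x) \<and>
         r' ''ps'' = (\<lambda>x. if x \<in> S then 0 else r ''ps'' x) \<and>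
         held (r' ''mk'') = rotated H (r ''px'') (r ''wy'') S \<and>
         holds_list (r' ''operations'') (base @ concat (map (\<lambda>(y, x). [y, x]) \<rho>))"
        and fr': "frame (writes ?loop) r1 r'"
      have R': "r' ''wy'' = r ''wy''" "r' ''cy'' = r ''cy''" "r' ''st'' = r ''st''" "r' ''i'' = r ''i''" "r' ''k'' 0 = k"
        using frameD[OF fr'] R by (simp_all add: rotate_step_simps k_def)
      let ?r = "r'(''sp'' := (r' ''sp'')(0 := k - 1))"
      note rot = rr_rotate[OF core stk k close re S_def refl]
      have code: "concat (map operation_code (ops @ [Eliminate \<rho>])) = base @ concat (map (\<lambda>(y, x). [y, x]) \<rho>)"
        by (simp add: base_def \<rho>_def rotation_of_def)
      have "rr_at M0 G (ops @ [Eliminate \<rho>]) ?r"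
        unfolding rr_at_def code using rot[folded \<rho>_def] r' by (simp add: R')
      moreover have "rr_potential ?r + Suc (Suc (Suc e - k)) \<le> rr_potential r"
      proof -
        have "inj_on (r ''st'') {k..e}"
          by (rule inj_on_inverseI[of _ "r ''ps''"]) (use rr_stackD(2)[OF stk] k in auto)
        then have cS: "card S = Suc e - k" by (simp add: S_def card_image)
        have pos: "r ''px'' x \<in> ids \<and> xo (r ''px'' x) = x" if "x \<in> S" for x
        proof -
          obtain l where l: "k \<le> l" "l \<le> e" "x = r ''st'' l" using \<open>x \<in> S\<close> by (auto simp: S_def)
          have "x \<in> xo ` ids" using rr_stackD(1)[OF stk, of l] l k by simp
          moreover have "r ''px'' x \<le> last_pos xo m x"
            using rr_stackD(5)[OF stk, of l] close l k by (cases "l = e") (simp_all add: step_def)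
          ultimately show ?thesis using rr_position[OF core] by blast
        qed
        from card_raise_set[OF finite_ids, of S "r ''px''" xo, OF pos]
        have "card {p \<in> ids. r' ''px'' (xo p) \<le> p} + (Suc e - k) \<le> card {p \<in> ids. r ''px'' (xo p) \<le> p}"
          using r' cS by simp
        moreover have "e \<le> m" using rr_stack_size[OF stk] .
        \<comment> \<open>With \<open>c\<close> agents on the cycle, \<open>px\<close> contributes a
          drop of at least \<open>4 * c\<close> and the shorter stack a rise of \<open>c\<close>.
          The net drop of \<open>3 * c\<close> is at least \<open>c + 2\<close> because
          \<open>c\<close> is positive.\<close>
        ultimately show ?thesis using k by (simp add: rr_potential_def R' e_def[symmetric])
      qed
      ultimately have "Q ?r" unfolding Q_def by blast
      then show "runs (Assign ''sp'' (Dec (Var ''k''))) r' 1 Q"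
        by (intro runs_loop_free) (simp_all add: R')
    qed
  qed
  have c0: "runs (Assign ''n'' (Const 0) ;; Assign ''j'' (Var ''k'')) r 2
      (\<lambda>r1. r1 ''n'' 0 = 0 \<and> r1 ''j'' 0 = k)"
    by (rule runs_loop_free) (simp_all add: k_def)
  have "runs rotate r (2 + (Suc (3 * (Suc e - k)) + (5 + (Suc (13 * (Suc e - k)) + 1)))) Q"
    unfolding rotate_def
  proof (rule runs_Seq[OF c0])
    fix r1 assume r1: "r1 ''n'' 0 = 0 \<and> r1 ''j'' 0 = k"
      and "frame (writes (Assign ''n'' (Const 0) ;; Assign ''j'' (Var ''k''))) r r1"
    then have f1: "frame {''n'', ''j'', ''operations''} r r1" by (auto simp: frame_def)
    have sp1: "r1 ''sp'' 0 = e" using frameD[OF f1] by (simp add: e_def)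
    have c1: "runs (While (Neg (Less (Var ''sp'') (Var ''j''))) count_step) r1 (Suc (3 * (Suc e - k))) (\<lambda>r2. r2 ''n'' 0 = Suc e - k)"
      using runs_count[of r1] r1 sp1 k by simp
    show "runs (While (Neg (Less (Var ''sp'') (Var ''j''))) count_step ;;
       (Append ''operations'' (Const 1) ;; Append ''operations'' (Var ''n'') ;; Assign ''j'' (Var ''k'')) ;;
       ?loop ;; Assign ''sp'' (Dec (Var ''k''))) r1 (Suc (3 * (Suc e - k)) + (5 + (Suc (13 * (Suc e - k)) + 1))) Q"
    proof (rule runs_Seq[OF c1])
      fix r2 assume n: "r2 ''n'' 0 = Suc e - k"
        and "frame (writes (While (Neg (Less (Var ''sp'') (Var ''j''))) count_step)) r1 r2"
      then have f2: "frame {''n'', ''j'', ''operations''} r r2"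
        using frame_trans[OF f1] by (auto simp: frame_def count_step_simps)
      have R2: "r2 ''k'' 0 = k" using frameD[OF f2] by (simp add: k_def)
      have op: "r2 ''operations'' = r ''operations''"
        using \<open>frame (writes (While (Neg (Less (Var ''sp'') (Var ''j''))) count_step)) r1 r2\<close>
          \<open>frame (writes (Assign ''n'' (Const 0) ;; Assign ''j'' (Var ''k''))) r r1\<close>
        by (simp add: frame_def count_step_simps)
      have c2: "runs (Append ''operations'' (Const 1) ;; Append ''operations'' (Var ''n'') ;; Assign ''j'' (Var ''k'')) r2 5
          (\<lambda>r3. r3 ''j'' 0 = k \<and> r3 ''operations'' = snoc (snoc (r ''operations'') 1) (Suc e - k))"
        by (rule runs_loop_free) (simp_all add: R2 op n)
      show "runs ((Append ''operations'' (Const 1) ;; Append ''operations'' (Var ''n'') ;; Assign ''j'' (Var ''k'')) ;;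
          ?loop ;; Assign ''sp'' (Dec (Var ''k''))) r2 (5 + (Suc (13 * (Suc e - k)) + 1)) Q"
      proof (rule runs_Seq[OF c2])
        fix r3 assume r3: "r3 ''j'' 0 = k \<and> r3 ''operations'' = snoc (snoc (r ''operations'') 1) (Suc e - k)"
          and "frame (writes (Append ''operations'' (Const 1) ;; Append ''operations'' (Var ''n'') ;; Assign ''j'' (Var ''k''))) r2 r3"
        then have "frame {''n'', ''j'', ''operations''} r r3"
          using frame_trans[OF f2] by (auto simp: frame_def)
        then have "keep r3" by (simp add: frame_def keep_def)
        then show "runs (?loop ;; Assign ''sp'' (Dec (Var ''k''))) r3 (Suc (13 * (Suc e - k)) + 1) Q"
          using L r3 holds_list_snoc2[OF ho] by (simp add: base_def)
      qed
    qed
  qed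
  then show ?thesis
    by (rule runs_mono) (simp_all add: Q_def k_def e_def)
qed

lemma cy_quota: "y \<in> ys \<Longrightarrow> s ''quota'' y = quota I y"
  using quota_array by blast

text \<open>Every branch pays by a pointer move, a push or the scan, except the discovery of a
  cycle: that one leaves the potential alone and is charged to the rotation that follows.\<close>

lemma search_step_correct:
  assumes at: "rr_at M0 G ops r" and im: "r ''i'' 0 \<le> m" and fr: "\<And>a. a \<in> static \<Longrightarrow> r a = s a"
  defines "r' \<equiv> sem search_step r"
  shows "r' ''k'' 0 = 0 \<and> (\<exists>G ops. rr_at M0 G ops r') \<and> rr_potential r' < rr_potential r \<or>
    r' ''k'' 0 \<noteq> 0 \<and> rr_at M0 G ops r' \<and> rotation_found r' \<and> rr_potential r' = rr_potential r"
proof -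
  have S: "r ''xo'' = xo" "r ''xe'' = xe" "r ''yo'' = yo" "r ''ye'' = ye" "r ''cr'' = cr" "r ''rc'' = rc"
    "r ''xl'' = last_pos xo m" "r ''quota'' = s ''quota''"
    using fr xl by (simp_all add: static_def)
  define H where "H = held (r ''mk'')"
  define i where "i = r ''i'' 0"
  define e where "e = r ''sp'' 0"
  have core: "rr_core G H (r ''px'') (r ''wy'') (r ''cy'')"
    and stk: "rr_stack H (r ''px'') (r ''wy'') (r ''cy'') (r ''st'') (r ''ps'') e i"
    and re: "reached M0 ops G H" and ho: "holds_list (r ''operations'') (concat (map operation_code ops))"
    using at by (simp_all add: rr_at_def H_def e_def i_def)
  note D = rr_coreD[OF core] and K = rr_stackD[OF stk]
  have im: "i \<le> m" using im by (simp add: i_def)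
  have em: "e \<le> m" using rr_stack_size[OF stk] .
  obtain t where "exec search_step r t r'"
    using exec_sem[OF search_step_simps(1), of r] unfolding r'_def by blast
  note fr' = frameD[OF exec_frame[OF this]]
  have mk: "r' ''mk'' = r ''mk''" and cy: "r' ''cy'' = r ''cy''"
    by (rule fr'; simp add: search_step_simps)+
  show ?thesis
  proof (cases "e = 0")
    case True
    have E: "r' ''k'' 0 = 0" "r' ''px'' = r ''px''" "r' ''wy'' = r ''wy''" "r' ''st'' = (r ''st'')(1 := xo i)"
      "r' ''ps'' = (r ''ps'')(xo i := 1)" "r' ''sp'' 0 = 1" "r' ''i'' 0 = i" "r' ''operations'' = r ''operations''"
      using True S unfolding r'_def by (simp_all add: search_defs e_def i_def)
    have "rr_at M0 G ops r'"
      unfolding rr_at_def E mk cy using re core ho rr_stack_first[OF stk[unfolded True] im] by (simp add: H_def)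
    \<comment> \<open>\<open>1 \<le> i\<close> and \<open>i \<le> m\<close> make \<open>m\<close>
      positive, so the push decreases \<open>m - sp\<close>.\<close>
    moreover have "rr_potential r' < rr_potential r"
      unfolding rr_potential_def E using True im K(8) by (simp add: e_def i_def)
    ultimately show ?thesis using E(1) by blast
  next
    case False
    define x where "x = r ''st'' e"
    have xi: "x \<in> xo ` ids" using K(1)[of e] False by (simp add: x_def)
    then obtain p0 where p0: "p0 \<in> ids" "x = xo p0" by blast
    have xx: "x \<in> xs" using x_mem[OF cr(1)[OF p0(1)]] cr(3)[OF p0(1)] p0(2) by simp
    show ?thesis
    proof (cases "last_pos xo m x < r ''px'' x")
      case fin: True
      obtain n where n: "e = Suc n" using False by (cases e) auto
      show ?thesis
      proof (cases "n = 0")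
        case True
        have E: "r' ''k'' 0 = 0" "r' ''px'' = r ''px''" "r' ''wy'' = r ''wy''" "r' ''st'' = r ''st''"
          "r' ''ps'' = (r ''ps'')(r ''st'' (Suc n) := 0)" "r' ''sp'' 0 = n" "r' ''i'' 0 = Suc i" "r' ''operations'' = r ''operations''"
          using True n S fin unfolding r'_def x_def e_def by (simp_all add: search_defs i_def)
        have "rr_at M0 G ops r'"
          unfolding rr_at_def E mk cy
          using re core ho rr_stack_pop[OF stk[unfolded n], of "Suc i"] fin True n by (simp add: H_def x_def)
        \<comment> \<open>The empty stack costs 1, and the advance of \<open>i\<close> returns
          2.\<close>
        moreover have "rr_potential r' < rr_potential r"
          unfolding rr_potential_def E using True n em im by (simp add: e_def[symmetric] i_def[symmetric])
        ultimately show ?thesis using E(1) by blast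
      next
        case n0: False
        define z where "z = r ''st'' n"
        define p where "p = r ''px'' z"
        have zi: "z \<in> xo ` ids" using K(1)[of n] n n0 by (simp add: z_def)
        have st: "step H (r ''px'') (r ''wy'') (r ''cy'') z x" using K(5)[of n] n n0 by (simp add: z_def x_def)
        note F = step_facts[OF core zi st, folded p_def]
        have E: "r' ''k'' 0 = 0" "r' ''px'' = (r ''px'')(z := Suc p)" "r' ''wy'' = r ''wy''" "r' ''st'' = r ''st''"
          "r' ''ps'' = (r ''ps'')(r ''st'' (Suc n) := 0)" "r' ''sp'' 0 = n" "r' ''i'' 0 = i"
          "r' ''operations'' = snoc (snoc (snoc (r ''operations'') 0) z) (xe p)"
          using n n0 S fin unfolding r'_def x_def e_def by (simp_all add: search_defs i_def z_def p_def)
        have le: "p \<le> last_pos xo m z" using st by (simp add: step_def p_def)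
        \<comment> \<open>The exhausted list of \<open>x\<close> contains no candidate, hence
          \<open>x\<close> is a sink.\<close>
        have "reached M0 (ops @ [Remove z (xe p)]) (G - {cr p}) H"
          using reached_remove[OF re D(2) F(1), of "Some x"] F(13,14) sink_x[OF D(1,2) xx rr_finished[OF core fin]]
          by (simp add: F(4,5))
        moreover have "rr_core (G - {cr p}) H ((r ''px'')(z := Suc p)) (r ''wy'') (r ''cy'')"
          using rr_advance[OF core zi, folded p_def, OF le, of "G - {cr p}"] F(3) by (simp add: cand_def)
        moreover have "rr_stack H ((r ''px'')(z := Suc p)) (r ''wy'') (r ''cy'') (r ''st'') ((r ''ps'')(r ''st'' (Suc n) := 0)) n i"
          using rr_stack_top_px[OF rr_stack_pop[OF stk[unfolded n], of i]] n0 by (simp add: z_def p_def)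
        moreover have "holds_list (r' ''operations'') (concat (map operation_code (ops @ [Remove z (xe p)])))"
          unfolding E using holds_list_snoc3[OF ho] by simp
        ultimately have "rr_at M0 (G - {cr p}) (ops @ [Remove z (xe p)]) r'"
          unfolding rr_at_def E(2-7) mk cy by (simp add: H_def)
        moreover have "rr_potential r' < rr_potential r"
          unfolding rr_potential_def E
          using card_raise[of ids "r ''px''" z xo, folded p_def, OF finite_ids F(11,12)] n em
          by (simp add: e_def[symmetric] i_def)
        ultimately show ?thesis using E(1) by blast
      qed
    next
      case unf: False
      define p where "p = r ''px'' x"
      define q where "q = cr p"
      define y where "y = xe p"
      define w where "w = r ''wy'' y"
      have le: "p \<le> last_pos xo m x" using unf by (simp add: p_def)
      note Q = rr_position[OF core xi, folded p_def, OF le, folded q_def y_def]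
      have e1: "1 \<le> e" using False by simp
      have yy: "y \<in> ys" using y_mem[OF Q(5)] Q(6) by simp
      note inc = card_raise[of ids "r ''px''" x xo, folded p_def, OF finite_ids Q(1,2)]
      show ?thesis
      proof (cases "r ''mk'' q = 0 \<and> q \<le> w")
        case skip: False
        have E: "r' ''k'' 0 = 0" "r' ''px'' = (r ''px'')(x := Suc p)" "r' ''wy'' = r ''wy''" "r' ''st'' = r ''st''"
          "r' ''ps'' = r ''ps''" "r' ''sp'' 0 = e" "r' ''i'' 0 = i" "r' ''operations'' = r ''operations''"
          using False unf skip S unfolding r'_def w_def y_def q_def p_def x_def e_def i_def
          by (cases "r ''mk'' (cr (r ''px'' (r ''st'' (r ''sp'' 0)))) = 0"; simp add: search_defs)+
        have "q \<in> H \<or> r ''wy'' (yo q) < q" using skip Q(5,6) by (auto simp: H_def held_def w_def)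
        then have nc: "\<not> cand G H q" by (rule rr_not_cand[OF core])
        have "rr_core G H ((r ''px'')(x := Suc p)) (r ''wy'') (r ''cy'')"
          using rr_advance[OF core xi, folded p_def, OF le, of G] nc by (simp add: q_def)
        moreover have "rr_stack H ((r ''px'')(x := Suc p)) (r ''wy'') (r ''cy'') (r ''st'') (r ''ps'') e i"
          using rr_stack_top_px[OF stk e1] by (simp add: x_def p_def)
        ultimately have "rr_at M0 G ops r'" unfolding rr_at_def E mk cy using re ho by (simp add: H_def)
        moreover have "rr_potential r' < rr_potential r"
          unfolding rr_potential_def E using inc by (simp add: e_def i_def)
        ultimately show ?thesis using E(1) by blast
      next
        case look: True
        have qH: "q \<notin> H" using look by (simp add: H_def held_def)
        \<comment> \<open>\<open>w\<close> lies between \<open>q\<close> and the end of the list of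
          \<open>y\<close>, so it is a position of \<open>y\<close>, held or not.\<close>
        have "first_pos yo m y \<le> q" using first_pos_le[of q m yo] Q(5,6) by (simp add: ids_def)
        then have wi: "w \<in> ids" "yo w = y"
          using table_owner_between[OF yt, of q w] Q(5,6) look D(6)[of y] by (simp_all add: ids_def w_def)
        show ?thesis
        proof (cases "r ''mk'' w = 0")
          case low: True
          have E: "r' ''k'' 0 = 0" "r' ''px'' = r ''px''" "r' ''wy'' = (r ''wy'')(y := w - 1)" "r' ''st'' = r ''st''"
            "r' ''ps'' = r ''ps''" "r' ''sp'' 0 = e" "r' ''i'' 0 = i" "r' ''operations'' = r ''operations''"
            using False unf look low S unfolding r'_def w_def y_def q_def p_def x_def e_def i_def by (simp_all add: search_defs)
          have wH: "r ''wy'' y \<notin> H" using low by (simp add: H_def held_def w_def)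
          have "rr_at M0 G ops r'"
            unfolding rr_at_def E mk cy using re ho rr_lower[OF core wH] rr_stack_lower[OF stk wH] by (simp add: H_def w_def)
          moreover have "0 < w" using wi(1) by (simp add: ids_def)
          then have "rr_potential r' < rr_potential r"
            unfolding rr_potential_def E
            using card_lower[of ids "r ''wy''" y yo, folded w_def, OF finite_ids wi] by (simp add: e_def i_def)
          ultimately show ?thesis using E(1) by blast
        next
          case mkw: False
          have wH: "w \<in> H" using mkw wi by (simp add: H_def held_def)
          have hyp: "r ''px'' x \<le> last_pos xo m x" "cr (r ''px'' x) \<notin> H"
            "cr (r ''px'' x) \<le> r ''wy'' (xe (r ''px'' x))" "r ''wy'' (xe (r ''px'' x)) \<in> H"
            using le qH look wH by (simp_all add: w_def y_def q_def p_def)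
          note C = rr_cand[OF core xi hyp, folded p_def, folded q_def y_def, folded w_def]
          note A = rr_arcs[OF core xi hyp, folded p_def, folded q_def y_def, folded w_def]
          show ?thesis
          proof (cases "r ''cy'' y < quota I y")
            case under: True
            have E: "r' ''k'' 0 = 0" "r' ''px'' = (r ''px'')(x := Suc p)" "r' ''wy'' = r ''wy''" "r' ''st'' = r ''st''"
              "r' ''ps'' = r ''ps''" "r' ''sp'' 0 = e" "r' ''i'' 0 = i"
              "r' ''operations'' = snoc (snoc (snoc (r ''operations'') 0) x) y"
              using False unf look mkw under S cy_quota[OF yy] unfolding r'_def w_def y_def q_def p_def x_def e_def i_def
              by (simp_all add: search_defs)
            \<comment> \<open>\<open>y\<close> is below its quota, so \<open>next\<close> is the
              vertex \<open>None\<close>, which is always a sink; nothing has to be pushed.\<close>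
            have "reached M0 (ops @ [Remove x y]) (G - {q}) H"
              using reached_remove[OF re D(2) Q(3), of None] A under sink_None by (simp add: Q(4,6))
            moreover have "rr_core (G - {q}) H ((r ''px'')(x := Suc p)) (r ''wy'') (r ''cy'')"
              using rr_advance[OF core xi, folded p_def, OF le, of "G - {q}"] qH by (simp add: cand_def q_def)
            moreover have "rr_stack H ((r ''px'')(x := Suc p)) (r ''wy'') (r ''cy'') (r ''st'') (r ''ps'') e i"
              using rr_stack_top_px[OF stk e1] by (simp add: x_def p_def)
            moreover have "holds_list (r' ''operations'') (concat (map operation_code (ops @ [Remove x y])))"
              unfolding E using holds_list_snoc3[OF ho] by simp
            ultimately have "rr_at M0 (G - {q}) (ops @ [Remove x y]) r'"
              unfolding rr_at_def E(2-7) mk cy by (simp add: H_def)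
            moreover have "rr_potential r' < rr_potential r"
              unfolding rr_potential_def E using inc by (simp add: e_def i_def)
            ultimately show ?thesis using E(1) by blast
          next
            case full: False
            define z where "z = ye w"
            have st: "step H (r ''px'') (r ''wy'') (r ''cy'') (r ''st'' e) z"
              using le qH C(2,3) wH full by (simp add: step_def x_def p_def q_def y_def w_def z_def)
            have zi: "z \<in> xo ` ids" using rc[OF wi(1)] by (metis imageI z_def)
            show ?thesis
            proof (cases "r ''ps'' z = 0")
              case new: True
              have E: "r' ''k'' 0 = 0" "r' ''px'' = r ''px''" "r' ''wy'' = r ''wy''" "r' ''st'' = (r ''st'')(Suc e := z)"
                "r' ''ps'' = (r ''ps'')(z := Suc e)" "r' ''sp'' 0 = Suc e" "r' ''i'' 0 = i" "r' ''operations'' = r ''operations''"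
                using False unf look mkw full new S cy_quota[OF yy] unfolding r'_def z_def w_def y_def q_def p_def x_def e_def i_def
                by (simp_all add: search_defs)
              note push = rr_stack_push[OF stk e1 st new zi]
              have "rr_at M0 G ops r'" unfolding rr_at_def E mk cy using re core ho push by (simp add: H_def)
              \<comment> \<open>The size bound for the longer stack ensures that the truncated
                difference \<open>m - sp\<close> really drops.\<close>
              moreover have "rr_potential r' < rr_potential r"
                unfolding rr_potential_def E using rr_stack_size[OF push] by (simp add: e_def i_def)
              ultimately show ?thesis using E(1) by blast
            next
              case old: False
              have E: "r' ''k'' 0 = r ''ps'' z" "r' ''px'' = r ''px''" "r' ''wy'' = r ''wy''" "r' ''st'' = r ''st''"
                "r' ''ps'' = r ''ps''" "r' ''sp'' 0 = e" "r' ''i'' 0 = i" "r' ''operations'' = r ''operations''" "r' ''y'' 0 = y"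
                using False unf look mkw full old S cy_quota[OF yy] unfolding r'_def z_def w_def y_def q_def p_def x_def e_def i_def
                by (simp_all add: search_defs)
              have "rr_at M0 G ops r'" unfolding rr_at_def E mk cy using re core ho stk by (simp add: H_def)
              moreover have "rotation_found r'"
                unfolding rotation_found_def E mk cy using old K(3,4)[OF old] st by (simp add: H_def y_def p_def x_def)
              moreover have "rr_potential r' = rr_potential r"
                unfolding rr_potential_def E by (simp add: e_def i_def)
              ultimately show ?thesis using E(1) old by simp
            qed
          qed
        qed
      qed
    qed
  qed
qed

end

definition dump_step :: "string \<Rightarrow> string \<Rightarrow> com" where
  "dump_step a b =
     Cond (Equal (Cell ''mk'' (Var ''i'')) (Const 0)) Skip
       (Append a (Cell ''yo'' (Var ''i'')) ;; Append b (Cell ''ye'' (Var ''i'')))"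

context loaded
begin

text \<open>The factor 100 is ample in both cases: a plain search step costs 43 for a drop of at
  least 1, a search that ends in rotating \<open>c\<close> agents costs \<open>52 + 16 * c\<close>
  for a drop of at least \<open>c + 2\<close>.\<close>

lemma rr_step_correct:
  assumes at: "rr_at M0 G ops r" and im: "r ''i'' 0 \<le> m" and fr: "\<And>a. a \<in> static \<Longrightarrow> r a = s a"
  shows "\<exists>n. runs rr_step r n (\<lambda>r'. (\<exists>G ops. rr_at M0 G ops r') \<and> 100 * rr_potential r' + n + 1 \<le> 100 * rr_potential r)"
proof -
  define r1 where "r1 = sem search_step r"
  have s1: "runs search_step r 41 (\<lambda>r'. r' = r1)"
    by (rule runs_loop_free) (simp_all add: search_step_simps r1_def)
  have fr1: "r1 a = s a" if "a \<in> static" for a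
  proof -
    obtain t where "exec search_step r t r1" using exec_sem[OF search_step_simps(1), of r] unfolding r1_def by blast
    from frameD[OF exec_frame[OF this], of a] have "r1 a = r a"
      using that by (auto simp: search_step_simps static_def)
    then show ?thesis using fr[OF that] by (rule trans)
  qed
  have "r1 ''k'' 0 = 0 \<and> (\<exists>G ops. rr_at M0 G ops r1) \<and> rr_potential r1 < rr_potential r \<or>
    r1 ''k'' 0 \<noteq> 0 \<and> rr_at M0 G ops r1 \<and> rotation_found r1 \<and> rr_potential r1 = rr_potential r"
    unfolding r1_def by (rule search_step_correct[OF at im fr])
  then show ?thesis
  proof (elim disjE conjE)
    assume k: "r1 ''k'' 0 = 0" and st: "\<exists>G ops. rr_at M0 G ops r1" and pot: "rr_potential r1 < rr_potential r"
    have "runs rr_step r (41 + Suc 1) (\<lambda>r'. r' = r1)"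
      unfolding rr_step_def
    proof (rule runs_Seq[OF s1])
      fix r' assume "r' = r1"
      then show "runs (Cond (Equal (Var ''k'') (Const 0)) Skip rotate) r' (Suc 1) (\<lambda>r'. r' = r1)"
        using k by (intro runs_Cond runs_loop_free) simp_all
    qed
    then have "runs rr_step r 43 (\<lambda>r'. (\<exists>G ops. rr_at M0 G ops r') \<and> 100 * rr_potential r' + 43 + 1 \<le> 100 * rr_potential r)"
      by (rule runs_mono) (use st pot in auto)
    then show ?thesis by blast
  next
    assume k: "r1 ''k'' 0 \<noteq> 0" and st: "rr_at M0 G ops r1" and found: "rotation_found r1"
      and pot: "rr_potential r1 = rr_potential r"
    define c where "c = Suc (r1 ''sp'' 0) - r1 ''k'' 0"
    have "runs rr_step r (41 + Suc (16 * c + 10)) (\<lambda>r'. (\<exists>G ops. rr_at M0 G ops r') \<and> rr_potential r' + Suc (Suc c) \<le> rr_potential r1)"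
      unfolding rr_step_def
    proof (rule runs_Seq[OF s1])
      fix r' assume r': "r' = r1"
      have "runs rotate r1 (16 * c + 10) (\<lambda>r'. (\<exists>G ops. rr_at M0 G ops r') \<and> rr_potential r' + Suc (Suc c) \<le> rr_potential r1)"
        unfolding c_def by (rule runs_rotate[OF st found fr1])
      then show "runs (Cond (Equal (Var ''k'') (Const 0)) Skip rotate) r' (Suc (16 * c + 10))
          (\<lambda>r'. (\<exists>G ops. rr_at M0 G ops r') \<and> rr_potential r' + Suc (Suc c) \<le> rr_potential r1)"
        using k unfolding r' by (intro runs_Cond) simp_all
    qed
    then have "runs rr_step r (52 + 16 * c) (\<lambda>r'. (\<exists>G ops. rr_at M0 G ops r') \<and> 100 * rr_potential r' + (52 + 16 * c) + 1 \<le> 100 * rr_potential r)"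
      by (rule runs_mono) (use pot in auto)
    then show ?thesis by blast
  qed
qed

lemma runs_rr:
  assumes fr: "\<And>a. a \<in> static \<Longrightarrow> r a = s a" and px: "r ''px'' = first_pos xo m" and wy: "r ''wy'' = last_pos yo m"
    and cy: "\<forall>y \<in> ys. card (at_y (held (r ''mk'')) y) = r ''cy'' y"
    and zero: "r ''sp'' 0 = 0" "r ''ps'' = (\<lambda>_. 0)" "r ''operations'' 0 = 0"
  shows "runs rr r (2 + 800 * m) (\<lambda>r'. \<exists>ops. rr_loop X I (edge ` held (r ''mk'')) ops (edge ` held (r' ''mk'')) \<and>
    holds_list (r' ''operations'') (concat (map operation_code ops)))"
proof -
  let ?b = "Neg (Less (Var ''m'') (Var ''i''))" and ?M0 = "edge ` held (r ''mk'')"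
  define r1 where "r1 = r(''i'' := (r ''i'')(0 := 1))"
  have static1: "r' a = s a" if "frame (writes rr_step) r1 r'" "a \<in> static" for r' a
  proof -
    have "a \<notin> writes rr_step \<and> a \<noteq> ''i''"
      using that(2) by (auto simp: writes_rr_step search_step_simps rotate_step_simps static_def)
    then have "r' a = r a" using frameD[OF that(1)] by (simp add: r1_def)
    then show ?thesis using fr[OF that(2)] by (rule trans)
  qed
  have "rr_at ?M0 ids [] r1"
    unfolding rr_at_def r1_def
    using reached_init rr_core_init[OF held_subset, of "r ''mk''" "r ''cy''"] cy rr_stack_init px wy zero
    by (simp add: holds_list_Nil)
  then have loop: "runs (While ?b rr_step) r1 (Suc (100 * rr_potential r1)) (\<lambda>r'. (\<exists>G ops. rr_at ?M0 G ops r') \<and> \<not> bval ?b r')"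
  proof (intro runs_While)
    fix r' assume "\<exists>G ops. rr_at ?M0 G ops r'" and b: "bval ?b r'" and f: "frame (writes rr_step) r1 r'"
    then obtain G ops where at: "rr_at ?M0 G ops r'" by blast
    have "r' ''m'' 0 = m" using static1[OF f] size by (simp add: static_def)
    then have "r' ''i'' 0 \<le> m" using b by simp
    from rr_step_correct[OF at this static1[OF f]]
    show "\<exists>n. runs rr_step r' n (\<lambda>r''. (\<exists>G ops. rr_at ?M0 G ops r'') \<and> 100 * rr_potential r'' + n + 1 \<le> 100 * rr_potential r')" .
  qed blast
  have "card {p \<in> ids. r1 ''px'' (xo p) \<le> p} \<le> card ids" "card {q \<in> ids. q \<le> r1 ''wy'' (yo q)} \<le> card ids"
    by (rule card_mono; auto)+
  \<comment> \<open>\<open>4 * m\<close> from \<open>px\<close>, \<open>m\<close> from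
    \<open>wy\<close>, \<open>m\<close> from the stack and \<open>2 * m\<close> from the
    scan.\<close>
  then have pot: "rr_potential r1 \<le> 8 * m" by (simp add: rr_potential_def r1_def ids_def)
  have "runs (Assign ''i'' (Const 1)) r 1 (\<lambda>r'. r' = r1)" by (rule runs_loop_free) (simp_all add: r1_def)
  then have "runs rr r (1 + Suc (100 * rr_potential r1)) (\<lambda>r'. \<exists>ops. rr_loop X I ?M0 ops (edge ` held (r' ''mk'')) \<and>
    holds_list (r' ''operations'') (concat (map operation_code ops)))"
    unfolding rr_def
  proof (rule runs_Seq)
    fix r' assume r': "r' = r1"
    show "runs (While ?b rr_step) r' (Suc (100 * rr_potential r1)) (\<lambda>r'. \<exists>ops. rr_loop X I ?M0 ops (edge ` held (r' ''mk'')) \<and>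
        holds_list (r' ''operations'') (concat (map operation_code ops)))"
      unfolding r'
    proof (rule runs_mono[OF loop])
      fix r' assume r': "(\<exists>G ops. rr_at ?M0 G ops r') \<and> \<not> bval ?b r'" and f: "frame (writes (While ?b rr_step)) r1 r'"
      then obtain G ops where "rr_at ?M0 G ops r'" by blast
      then have re: "reached ?M0 ops G (held (r' ''mk''))"
        and core: "rr_core G (held (r' ''mk'')) (r' ''px'') (r' ''wy'') (r' ''cy'')"
        and stk: "rr_stack (held (r' ''mk'')) (r' ''px'') (r' ''wy'') (r' ''cy'') (r' ''st'') (r' ''ps'') (r' ''sp'' 0) (r' ''i'' 0)"
        and ho: "holds_list (r' ''operations'') (concat (map operation_code ops))"
        by (simp_all add: rr_at_def)
      have "r' ''m'' 0 = m" using static1[of r'] f size by (simp add: static_def)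
      then have i: "m < r' ''i'' 0" using r' by simp
      \<comment> \<open>The scan has passed every position, so all owners are exhausted, and a
        candidate would sit at a position of one of them.\<close>
      have "\<not> cand G (held (r' ''mk'')) q" for q
      proof
        assume c: "cand G (held (r' ''mk'')) q"
        then have "q \<in> ids" using rr_coreD(2)[OF core] by (auto simp: cand_def)
        note R = rc[OF this]
        have "last_pos xo m (xo (rc q)) < r' ''px'' (xo (rc q))"
          using rr_stackD(10)[OF stk, of "rc q"] R(1) i by (simp add: ids_def)
        from rr_finished[OF core this c] show False using R(3) by simp
      qed
      from reached_stop[OF re rr_coreD(1,2)[OF core] this] ho
      show "\<exists>ops. rr_loop X I ?M0 ops (edge ` held (r' ''mk'')) \<and> holds_list (r' ''operations'') (concat (map operation_code ops))"
        by blast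
    qed simp
  qed
  then show ?thesis by (rule runs_mono) (use pot in auto)
qed

lemma runs_dump:
  assumes fr: "\<And>a. a \<in> static \<Longrightarrow> r a = s a" and ab: "a \<noteq> b" "a \<notin> {''i'', ''mk''} \<union> static" "b \<notin> {''i'', ''mk''} \<union> static"
    and zero: "r a 0 = 0" "r b 0 = 0"
  shows "runs (For (dump_step a b)) r (2 + 8 * m) (\<lambda>r'. stores_edges r' a b (edge ` held (r ''mk'')))"
proof -
  define L where "L i = filter (\<lambda>q. r ''mk'' q \<noteq> 0) [1..<i]" for i
  define P where "P i r' \<longleftrightarrow> holds_list (r' a) (map yo (L i)) \<and> holds_list (r' b) (map ye (L i))" for i and r' :: memory
  have w: "writes (dump_step a b) = {a, b}" by (auto simp: dump_step_def)
  have "runs (For (dump_step a b)) r (2 + (weight (dump_step a b) + 2) * m) (P (Suc m))"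
  proof (rule runs_For[where P = P])
    show "loop_free (dump_step a b)" by (simp add: dump_step_def)
    show "''i'' \<notin> writes (dump_step a b)" "''m'' \<notin> writes (dump_step a b)" using ab by (auto simp: w static_def)
    show "r ''m'' 0 = m" using fr size by (simp add: static_def)
    show "P i (r(''i'' := f))" if "P i r" for i r f using that ab by (auto simp: P_def)
    show "P 1 r" using zero by (simp add: P_def L_def holds_list_Nil)
    fix i r' assume i: "1 \<le> i" "i \<le> m" "r' ''i'' 0 = i" and P: "P i r'" and f: "frame (insert ''i'' (writes (dump_step a b))) r r'"
    have ne: "c \<noteq> a" "c \<noteq> b" "c \<noteq> ''i''" if "c \<in> {''mk'', ''yo'', ''ye''}" for c
      using that ab by (auto simp: static_def)
    have ia: "''i'' \<noteq> a" "''i'' \<noteq> b" using ab by auto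
    have R: "r' ''mk'' = r ''mk''" "r' ''yo'' = yo" "r' ''ye'' = ye"
      using frameD[OF f, of "''mk''"] frameD[OF f, of "''yo''"] frameD[OF f, of "''ye''"] ne fr
      by (auto simp: w static_def)
    have L: "L (Suc i) = L i @ (if r ''mk'' i = 0 then [] else [i])" using i(1) by (simp add: L_def)
    show "P (Suc i) (sem (dump_step a b) r')"
    proof (cases "r ''mk'' i = 0")
      case True
      then have "sem (dump_step a b) r' = r'" using i(3) R by (simp add: dump_step_def)
      then show ?thesis using P True by (simp add: P_def L)
    next
      case False
      then have "sem (dump_step a b) r' = r'(a := snoc (r' a) (yo i), b := snoc (r' b) (ye i))"
        using i(3) R ab ne[of "''ye''"] ne[of "''mk''"] ia by (simp add: dump_step_def)
      then show ?thesis using P False ab(1) holds_list_snoc[of _ "map yo (L i)" "yo i"] holds_list_snoc[of _ "map ye (L i)" "ye i"]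
        by (simp add: P_def L)
    qed
  qed
  then show ?thesis
  proof (rule runs_mono)
    show "2 + (weight (dump_step a b) + 2) * m \<le> 2 + 8 * m" by (simp add: dump_step_def)
    fix r' assume r': "P (Suc m) r'"
    let ?es = "map (\<lambda>q. (yo q, ye q)) (L (Suc m))"
    have set: "set (L (Suc m)) = held (r ''mk'')" by (auto simp: L_def held_def ids_def)
    have 1: "map (\<lambda>(u, v). {u, v}) ?es = map edge (L (Suc m))" by (simp add: edge_def)
    have "distinct (L (Suc m))" by (simp add: L_def)
    then have 2: "distinct (map edge (L (Suc m)))"
      using inj_on_subset[OF inj_edge held_subset] by (simp add: distinct_map set)
    have 3: "map fst ?es = map yo (L (Suc m))" "map snd ?es = map ye (L (Suc m))" by simp_all
    show "stores_edges r' a b (edge ` held (r ''mk''))"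
      unfolding stores_edges_def stores_iff_holds_list
    proof (intro exI[of _ ?es] conjI)
      show "distinct (map (\<lambda>(u, v). {u, v}) ?es)" unfolding 1 by (rule 2)
      show "edge ` held (r ''mk'') = (\<lambda>(u, v). {u, v}) ` set ?es" by (simp add: set image_image edge_def)
      show "holds_list (r' a) (map fst ?es)" "holds_list (r' b) (map snd ?es)" unfolding 3 using r' by (simp_all only: P_def)
    qed
  qed
qed

end

section \<open>The complete program\<close>

definition program :: "side \<Rightarrow> com" where
  "program X =
     (Assign ''m'' (Var (owner_array X)) ;; For (copy_step X) ;; For index_step ;; cross ;; da ;;
      For (dump_step ''initial_fst'' ''initial_snd'') ;; rr ;; For (dump_step ''output_fst'' ''output_snd''))"

lemma writes_simps:
  "writes (copy_step X) = {''xo'', ''xe'', ''yo'', ''ye'', ''qu''}"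
  "writes index_step = {''xl'', ''wx'', ''px'', ''yl'', ''wy'', ''py'', ''nx'', ''hd''}"
  "writes cross = {''cr'', ''rc'', ''i'', ''r'', ''tp'', ''hd''}"
  "writes da = {''w'', ''wx'', ''mk'', ''y'', ''cy'', ''cx'', ''t'', ''qu'', ''ov'', ''q'', ''py'', ''x'', ''h''}"
  "writes (dump_step a b) = {a, b}"
  "writes rr = {''k'', ''sp'', ''st'', ''ps'', ''x'', ''i'', ''z'', ''operations'', ''px'', ''p'', ''q'', ''y'', ''w'', ''wy'',
     ''mk'', ''j'', ''n''}"
  by (auto simp: copy_step_def index_step_def cross_def cross_step_def da_def da_step_simps dump_step_def rr_def
      writes_rr_step search_step_simps rotate_step_simps)

lemma frame_Un: "frame W s s' \<Longrightarrow> frame W' s' s'' \<Longrightarrow> frame (W \<union> W') s s''"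
  by (simp add: frame_def)

lemma stores_edges_cong:
  "stores_edges r a b M \<Longrightarrow> r' a = r a \<Longrightarrow> r' b = r b \<Longrightarrow> stores_edges r' a b M"
  unfolding stores_edges_def stores_def by metis

lemma input_memory_arrays:
  assumes "input_memory I s"
  shows "\<exists>tbl. \<forall>Z. pref_table I Z (tbl Z) \<and> s (owner_array Z) = list_array (map fst (tbl Z)) \<and>
      s (entry_array Z) = list_array (map snd (tbl Z))"
    and "v \<in> students I \<union> schools I \<Longrightarrow> s ''quota'' v = quota I v"
    and "a \<notin> {''student_owner'', ''student_entry'', ''school_owner'', ''school_entry'', ''quota''} \<Longrightarrow> s a = (\<lambda>_. 0)"
proof -
  obtain ps qs where p: "pref_table I Students ps" "pref_table I Schools qs"
    and s: "s = (\<lambda>_ _. 0)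
          (''student_owner'' := list_array (map fst ps),
           ''student_entry'' := list_array (map snd ps),
           ''school_owner'' := list_array (map fst qs),
           ''school_entry'' := list_array (map snd qs),
           ''quota'' := (\<lambda>v. if v \<in> students I \<union> schools I then quota I v else 0))"
    using assms unfolding input_memory_def by blast
  have "pref_table I Z (case_side ps qs Z) \<and> s (owner_array Z) = list_array (map fst (case_side ps qs Z)) \<and>
      s (entry_array Z) = list_array (map snd (case_side ps qs Z))" for Z
    using p by (cases Z) (simp_all add: s)
  then show "\<exists>tbl. \<forall>Z. pref_table I Z (tbl Z) \<and> s (owner_array Z) = list_array (map fst (tbl Z)) \<and>
      s (entry_array Z) = list_array (map snd (tbl Z))"
    by (intro exI[of _ "case_side ps qs"]) blast
qed (use assms in \<open>auto simp: input_memory_def\<close>)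

text \<open>The phases from \<open>copy_step\<close> to the final dump cost 7, 14, 16, 108, 8, 800
  and 8 units per edge, 961 in total.\<close>

lemma runs_program:
  assumes inst: "stable_assignment_instance I" and inp: "input_memory I s" and m: "m = card (edges I)"
  shows "runs (program X) s (16 + 961 * m) (\<lambda>s'. \<exists>M0 ops M. rotate_remove_run X I M0 ops M \<and> output_memory s' M0 ops M)"
proof -
  note quota = input_memory_arrays(2)[OF inp] and zero = input_memory_arrays(3)[OF inp]
  obtain tbl where tbl: "\<And>Z. pref_table I Z (tbl Z)"
    and arrays: "\<And>Z. s (owner_array Z) = list_array (map fst (tbl Z))" "\<And>Z. s (entry_array Z) = list_array (map snd (tbl Z))"
    using input_memory_arrays(1)[OF inp] by blast
  have tab0: "table I Z (length (tbl Z)) (s (owner_array Z)) (s (entry_array Z))" for Z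
    using pref_table_table[OF inst tbl] arrays by simp
  have len: "length (tbl Z) = m" for Z using table_card[OF tab0] m by simp
  note tab = tab0[unfolded len]
  have m0: "s (owner_array X) 0 = m" by (simp add: arrays list_array_def len)
  have union: "members I X \<union> members I (opposite X) = students I \<union> schools I" by (cases X) auto
  let ?ini = "For (dump_step ''initial_fst'' ''initial_snd'')"
  let ?fin = "For (dump_step ''output_fst'' ''output_snd'')"
  define Q where "Q s' \<longleftrightarrow> (\<exists>M0 ops M. rotate_remove_run X I M0 ops M \<and> output_memory s' M0 ops M)" for s'
  have c1: "runs (Assign ''m'' (Var (owner_array X))) s 1 (\<lambda>r. r ''m'' 0 = m)"
    by (rule runs_loop_free) (simp_all add: m0)
  have "runs (program X) s (1 + ((2 + 7 * m) + ((2 + 14 * m) + ((2 + 16 * m) + ((3 + 108 * m) + ((2 + 8 * m) + ((2 + 800 * m) + (2 + 8 * m)))))))) Q"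
    unfolding program_def
  proof (rule runs_Seq[OF c1], rule runs_Seq[OF runs_copy])
    fix r1 r2 assume r1: "r1 ''m'' 0 = m" and "frame (writes (Assign ''m'' (Var (owner_array X)))) s r1"
    then show "r1 ''m'' 0 = m" by simp
    have f1: "frame {''m''} s r1" using \<open>frame (writes (Assign ''m'' (Var (owner_array X)))) s r1\<close> by simp
    have in1: "r1 (owner_array Z) = s (owner_array Z)" "r1 (entry_array Z) = s (entry_array Z)" for Z
      using frameD[OF f1] by (cases Z; simp)+
    assume "\<forall>p \<in> {1..m}. r2 ''xo'' p = r1 (owner_array X) p \<and> r2 ''xe'' p = r1 (entry_array X) p \<and>
        r2 ''yo'' p = r1 (owner_array (opposite X)) p \<and> r2 ''ye'' p = r1 (entry_array (opposite X)) p \<and> r2 ''qu'' p = r2 ''yo'' p"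
      and f2: "frame (writes (For (copy_step X))) r1 r2"
    then have cp: "\<And>p. p \<in> {1..m} \<Longrightarrow> r2 ''xo'' p = s (owner_array X) p \<and> r2 ''xe'' p = s (entry_array X) p"
      "\<And>p. p \<in> {1..m} \<Longrightarrow> r2 ''yo'' p = s (owner_array (opposite X)) p \<and> r2 ''ye'' p = s (entry_array (opposite X)) p"
      and qu2: "\<forall>p \<in> {1..m}. r2 ''qu'' p = r2 ''yo'' p"
      by (simp_all add: in1)
    have xt2: "table I X m (r2 ''xo'') (r2 ''xe'')" using table_cong[OF tab cp(1)] .
    have yt2: "table I (opposite X) m (r2 ''yo'') (r2 ''ye'')" using table_cong[OF tab cp(2)] .
    have F2: "frame {''m'', ''i'', ''xo'', ''xe'', ''yo'', ''ye'', ''qu''} s r2"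
      using frame_Un[OF f1 f2] by (simp add: writes_simps insert_commute)
    have m2: "r2 ''m'' 0 = m" using frameD[OF f2, of "''m''"] r1 by (simp add: writes_simps)
    have z2: "r2 a = (\<lambda>_. 0)" if "a \<in> {''xl'', ''wx'', ''px'', ''yl'', ''wy'', ''py'', ''hd''}" for a
      using that frameD[OF F2, of a] zero[of a] by auto
    have idx: "runs (For index_step) r2 (2 + 14 * m) (\<lambda>r3.
        r3 ''xl'' = last_pos (r2 ''xo'') m \<and> r3 ''wx'' = last_pos (r2 ''xo'') m \<and> r3 ''px'' = first_pos (r2 ''xo'') m \<and>
        r3 ''yl'' = last_pos (r2 ''yo'') m \<and> r3 ''wy'' = last_pos (r2 ''yo'') m \<and> r3 ''py'' = first_pos (r2 ''yo'') m \<and>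
        r3 ''hd'' = last_pos (r2 ''ye'') m \<and> (\<forall>q \<in> {1..m}. r3 ''nx'' q = last_pos (r2 ''ye'') (q - 1) (r2 ''ye'' q)))"
      by (rule runs_index[of r2 m, OF m2]) (rule z2)
    show "runs (For index_step ;; cross ;; da ;; ?ini ;; rr ;; ?fin)
      r2 ((2 + 14 * m) + ((2 + 16 * m) + ((3 + 108 * m) + ((2 + 8 * m) + ((2 + 800 * m) + (2 + 8 * m)))))) Q"
    proof (rule runs_Seq[OF idx])
      fix r3 assume ix: "r3 ''xl'' = last_pos (r2 ''xo'') m \<and> r3 ''wx'' = last_pos (r2 ''xo'') m \<and> r3 ''px'' = first_pos (r2 ''xo'') m \<and>
         r3 ''yl'' = last_pos (r2 ''yo'') m \<and> r3 ''wy'' = last_pos (r2 ''yo'') m \<and> r3 ''py'' = first_pos (r2 ''yo'') m \<and>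
         r3 ''hd'' = last_pos (r2 ''ye'') m \<and> (\<forall>q \<in> {1..m}. r3 ''nx'' q = last_pos (r2 ''ye'') (q - 1) (r2 ''ye'' q))"
        and f3: "frame (writes (For index_step)) r2 r3"
      have e3: "r3 ''xo'' = r2 ''xo''" "r3 ''xe'' = r2 ''xe''" "r3 ''yo'' = r2 ''yo''" "r3 ''ye'' = r2 ''ye''" "r3 ''qu'' = r2 ''qu''" "r3 ''m'' = r2 ''m''"
        using frameD[OF f3] by (simp_all add: writes_simps)
      have F3: "frame ({''m'', ''i'', ''xo'', ''xe'', ''yo'', ''ye'', ''qu''} \<union> insert ''i'' (writes index_step)) s r3"
        using frame_Un[OF F2 f3] by simp
      have cross: "runs cross r3 (2 + 16 * m) (\<lambda>s'. \<forall>p \<in> {1..m}. s' ''cr'' p \<in> {1..m} \<and>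
          r3 ''yo'' (s' ''cr'' p) = r3 ''xe'' p \<and> r3 ''ye'' (s' ''cr'' p) = r3 ''xo'' p \<and> s' ''rc'' (s' ''cr'' p) = p)"
        by (rule runs_cross[OF _ inst, of _ _ X]) (use xt2 yt2 ix m2 in \<open>simp_all add: e3\<close>)
      show "runs (cross ;; da ;; ?ini ;; rr ;; ?fin)
          r3 ((2 + 16 * m) + ((3 + 108 * m) + ((2 + 8 * m) + ((2 + 800 * m) + (2 + 8 * m))))) Q"
      proof (rule runs_Seq[OF cross])
        fix r4 assume cr: "\<forall>p \<in> {1..m}. r4 ''cr'' p \<in> {1..m} \<and>
          r3 ''yo'' (r4 ''cr'' p) = r3 ''xe'' p \<and> r3 ''ye'' (r4 ''cr'' p) = r3 ''xo'' p \<and> r4 ''rc'' (r4 ''cr'' p) = p"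
          and f4: "frame (writes cross) r3 r4"
        have e4: "r4 ''xo'' = r2 ''xo''" "r4 ''xe'' = r2 ''xe''" "r4 ''yo'' = r2 ''yo''" "r4 ''ye'' = r2 ''ye''" "r4 ''qu'' = r2 ''qu''" "r4 ''m'' = r2 ''m''"
          "r4 ''xl'' = last_pos (r2 ''xo'') m" "r4 ''yl'' = last_pos (r2 ''yo'') m" "r4 ''wx'' = last_pos (r2 ''xo'') m"
          "r4 ''px'' = first_pos (r2 ''xo'') m" "r4 ''wy'' = last_pos (r2 ''yo'') m" "r4 ''py'' = first_pos (r2 ''yo'') m"
          using frameD[OF f4] ix by (simp_all add: writes_simps e3)
        have F4: "frame ({''m'', ''i'', ''xo'', ''xe'', ''yo'', ''ye'', ''qu''} \<union> insert ''i'' (writes index_step) \<union> writes cross) s r4"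
          using frame_Un[OF F3 f4] by simp
        have z4: "r4 a = (\<lambda>_. 0)" if "a \<in> {''mk'', ''cx'', ''cy'', ''ov'', ''sp'', ''ps'', ''operations'', ''initial_fst'', ''initial_snd'', ''output_fst'', ''output_snd''}" for a
          using that frameD[OF F4, of a] zero[of a] by (auto simp: writes_simps)
        have q4: "r4 ''quota'' = s ''quota''" using frameD[OF F4] by (simp add: writes_simps)
        \<comment> \<open>From this state on the tables are fixed: the remaining phases write no
          array in \<open>static\<close>.\<close>
        interpret L: loaded X I m r4
        proof
          show "table I X m (r4 ''xo'') (r4 ''xe'')" "table I (opposite X) m (r4 ''yo'') (r4 ''ye'')" using xt2 yt2 by (simp_all add: e4)
          show "\<forall>p \<in> {1..m}. r4 ''cr'' p \<in> {1..m} \<and> r4 ''yo'' (r4 ''cr'' p) = r4 ''xe'' p \<and> r4 ''ye'' (r4 ''cr'' p) = r4 ''xo'' p \<and> r4 ''rc'' (r4 ''cr'' p) = p"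
            using cr by (simp add: e3 e4)
          show "r4 ''quota'' v = quota I v" if "v \<in> members I X \<union> members I (opposite X)" for v
            using that quota unfolding q4 union by blast
        qed (simp_all add: e4 m2 inst)
        have da: "runs da r4 (3 + 108 * m) (\<lambda>r. side_optimal (opposite X) I (L.edge ` L.held (r ''mk'')) \<and>
            (\<forall>y \<in> members I (opposite X). card (L.at_y (L.held (r ''mk'')) y) = r ''cy'' y))"
          by (rule L.runs_da) (use qu2 z4 in \<open>auto simp: e4\<close>)
        show "runs (da ;; ?ini ;; rr ;; ?fin)
            r4 ((3 + 108 * m) + ((2 + 8 * m) + ((2 + 800 * m) + (2 + 8 * m)))) Q"
        proof (rule runs_Seq[OF da])
          fix r5 assume opt: "side_optimal (opposite X) I (L.edge ` L.held (r5 ''mk'')) \<and>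
              (\<forall>y \<in> members I (opposite X). card (L.at_y (L.held (r5 ''mk'')) y) = r5 ''cy'' y)"
            and f5: "frame (writes da) r4 r5"
          have s5: "r5 a = r4 a" if "a \<in> static" for a
            using that frameD[OF f5, of a] by (auto simp: writes_simps static_def)
          have z5: "r5 a = (\<lambda>_. 0)" if "a \<in> {''sp'', ''ps'', ''operations'', ''initial_fst'', ''initial_snd'', ''output_fst'', ''output_snd''}" for a
            using that frameD[OF f5, of a] z4[of a] by (auto simp: writes_simps)
          have d5: "runs ?ini r5 (2 + 8 * m)
              (\<lambda>r. stores_edges r ''initial_fst'' ''initial_snd'' (L.edge ` L.held (r5 ''mk'')))"
            by (rule L.runs_dump[of r5, OF s5]) (use z5 in \<open>auto simp: static_def\<close>)
          show "runs (?ini ;; rr ;; ?fin)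
              r5 ((2 + 8 * m) + ((2 + 800 * m) + (2 + 8 * m))) Q"
          proof (rule runs_Seq[OF d5])
            fix r6 assume init: "stores_edges r6 ''initial_fst'' ''initial_snd'' (L.edge ` L.held (r5 ''mk''))"
              and f6: "frame (writes ?ini) r5 r6"
            have s6: "r6 a = r4 a" if "a \<in> static" for a
              using that frameD[OF f6, of a] s5[OF that] by (auto simp: writes_simps static_def)
            have e6: "r6 ''mk'' = r5 ''mk''" "r6 ''cy'' = r5 ''cy''" "r6 ''px'' = r4 ''px''" "r6 ''wy'' = r4 ''wy''"
              using frameD[OF f6] frameD[OF f5] by (simp_all add: writes_simps)
            have z6: "r6 a = (\<lambda>_. 0)" if "a \<in> {''sp'', ''ps'', ''operations'', ''output_fst'', ''output_snd''}" for a
              using that frameD[OF f6, of a] z5[of a] by (auto simp: writes_simps)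
            have rr6: "runs rr r6 (2 + 800 * m) (\<lambda>r. \<exists>ops. rr_loop X I (L.edge ` L.held (r6 ''mk'')) ops (L.edge ` L.held (r ''mk'')) \<and>
                holds_list (r ''operations'') (concat (map operation_code ops)))"
              by (rule L.runs_rr[of r6, OF s6]) (use opt z6 in \<open>simp_all add: e4 e6\<close>)
            show "runs (rr ;; ?fin) r6 ((2 + 800 * m) + (2 + 8 * m)) Q"
            proof (rule runs_Seq[OF rr6])
              fix r7 assume "\<exists>ops. rr_loop X I (L.edge ` L.held (r6 ''mk'')) ops (L.edge ` L.held (r7 ''mk'')) \<and>
                  holds_list (r7 ''operations'') (concat (map operation_code ops))"
                and f7: "frame (writes rr) r6 r7"
              then obtain ops where rl: "rr_loop X I (L.edge ` L.held (r5 ''mk'')) ops (L.edge ` L.held (r7 ''mk''))"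
                and ho: "holds_list (r7 ''operations'') (concat (map operation_code ops))" by (auto simp: e6)
              have s7: "r7 a = r4 a" if "a \<in> static" for a
                using that frameD[OF f7, of a] s6[OF that] by (auto simp: writes_simps static_def)
              have z7: "r7 a = (\<lambda>_. 0)" if "a \<in> {''output_fst'', ''output_snd''}" for a
                using that frameD[OF f7, of a] z6[of a] by (auto simp: writes_simps)
              have i7: "stores_edges r7 ''initial_fst'' ''initial_snd'' (L.edge ` L.held (r5 ''mk''))"
                by (rule stores_edges_cong[OF init]) (use frameD[OF f7] in \<open>simp_all add: writes_simps\<close>)
              have d7: "runs ?fin r7 (2 + 8 * m)
                  (\<lambda>r. stores_edges r ''output_fst'' ''output_snd'' (L.edge ` L.held (r7 ''mk'')))"
                by (rule L.runs_dump[of r7, OF s7]) (use z7 in \<open>auto simp: static_def\<close>)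
              show "runs ?fin r7 (2 + 8 * m) Q"
              proof (rule runs_mono[OF d7])
                fix r8 assume out: "stores_edges r8 ''output_fst'' ''output_snd'' (L.edge ` L.held (r7 ''mk''))"
                  and f8: "frame (writes ?fin) r7 r8"
                have i8: "stores_edges r8 ''initial_fst'' ''initial_snd'' (L.edge ` L.held (r5 ''mk''))"
                  by (rule stores_edges_cong[OF i7]) (use frameD[OF f8] in \<open>simp_all add: writes_simps\<close>)
                have "r8 ''operations'' = r7 ''operations''" using frameD[OF f8] by (simp add: writes_simps)
                then have "output_memory r8 (L.edge ` L.held (r5 ''mk'')) ops (L.edge ` L.held (r7 ''mk''))"
                  using i8 out ho by (simp add: output_memory_def stores_iff_holds_list)
                moreover have "rotate_remove_run X I (L.edge ` L.held (r5 ''mk'')) ops (L.edge ` L.held (r7 ''mk''))"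
                  using opt rl by (simp add: rotate_remove_run_def)
                ultimately show "Q r8" unfolding Q_def by blast
              qed simp
            qed
          qed
        qed
      qed
    qed
  qed
  then show ?thesis
    by (rule runs_mono) (simp_all add: Q_def)
qed

theorem theorem6:
  fixes X :: side
  shows "\<exists>(c :: com) (T :: nat \<Rightarrow> nat).
    (\<lambda>m. real (T m)) \<in> O(\<lambda>m. real m) \<and>
    (\<forall>(I :: nat inst) s. stable_assignment_instance I \<and> input_memory I s \<longrightarrow>
       (\<exists>t s' M0 ops M.
          exec c s t s' \<and> t \<le> T (card (edges I)) \<and>
          rotate_remove_run X I M0 ops M \<and> output_memory s' M0 ops M))"
proof (rule exI[of _ "program X"], rule exI[of _ "\<lambda>m. 16 + 961 * m"], intro conjI allI impI)
  show "(\<lambda>m. real (16 + 961 * m)) \<in> O(\<lambda>m. real m)"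
    \<comment> \<open>For \<open>m \<ge> 1\<close> the constant 16 is absorbed into
      \<open>977 = 16 + 961\<close>.\<close>
    by (rule bigoI[of _ 977]) (auto intro!: eventually_at_top_linorderI[of 1])
next
  fix I :: "nat inst" and s
  assume "stable_assignment_instance I \<and> input_memory I s"
  then have "runs (program X) s (16 + 961 * card (edges I))
      (\<lambda>s'. \<exists>M0 ops M. rotate_remove_run X I M0 ops M \<and> output_memory s' M0 ops M)"
    using runs_program by blast
  then show "\<exists>t s' M0 ops M. exec (program X) s t s' \<and> t \<le> 16 + 961 * card (edges I) \<and>
      rotate_remove_run X I M0 ops M \<and> output_memory s' M0 ops M"
    unfolding runs_def by blast
qed

end
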